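(* (1) Let $k\ge0$, $n\ge1$ be integers and $\lambda/\eta$ a skew diagram. Then $$p_n[h_k]\,s_{\lambda/\eta}=\sum_{\rho,\mu}(-1)^{|\eta/\mu|}\operatorname{sgn}(\rho/\lambda)\operatorname{sgn}(\eta^t/\mu^t)\,s_{\rho/\mu},$$ where the sum ranges over all partitions $\rho\supset\lambda$, $\mu\subset\eta$ such that both $\rho/\lambda$ and $\eta^t/\mu^t$ are horizontal $n$-ribbons and the sum of their weights is $k$. (2) Let $k\ge1$, $m\ge0$ be integers and $\eta\subset\lambda$ partitions. Then $$G(k,m)\,s_{\lambda/\eta}=\sum_{\rho,\mu}(-1)^{|\eta/\mu|}\operatorname{sgn}'(\rho/\lambda)\operatorname{sgn}'(\eta^t/\mu^t)\,s_{\rho/\mu},$$ where the sum ranges over all partitions $\rho\supset\lambda$ and $\mu\subset\eta$ such that $|\rho/\lambda|+|\eta/\mu|=m$ and both $\rho/\lambda$ and $\eta^t/\mu^t$ are good proper $k$-ribbons with $\rho_i-\lambda_i<k$ and $\eta^t_i-\mu^t_i<k$ for all $i$. (3) Let $k\ge1$ and $\mu\subset\lambda$ partitions. Then the skew modular Schur function expands as $$\mathfrak s^{(k)}_{\lambda/\mu}=\sum_\nu\ \sum_{(\mathcal T,\mathscr T)}\operatorname{sgn}(\mathcal T)\operatorname{sgn}'(\mathscr T)\,s_\nu,$$ where the inner sum runs over all pairs consisting of a special ribbon tableau $\mathcal T$ of shape $\lambda/\mu$ and a good proper $k$-ribbon tableau $\mathscr T$ of shape $\nu$ having the same type.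
   Context: All symmetric functions are in $X=(x_1,x_2,\dots)$; $p_n[h_k]=h_k(x_1^n,x_2^n,\dots)$; $\lambda^t$ is the conjugate partition. A ribbon is a connected skew diagram with no $2\times2$ block; an $n$-ribbon is a ribbon with $n$ boxes; its height $\mathrm{ht}$ is its number of rows minus $1$; its starting/ending box is its southwest-most/northeast-most box. **Horizontal $n$-ribbons.** $\rho/\lambda$ is a horizontal $n$-ribbon of weight $w$ if there are partitions $\lambda=\tau^{(0)}\subset\cdots\subset\tau^{(w)}=\rho$ such that each $\tau^{(i)}/\tau^{(i-1)}$ is an $n$-ribbon whose ending box is the topmost box in its column of $\rho/\lambda$. Then $\operatorname{sgn}(\rho/\lambda)=\prod_i(-1)^{\mathrm{ht}(\tau^{(i)}/\tau^{(i-1)})}$ (the empty skew shape has weight $0$ and sign $1$). **Petrie functions.** $\sum_{m\ge0}G(k,m)z^m=\prod_i\sum_{j=0}^{k-1}(x_iz)^j$, and $G(k,m)=0$ for $m<0$. **Good proper $k$-ribbons.** A skew diagram is a vertical $k$-ribbon if its transpose is a horizontal $k$-ribbon (of some weight); if it consists of the $k$-ribbons $\xi_1,\dots,\xi_w$ (transposes of those in the chain), then $\operatorname{sgn}'=\prod_i(-1)^{r(\xi_i)}$, with $r(\xi_i)$ the number of rows of $\xi_i$. $\lambda/\mu$ is a proper $k$-ribbon if there is a partition $\nu$ with $\mu\subset\nu\subset\lambda$, $\nu/\mu$ a horizontal strip and $\lambda/\nu$ a vertical $k$-ribbon; it is good if this $\nu$ is unique, in which case $\operatorname{sgn}'(\lambda/\mu):=\operatorname{sgn}'(\lambda/\nu)$.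 **Skew modular Schur function.** $\mathfrak s^{(k)}_{\lambda/\mu}=\det_{1\le i,j\le\ell(\lambda)}\bigl(G(k,\lambda_i-\mu_j-i+j)\bigr)$, with $\mu$ padded by zeros. **Special ribbon tableaux.** A special ribbon tableau $\mathcal T$ of shape $\lambda/\mu$ and type $\tau=(\tau_1,\dots,\tau_N)$ (a composition of $|\lambda/\mu|$) is a filling of $\lambda/\mu$ by positive integers $\le N$, weakly increasing along rows and down columns, such that, with $\mathcal T^{(i)}$ the set of boxes with entries $\le i$, each $\mathcal T^{(i)}/\mathcal T^{(i-1)}$ ($1\le i\le N$) is a ribbon of $\tau_i$ boxes whose starting box is the southwest-most box of $\mathcal T^{(i)}$. $\operatorname{sgn}(\mathcal T)=\prod_i(-1)^{\mathrm{ht}(\mathcal T^{(i)}/\mathcal T^{(i-1)})}$. **Good proper $k$-ribbon tableaux.** For a composition $\tau=(\tau_1,\dots,\tau_N)$ of $|\nu|$, a good proper $k$-ribbon tableau $\mathscr T$ of shape $\nu$ and type $\tau$ is a filling of $\nu$ by positive integers, weakly increasing along rows and down columns, such that for each $1\le i\le N$ the boxes labelled $i$ number $\tau_i$ and form a good proper $k$-ribbon each of whose rows has fewer than $k$ boxes. $\operatorname{sgn}'(\mathscr T)=\prod_i\operatorname{sgn}'(\mathscr T^{(i)}/\mathscr T^{(i-1)})$, with $\mathscr T^{(i)}$ the shape of the entries $\le i$. *)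

theory Defs
  imports
    "HOL-Library.Poly_Mapping"
    "HOL-Library.FuncSet"
    "HOL-Computational_Algebra.Formal_Power_Series"
    "Jordan_Normal_Form.Determinant"
begin

section \<open>Formal power series in infinitely many variables\<close>

text \<open>
  Symmetric functions live in the ring of formal power series with integer coefficients in
  the variables \<open>x\<^sub>0, x\<^sub>1, \<dots>\<close>; an exponent vector is a finitely supported
  \<^typ>\<open>nat \<Rightarrow>\<^sub>0 nat\<close>.  The ring of symmetric functions is a subring of this ring, so
  identities between symmetric functions may be stated here.
\<close>

typedef mps = "UNIV :: ((nat \<Rightarrow>\<^sub>0 nat) \<Rightarrow> int) set"
  morphisms mcoeff MPS ..

lemma mcoeff_MPS [simp]: "mcoeff (MPS f) = f"
  by (simp add: MPS_inverse)

lemma mps_eqI: "(\<And>a. mcoeff f a = mcoeff g a) \<Longrightarrow> f = g"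
  by (metis ext mcoeff_inject)

lemma finite_pm_split: "finite {(b, c). b + c = (a :: nat \<Rightarrow>\<^sub>0 nat)}"
proof -
  let ?F = "{f :: nat \<Rightarrow> nat. \<forall>i. (i \<in> Poly_Mapping.keys a \<longrightarrow> f i \<in> {..Max (range (Poly_Mapping.lookup a))}) \<and>
     (i \<notin> Poly_Mapping.keys a \<longrightarrow> f i = 0)}"
  have fr: "finite (range (Poly_Mapping.lookup a))"
  proof -
    have "range (Poly_Mapping.lookup a) \<subseteq> insert 0 (Poly_Mapping.lookup a ` Poly_Mapping.keys a)"
      by (auto simp: in_keys_iff)
    then show ?thesis by (rule finite_subset) simp
  qed
  have fF: "finite ?F"
    by (rule finite_set_of_finite_funs) auto
  have sub: "(\<lambda>(b, c). (Poly_Mapping.lookup b, Poly_Mapping.lookup c)) ` {(b, c). b + c = a} \<subseteq> ?F \<times> ?F"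
  proof (clarsimp, intro conjI allI)
    fix b c :: "nat \<Rightarrow>\<^sub>0 nat" and i
    assume "a = b + c"
    have "Poly_Mapping.lookup b i + Poly_Mapping.lookup c i = Poly_Mapping.lookup a i"
      using \<open>a = b + c\<close> by (simp add: lookup_add)
    moreover have "Poly_Mapping.lookup a i \<le> Max (range (Poly_Mapping.lookup a))"
      using fr by simp
    ultimately show
      "i \<in> Poly_Mapping.keys (b + c) \<longrightarrow> Poly_Mapping.lookup b i \<le> Max (range (Poly_Mapping.lookup (b + c)))"
      "i \<notin> Poly_Mapping.keys (b + c) \<longrightarrow> Poly_Mapping.lookup b i = 0"
      "i \<in> Poly_Mapping.keys (b + c) \<longrightarrow> Poly_Mapping.lookup c i \<le> Max (range (Poly_Mapping.lookup (b + c)))"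
      "i \<notin> Poly_Mapping.keys (b + c) \<longrightarrow> Poly_Mapping.lookup c i = 0"
      using \<open>a = b + c\<close> by (auto simp: in_keys_iff)
  qed
  have "inj_on (\<lambda>(b, c). (Poly_Mapping.lookup b, Poly_Mapping.lookup c)) {(b, c). b + c = a}"
    by (auto simp: inj_on_def intro: poly_mapping_eqI)
  then show ?thesis
    using finite_imageD finite_subset[OF sub finite_cartesian_product[OF fF fF]] by blast
qed

instantiation mps :: comm_ring_1
begin

definition "0 = MPS (\<lambda>_. 0)"
definition "1 = MPS (\<lambda>a. if a = 0 then 1 else 0)"
definition "f + g = MPS (\<lambda>a. mcoeff f a + mcoeff g a)"
definition "f - g = MPS (\<lambda>a. mcoeff f a - mcoeff g a)"
definition "- f = MPS (\<lambda>a. - mcoeff f a)"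
definition "f * g = MPS (\<lambda>a. \<Sum>(b, c) | b + c = a. mcoeff f b * mcoeff g c)"

instance
proof
  fix f g h :: mps
  show "f + g + h = f + (g + h)" "f + g = g + f" "0 + f = f" "- f + f = 0" "f - g = f + - g"
    by (auto simp: plus_mps_def zero_mps_def uminus_mps_def minus_mps_def intro: mps_eqI)
  show "(0::mps) \<noteq> 1"
  proof
    assume "(0::mps) = 1"
    then have "mcoeff 0 0 = mcoeff 1 0" by simp
    then show False by (simp add: zero_mps_def one_mps_def)
  qed
  show "(f + g) * h = f * h + g * h"
    by (rule mps_eqI)
      (simp add: plus_mps_def times_mps_def case_prod_unfold distrib_right sum.distrib)
  show "f * g = g * f"
  proof (rule mps_eqI)
    fix a
    show "mcoeff (f * g) a = mcoeff (g * f) a"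
      unfolding times_mps_def mcoeff_MPS
      by (rule sum.reindex_bij_witness[of _ prod.swap prod.swap]) (auto simp: add.commute)
  qed
  show "1 * f = f"
  proof (rule mps_eqI)
    fix a
    have "mcoeff (1 * f) a = (\<Sum>(b, c) | b + c = a. (if b = 0 then 1 else 0) * mcoeff f c)"
      by (simp add: times_mps_def one_mps_def)
    also have "\<dots> = (\<Sum>(b, c) \<in> {(0 :: nat \<Rightarrow>\<^sub>0 nat, a)}. (if b = 0 then 1 else 0) * mcoeff f c)"
      by (rule sum.mono_neutral_right) (auto simp: finite_pm_split split: if_splits)
    finally show "mcoeff (1 * f) a = mcoeff f a" by simp
  qed
  show "f * g * h = f * (g * h)"
  proof (rule mps_eqI)
    fix a
    have "mcoeff (f * g * h) a =
      (\<Sum>p | fst p + snd p = a. \<Sum>q | fst q + snd q = fst p. mcoeff f (fst q) * mcoeff g (snd q) * mcoeff h (snd p))"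
      by (simp add: times_mps_def case_prod_unfold sum_distrib_right)
    also have "\<dots> = (\<Sum>(p, q) \<in> Sigma {p. fst p + snd p = a} (\<lambda>p. {q. fst q + snd q = fst p}).
        mcoeff f (fst q) * mcoeff g (snd q) * mcoeff h (snd p))"
      using finite_pm_split by (subst sum.Sigma) (auto simp: case_prod_unfold)
    also have "\<dots> = (\<Sum>(p, q) \<in> Sigma {p. fst p + snd p = a} (\<lambda>p. {q. fst q + snd q = snd p}).
        mcoeff f (fst p) * (mcoeff g (fst q) * mcoeff h (snd q)))"
      by (rule sum.reindex_bij_witness[of _
            "\<lambda>((b, cd), (c, d)). ((b + c, d), (b, c))" "\<lambda>((bc, d), (b, c)). ((b, c + d), (c, d))"])
        (auto simp: ac_simps)
    also have "\<dots> = (\<Sum>p | fst p + snd p = a. \<Sum>q | fst q + snd q = snd p.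
        mcoeff f (fst p) * (mcoeff g (fst q) * mcoeff h (snd q)))"
      using finite_pm_split by (subst sum.Sigma) (auto simp: case_prod_unfold)
    also have "\<dots> = mcoeff (f * (g * h)) a"
      by (simp add: times_mps_def case_prod_unfold sum_distrib_left)
    finally show "mcoeff (f * g * h) a = mcoeff (f * (g * h)) a" .
  qed
qed

end


definition mdeg :: "(nat \<Rightarrow>\<^sub>0 nat) \<Rightarrow> nat" where
  "mdeg a = (\<Sum>i \<in> Poly_Mapping.keys a. Poly_Mapping.lookup a i)"

definition mvar :: "nat \<Rightarrow> mps" where
  "mvar i = MPS (\<lambda>a. if a = Poly_Mapping.single i 1 then 1 else 0)"

text \<open>Complete homogeneous symmetric functions.\<close>

definition hsym :: "nat \<Rightarrow> mps" where
  "hsym k = MPS (\<lambda>a. if mdeg a = k then 1 else 0)"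

text \<open>
  The plethysm \<open>p\<^sub>n[f] = f(x\<^sub>0\<^sup>n, x\<^sub>1\<^sup>n, \<dots>)\<close>, for \<open>n \<ge> 1\<close>: every monomial with exponent
  vector \<open>b\<close> of \<open>f\<close> is replaced by the one with exponent vector \<open>n b\<close>.
\<close>

definition p_plethysm :: "nat \<Rightarrow> mps \<Rightarrow> mps" where
  "p_plethysm n f = MPS (\<lambda>a. \<Sum>b | Poly_Mapping.map ((*) n) b = a. mcoeff f b)"

text \<open>
  The Petrie functions are the coefficients (in \<open>z\<close>, represented by \<^const>\<open>fps_X\<close>) of the
  infinite product \<open>\<Prod>i. \<Sum>j<k. (x\<^sub>i z)\<^sup>j\<close>.  This product is the coefficientwise limit of its finite
  subproducts; each coefficient is eventually constant.
\<close>

definition petrie_prod :: "nat \<Rightarrow> nat \<Rightarrow> mps fps" where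
  "petrie_prod k N = (\<Prod>i<N. \<Sum>j<k. (fps_const (mvar i) * fps_X) ^ j)"

definition petrie :: "nat \<Rightarrow> int \<Rightarrow> mps" where
  "petrie k m =
     (if m < 0 then 0
      else MPS (\<lambda>a. lim (\<lambda>N. mcoeff (fps_nth (petrie_prod k N) (nat m)) a)))"

lemma mcoeff_0 [simp]: "mcoeff 0 a = 0"
  by (simp add: zero_mps_def)

lemma mcoeff_add [simp]: "mcoeff (f + g) a = mcoeff f a + mcoeff g a"
  by (simp add: plus_mps_def)

lemma mcoeff_sum: "mcoeff (sum f A) a = (\<Sum>x\<in>A. mcoeff (f x) a)"
  by (induction A rule: infinite_finite_induct) auto

lemma mdeg_add: "mdeg (a + b) = mdeg a + mdeg b"
proof -
  have *: "mdeg c = (\<Sum>i \<in> Poly_Mapping.keys a \<union> Poly_Mapping.keys b. Poly_Mapping.lookup c i)"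
    if "Poly_Mapping.keys c \<subseteq> Poly_Mapping.keys a \<union> Poly_Mapping.keys b" for c
    unfolding mdeg_def by (rule sum.mono_neutral_left) (use that in \<open>auto simp: in_keys_iff\<close>)
  have "Poly_Mapping.keys (a + b) \<subseteq> Poly_Mapping.keys a \<union> Poly_Mapping.keys b"
    by (rule keys_add)
  then show ?thesis
    by (simp add: * lookup_add sum.distrib)
qed

lemma mvar_power: "mvar i ^ j = MPS (\<lambda>a. if a = Poly_Mapping.single i j then 1 else 0)"
proof (induction j)
  case 0
  then show ?case by (simp add: one_mps_def)
next
  case (Suc j)
  show ?case
  proof (rule mps_eqI)
    fix a
    have "mcoeff (mvar i ^ Suc j) a =
      (\<Sum>(b, c) | b + c = a. (if b = Poly_Mapping.single i 1 then 1 else 0) *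
         (if c = Poly_Mapping.single i j then 1 else 0))"
      by (simp only: power_Suc Suc) (simp add: times_mps_def mvar_def)
    also have "\<dots> = (\<Sum>(b, c) | b + c = a \<and> b = Poly_Mapping.single i 1 \<and> c = Poly_Mapping.single i j. 1)"
      by (rule sum.mono_neutral_cong_right) (auto simp: finite_pm_split split: if_splits)
    also have "\<dots> = (if a = Poly_Mapping.single i (Suc j) then 1 else 0)"
    proof (cases "a = Poly_Mapping.single i (Suc j)")
      case True
      have "Poly_Mapping.single i 1 + Poly_Mapping.single i j = Poly_Mapping.single i (Suc j)"
        by (simp flip: single_add)
      with True have "{(b, c). b + c = a \<and> b = Poly_Mapping.single i 1 \<and> c = Poly_Mapping.single i j} =
          {(Poly_Mapping.single i 1, Poly_Mapping.single i j)}"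
        by auto
      with True show ?thesis by simp
    next
      case False
      have "Poly_Mapping.single i 1 + Poly_Mapping.single i j = Poly_Mapping.single i (Suc j)"
        by (simp flip: single_add)
      with False have "{(b, c). b + c = a \<and> b = Poly_Mapping.single i 1 \<and> c = Poly_Mapping.single i j} = {}"
        by auto
      with False show ?thesis by (simp only: sum.empty if_False)
    qed
    finally show "mcoeff (mvar i ^ Suc j) a =
        mcoeff (MPS (\<lambda>a. if a = Poly_Mapping.single i (Suc j) then 1 else 0)) a"
      by simp
  qed
qed

lemma mcoeff_mult_mvar_power:
  "mcoeff (f * mvar i ^ j) a =
     (if j \<le> Poly_Mapping.lookup a i then mcoeff f (a - Poly_Mapping.single i j) else 0)"
proof -
  let ?s = "Poly_Mapping.single i j"
  have "mcoeff (f * mvar i ^ j) a = (\<Sum>(b, c) | b + c = a. mcoeff f b * (if c = ?s then 1 else 0))"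
    by (simp add: mvar_power times_mps_def)
  also have "\<dots> = (\<Sum>(b, c) | b + c = a \<and> c = ?s. mcoeff f b)"
    by (rule sum.mono_neutral_cong_right) (auto simp: finite_pm_split split: if_splits)
  also have "\<dots> = (if j \<le> Poly_Mapping.lookup a i then mcoeff f (a - ?s) else 0)"
  proof (cases "j \<le> Poly_Mapping.lookup a i")
    case True
    then have "a - ?s + ?s = a"
      by (intro poly_mapping_eqI) (auto simp: lookup_add lookup_minus lookup_single when_def)
    then have "{(b, c). b + c = a \<and> c = ?s} = {(a - ?s, ?s)}"
      by auto
    with True show ?thesis by simp
  next
    case False
    then have "{(b, c). b + c = a \<and> c = ?s} = {}"
      by (auto simp: lookup_add)
    with False show ?thesis by (simp only: sum.empty if_False)
  qed
  finally show ?thesis .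
qed

lemma mcoeff_petrie_prod:
  "mcoeff (fps_nth (petrie_prod k N) m) a =
     (if mdeg a = m \<and> Poly_Mapping.keys a \<subseteq> {..<N} \<and>
         (\<forall>i\<in>Poly_Mapping.keys a. Poly_Mapping.lookup a i < k) \<and> (N = 0 \<or> k > 0) then 1 else 0)"
proof (induction N arbitrary: m a)
  case 0
  then show ?case
    by (auto simp: petrie_prod_def mdeg_def one_mps_def)
next
  case (Suc N)
  let ?c = "\<lambda>N m a. mdeg a = m \<and> Poly_Mapping.keys a \<subseteq> {..<N} \<and>
         (\<forall>i\<in>Poly_Mapping.keys a. Poly_Mapping.lookup a i < k) \<and> (N = 0 \<or> k > 0)"
  let ?l = "Poly_Mapping.lookup a N"
  let ?s = "Poly_Mapping.single N"
  have pw: "(fps_const (mvar N) * fps_X) ^ j = fps_const (mvar N ^ j) * fps_X ^ j" for j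
    by (simp add: power_mult_distrib fps_const_power)
  have "petrie_prod k (Suc N) = petrie_prod k N * (\<Sum>j<k. fps_const (mvar N ^ j) * fps_X ^ j)"
    by (simp add: petrie_prod_def pw)
  also have "\<dots> = (\<Sum>j<k. petrie_prod k N * fps_const (mvar N ^ j) * fps_X ^ j)"
    by (simp add: sum_distrib_left mult.assoc)
  finally have "mcoeff (fps_nth (petrie_prod k (Suc N)) m) a =
      (\<Sum>j<k. if j \<le> m then mcoeff (fps_nth (petrie_prod k N) (m - j) * mvar N ^ j) a else 0)"
    by (auto simp: fps_sum_nth mcoeff_sum fps_X_power_mult_right_nth intro!: sum.cong)
  also have "\<dots> = (\<Sum>j<k. if j \<le> m \<and> j \<le> ?l \<and> ?c N (m - j) (a - ?s j) then 1 else 0)"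
    by (intro sum.cong refl) (simp add: mcoeff_mult_mvar_power Suc)
  also have "\<dots> = (\<Sum>j<k. if j = ?l \<and> ?c (Suc N) m a then 1 else 0)"
  proof (intro sum.cong refl if_cong)
    fix j assume j: "j \<in> {..<k}"
    show "(j \<le> m \<and> j \<le> ?l \<and> ?c N (m - j) (a - ?s j)) = (j = ?l \<and> ?c (Suc N) m a)"
    proof (cases "j \<le> ?l")
      case False
      then show ?thesis by auto
    next
      case True
      have eq: "a = (a - ?s j) + ?s j"
        using True by (intro poly_mapping_eqI) (auto simp: lookup_add lookup_minus lookup_single when_def)
      have "mdeg (?s j) = j"
        by (simp add: mdeg_def)
      then have deg: "mdeg a = mdeg (a - ?s j) + j"
        using mdeg_add[of "a - ?s j" "?s j"] eq by simp
      have lk: "Poly_Mapping.lookup (a - ?s j) i = (if i = N then ?l - j else Poly_Mapping.lookup a i)" for i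
        by (auto simp: lookup_minus lookup_single when_def)
      have ks: "Poly_Mapping.keys (a - ?s j) \<subseteq> {..<N} \<longleftrightarrow>
          j = ?l \<and> Poly_Mapping.keys a \<subseteq> {..<Suc N}"
        using True by (auto simp: subset_iff in_keys_iff lk less_Suc_eq split: if_splits)
      have bd: "(\<forall>i\<in>Poly_Mapping.keys (a - ?s j). Poly_Mapping.lookup (a - ?s j) i < k) \<longleftrightarrow>
          (\<forall>i\<in>Poly_Mapping.keys a. Poly_Mapping.lookup a i < k)" if "j = ?l"
        unfolding in_keys_iff Ball_def lk using that j by auto
      show ?thesis using True deg ks bd j by (cases "j = ?l") auto
    qed
  qed
  also have "\<dots> = (if ?c (Suc N) m a then 1 else 0)"
  proof (cases "?c (Suc N) m a")
    case True
    then have "?l < k" by (cases "N \<in> Poly_Mapping.keys a") (auto simp: in_keys_iff)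
    then show ?thesis by (simp add: True)
  next
    case False
    then have "(if j = ?l \<and> ?c (Suc N) m a then 1 else 0 :: int) = 0" for j
      by (meson if_not_P)
    with False show ?thesis by (simp only: sum.neutral_const if_False)
  qed
  finally show ?case .
qed

lemma mcoeff_petrie:
  assumes "k > 0"
  shows "mcoeff (petrie k m) a =
     (if int (mdeg a) = m \<and> (\<forall>i. Poly_Mapping.lookup a i < k) then 1 else 0)"
proof (cases "m < 0")
  case True
  then show ?thesis by (auto simp: petrie_def)
next
  case False
  let ?f = "\<lambda>N. mcoeff (fps_nth (petrie_prod k N) (nat m)) a"
  let ?L = "if int (mdeg a) = m \<and> (\<forall>i. Poly_Mapping.lookup a i < k) then 1 else 0 :: int"
  obtain M where M: "Poly_Mapping.keys a \<subseteq> {..<M}"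
    using finite_nat_iff_bounded[of "Poly_Mapping.keys a"] by auto
  have "?f N = ?L" if "N \<ge> M" for N
  proof -
    have "Poly_Mapping.keys a \<subseteq> {..<N}" using M that by auto
    moreover have "(\<forall>i\<in>Poly_Mapping.keys a. Poly_Mapping.lookup a i < k) \<longleftrightarrow>
        (\<forall>i. Poly_Mapping.lookup a i < k)"
      using assms by (metis in_keys_iff)
    moreover have "mdeg a = nat m \<longleftrightarrow> int (mdeg a) = m" using False by auto
    ultimately show ?thesis using assms by (simp add: mcoeff_petrie_prod)
  qed
  then have "?f \<longlonglongrightarrow> ?L"
    by (intro tendsto_eventually) (unfold eventually_sequentially, blast)
  then have "lim ?f = ?L" by (rule limI)
  then show ?thesis using False by (simp add: petrie_def)
qed


section \<open>Partitions and skew diagrams\<close>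

text \<open>
  A partition is a weakly decreasing, finitely supported sequence of naturals; rows and columns
  are indexed from 0, and \<open>(i, j)\<close> is the box in row \<open>i\<close> and column \<open>j\<close>, with rows going
  downwards.  Containment of partitions is the pointwise order \<open>\<le>\<close>.
\<close>

definition is_partition :: "(nat \<Rightarrow> nat) \<Rightarrow> bool" where
  "is_partition p \<longleftrightarrow> antimono p \<and> finite {i. p i \<noteq> 0}"

definition plength :: "(nat \<Rightarrow> nat) \<Rightarrow> nat" where
  "plength p = card {i. p i \<noteq> 0}"

definition conj_part :: "(nat \<Rightarrow> nat) \<Rightarrow> nat \<Rightarrow> nat" where
  "conj_part p = (\<lambda>j. card {i. j < p i})"

definition skew :: "(nat \<Rightarrow> nat) \<Rightarrow> (nat \<Rightarrow> nat) \<Rightarrow> (nat \<times> nat) set" where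
  "skew l u = {(i, j). u i \<le> j \<and> j < l i}"

abbreviation diagram :: "(nat \<Rightarrow> nat) \<Rightarrow> (nat \<times> nat) set" where
  "diagram l \<equiv> skew l (\<lambda>_. 0)"

definition is_skew_diagram :: "(nat \<times> nat) set \<Rightarrow> bool" where
  "is_skew_diagram B \<longleftrightarrow> (\<exists>l u. is_partition l \<and> is_partition u \<and> u \<le> l \<and> B = skew l u)"


section \<open>Skew Schur functions\<close>

definition rows_weakly_inc :: "(nat \<times> nat) set \<Rightarrow> (nat \<times> nat \<Rightarrow> nat) \<Rightarrow> bool" where
  "rows_weakly_inc B T \<longleftrightarrow>
     (\<forall>i j j'. (i, j) \<in> B \<and> (i, j') \<in> B \<and> j < j' \<longrightarrow> T (i, j) \<le> T (i, j'))"

definition cols_weakly_inc :: "(nat \<times> nat) set \<Rightarrow> (nat \<times> nat \<Rightarrow> nat) \<Rightarrow> bool" where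
  "cols_weakly_inc B T \<longleftrightarrow>
     (\<forall>i i' j. (i, j) \<in> B \<and> (i', j) \<in> B \<and> i < i' \<longrightarrow> T (i, j) \<le> T (i', j))"

definition cols_strictly_inc :: "(nat \<times> nat) set \<Rightarrow> (nat \<times> nat \<Rightarrow> nat) \<Rightarrow> bool" where
  "cols_strictly_inc B T \<longleftrightarrow>
     (\<forall>i i' j. (i, j) \<in> B \<and> (i', j) \<in> B \<and> i < i' \<longrightarrow> T (i, j) < T (i', j))"

text \<open>
  Fillings of \<open>B\<close> are functions in \<^term>\<open>extensional B\<close>, so that each filling is counted once.
  The entries of semistandard tableaux are the indices of the variables, hence start from 0.
\<close>

definition ssyt :: "(nat \<times> nat) set \<Rightarrow> (nat \<times> nat \<Rightarrow> nat) set" where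
  "ssyt B = {T \<in> extensional B. rows_weakly_inc B T \<and> cols_strictly_inc B T}"

definition schur :: "(nat \<Rightarrow> nat) \<Rightarrow> (nat \<Rightarrow> nat) \<Rightarrow> mps" where
  "schur l u = MPS (\<lambda>a. int (card
     {T \<in> ssyt (skew l u). (\<Sum>b \<in> skew l u. Poly_Mapping.single (T b) 1) = a}))"


section \<open>Ribbons\<close>

definition adjacent :: "nat \<times> nat \<Rightarrow> nat \<times> nat \<Rightarrow> bool" where
  "adjacent b c \<longleftrightarrow>
     \<bar>int (fst b) - int (fst c)\<bar> + \<bar>int (snd b) - int (snd c)\<bar> = 1"

definition box_connected :: "(nat \<times> nat) set \<Rightarrow> bool" where
  "box_connected B \<longleftrightarrow> B \<noteq> {} \<and>
     (\<forall>b\<in>B. \<forall>c\<in>B. (b, c) \<in> {(x, y). x \<in> B \<and> y \<in> B \<and> adjacent x y}\<^sup>*)"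

definition ribbon :: "(nat \<times> nat) set \<Rightarrow> bool" where
  "ribbon B \<longleftrightarrow> is_skew_diagram B \<and> box_connected B \<and>
     \<not> (\<exists>i j. {(i, j), (Suc i, j), (i, Suc j), (Suc i, Suc j)} \<subseteq> B)"

definition num_rows :: "(nat \<times> nat) set \<Rightarrow> nat" where
  "num_rows B = card (fst ` B)"

definition height :: "(nat \<times> nat) set \<Rightarrow> nat" where
  "height B = num_rows B - 1"

definition northeastmost :: "(nat \<times> nat) set \<Rightarrow> nat \<times> nat \<Rightarrow> bool" where
  "northeastmost B b \<longleftrightarrow> b \<in> B \<and> (\<forall>c\<in>B. fst b \<le> fst c \<and> snd c \<le> snd b)"

definition southwestmost :: "(nat \<times> nat) set \<Rightarrow> nat \<times> nat \<Rightarrow> bool" where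
  "southwestmost B b \<longleftrightarrow> b \<in> B \<and> (\<forall>c\<in>B. fst c \<le> fst b \<and> snd b \<le> snd c)"

text \<open>
  \<open>ribbon_chain n r l ts\<close>: the list \<open>ts\<close> is a chain of partitions from \<open>l\<close> to \<open>r\<close> exhibiting
  \<open>r/l\<close> as a horizontal \<open>n\<close>-ribbon; its weight is one less than the length of \<open>ts\<close>.
\<close>

definition ribbon_chain ::
    "nat \<Rightarrow> (nat \<Rightarrow> nat) \<Rightarrow> (nat \<Rightarrow> nat) \<Rightarrow> (nat \<Rightarrow> nat) list \<Rightarrow> bool" where
  "ribbon_chain n r l ts \<longleftrightarrow>
     ts \<noteq> [] \<and> hd ts = l \<and> last ts = r \<and> (\<forall>t \<in> set ts. is_partition t) \<and>
     (\<forall>i. Suc i < length ts \<longrightarrow>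
        ts ! i \<le> ts ! Suc i \<and>
        ribbon (skew (ts ! Suc i) (ts ! i)) \<and>
        card (skew (ts ! Suc i) (ts ! i)) = n \<and>
        (\<exists>b. northeastmost (skew (ts ! Suc i) (ts ! i)) b \<and>
             (\<forall>c \<in> skew r l. snd c = snd b \<longrightarrow> fst b \<le> fst c)))"

definition horizontal_ribbon :: "nat \<Rightarrow> (nat \<Rightarrow> nat) \<Rightarrow> (nat \<Rightarrow> nat) \<Rightarrow> nat \<Rightarrow> bool" where
  "horizontal_ribbon n r l w \<longleftrightarrow> (\<exists>ts. ribbon_chain n r l ts \<and> length ts = Suc w)"

text \<open>The signs below do not depend on which chain is chosen.\<close>

definition sgn_ribbon :: "nat \<Rightarrow> (nat \<Rightarrow> nat) \<Rightarrow> (nat \<Rightarrow> nat) \<Rightarrow> int" where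
  "sgn_ribbon n r l = (let ts = (SOME ts. ribbon_chain n r l ts) in
     \<Prod>i < length ts - 1. (-1) ^ height (skew (ts ! Suc i) (ts ! i)))"

definition vertical_ribbon :: "nat \<Rightarrow> (nat \<Rightarrow> nat) \<Rightarrow> (nat \<Rightarrow> nat) \<Rightarrow> bool" where
  "vertical_ribbon k r l \<longleftrightarrow> (\<exists>w. horizontal_ribbon k (conj_part r) (conj_part l) w)"

text \<open>
  The chain consists of partitions between the conjugates of \<open>l\<close> and \<open>r\<close>; the ribbons that make
  up \<open>r/l\<close> itself are the transposes of its steps.
\<close>

definition sgn_vertical :: "nat \<Rightarrow> (nat \<Rightarrow> nat) \<Rightarrow> (nat \<Rightarrow> nat) \<Rightarrow> int" where
  "sgn_vertical k r l = (let ts = (SOME ts. ribbon_chain k (conj_part r) (conj_part l) ts) in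
     \<Prod>i < length ts - 1. (-1) ^ num_rows (prod.swap ` skew (ts ! Suc i) (ts ! i)))"


section \<open>Good proper ribbons\<close>

definition horizontal_strip :: "(nat \<Rightarrow> nat) \<Rightarrow> (nat \<Rightarrow> nat) \<Rightarrow> bool" where
  "horizontal_strip v u \<longleftrightarrow> (\<forall>b \<in> skew v u. \<forall>c \<in> skew v u. snd b = snd c \<longrightarrow> b = c)"

definition proper_decomp ::
    "nat \<Rightarrow> (nat \<Rightarrow> nat) \<Rightarrow> (nat \<Rightarrow> nat) \<Rightarrow> (nat \<Rightarrow> nat) \<Rightarrow> bool" where
  "proper_decomp k l u v \<longleftrightarrow>
     is_partition v \<and> u \<le> v \<and> v \<le> l \<and> horizontal_strip v u \<and> vertical_ribbon k l v"

definition good_proper_ribbon :: "nat \<Rightarrow> (nat \<Rightarrow> nat) \<Rightarrow> (nat \<Rightarrow> nat) \<Rightarrow> bool" where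
  "good_proper_ribbon k l u \<longleftrightarrow> (\<exists>!v. proper_decomp k l u v)"

definition sgn_good :: "nat \<Rightarrow> (nat \<Rightarrow> nat) \<Rightarrow> (nat \<Rightarrow> nat) \<Rightarrow> int" where
  "sgn_good k l u = sgn_vertical k l (THE v. proper_decomp k l u v)"


section \<open>Skew modular Schur functions and tableaux\<close>

definition modular_schur :: "nat \<Rightarrow> (nat \<Rightarrow> nat) \<Rightarrow> (nat \<Rightarrow> nat) \<Rightarrow> mps" where
  "modular_schur k l u =
     det (mat (plength l) (plength l)
       (\<lambda>(i, j). petrie k (int (l i) - int (u j) - int i + int j)))"

definition is_composition :: "nat list \<Rightarrow> nat \<Rightarrow> bool" where
  "is_composition ty n \<longleftrightarrow> (\<forall>t \<in> set ty. 0 < t) \<and> sum_list ty = n"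

text \<open>The boxes of \<open>B\<close> with entries at most \<open>i\<close>, and those with entry exactly \<open>i\<close>.\<close>

definition upto_boxes :: "(nat \<times> nat) set \<Rightarrow> (nat \<times> nat \<Rightarrow> nat) \<Rightarrow> nat \<Rightarrow> (nat \<times> nat) set" where
  "upto_boxes B T i = {b \<in> B. T b \<le> i}"

definition label_boxes :: "(nat \<times> nat) set \<Rightarrow> (nat \<times> nat \<Rightarrow> nat) \<Rightarrow> nat \<Rightarrow> (nat \<times> nat) set" where
  "label_boxes B T i = {b \<in> B. T b = i}"

definition special_ribbon_tableau ::
    "(nat \<Rightarrow> nat) \<Rightarrow> (nat \<Rightarrow> nat) \<Rightarrow> nat list \<Rightarrow> (nat \<times> nat \<Rightarrow> nat) \<Rightarrow> bool" where
  "special_ribbon_tableau l u ty T \<longleftrightarrow> (let B = skew l u in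
     is_composition ty (card B) \<and>
     T \<in> extensional B \<and> (\<forall>b\<in>B. 1 \<le> T b \<and> T b \<le> length ty) \<and>
     rows_weakly_inc B T \<and> cols_weakly_inc B T \<and>
     (\<forall>i \<in> {1..length ty}.
        ribbon (label_boxes B T i) \<and>
        card (label_boxes B T i) = ty ! (i - 1) \<and>
        (\<exists>b. southwestmost (label_boxes B T i) b \<and> southwestmost (upto_boxes B T i) b)))"

text \<open>Since the parts of a composition are positive, the labels in use are exactly \<open>T ` B\<close>.\<close>

definition sgn_srt :: "(nat \<Rightarrow> nat) \<Rightarrow> (nat \<Rightarrow> nat) \<Rightarrow> (nat \<times> nat \<Rightarrow> nat) \<Rightarrow> int" where
  "sgn_srt l u T = (\<Prod>i \<in> T ` skew l u. (-1) ^ height (label_boxes (skew l u) T i))"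

text \<open>The partition whose diagram consists of the boxes with entries at most \<open>i\<close>.\<close>

definition upto_shape :: "(nat \<Rightarrow> nat) \<Rightarrow> (nat \<times> nat \<Rightarrow> nat) \<Rightarrow> nat \<Rightarrow> nat \<Rightarrow> nat" where
  "upto_shape v S i = (\<lambda>r. card {j. (r, j) \<in> upto_boxes (diagram v) S i})"

definition good_proper_ribbon_tableau ::
    "nat \<Rightarrow> (nat \<Rightarrow> nat) \<Rightarrow> nat list \<Rightarrow> (nat \<times> nat \<Rightarrow> nat) \<Rightarrow> bool" where
  "good_proper_ribbon_tableau k v ty S \<longleftrightarrow> (let B = diagram v in
     is_composition ty (card B) \<and>
     S \<in> extensional B \<and> (\<forall>b\<in>B. 1 \<le> S b) \<and>
     rows_weakly_inc B S \<and> cols_weakly_inc B S \<and>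
     (\<forall>i \<in> {1..length ty}.
        card (label_boxes B S i) = ty ! (i - 1) \<and>
        good_proper_ribbon k (upto_shape v S i) (upto_shape v S (i - 1)) \<and>
        (\<forall>r. card {j. (r, j) \<in> label_boxes B S i} < k)))"

definition sgn_gprt :: "nat \<Rightarrow> (nat \<Rightarrow> nat) \<Rightarrow> (nat \<times> nat \<Rightarrow> nat) \<Rightarrow> int" where
  "sgn_gprt k v S =
     (\<Prod>i \<in> S ` diagram v. sgn_good k (upto_shape v S i) (upto_shape v S (i - 1)))"

end

theory Submission
  imports Defs
begin

text \<open>
  Encode a partition by its beads \<open>\<lambda>\<^sub>i - i\<close>.  For a power series \<open>f\<close> with constant term 1, the minors
  \<open>det (f\<^bsub>\<rho>\<^sub>i - i - \<lambda>\<^sub>j + j\<^esub>)\<close> form a matrix \<open>M\<^sub>f\<close> indexed by partitions, with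
  \<open>M\<^sub>f M\<^sub>g = M\<^bsub>f g\<^esub>\<close> by the Cauchy--Binet formula.  Let \<open>U(x)\<close> be the matrix of horizontal strips weighted by
  \<open>x\<close> to the number of boxes; row and column operations on a single determinant give
  \<open>U(x) M\<^sub>f\<^sup>T = f(x) M\<^sub>f\<^sup>T U(x)\<close>.  Since the skew Schur functions are the entries of \<open>U(x\<^sub>0) U(x\<^sub>1) \<dots>\<close>,
  multiplying them by \<open>\<Prod>\<^sub>i f(x\<^sub>i)\<close> amounts to conjugating by \<open>M\<^sub>f\<^sup>T\<close>: this yields products in which
  ribbons are added outside with coefficients from \<open>M\<^sub>f\<close> and removed inside with coefficients from
  \<open>M\<^bsub>1/f\<^esub>\<close>.

  It remains to evaluate minors.  For \<open>f = 1 / (1 - t\<^sup>n)\<close> and \<open>f = 1 - t\<^sup>n\<close>, adding one ribbon moves one bead by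
  \<open>n\<close>, which changes the minor by a sign, and a minor that admits no such step vanishes.  For the Petrie
  functions \<open>f = (1 - t\<^sup>k) / (1 - t)\<close>, the minor is the signed number of decompositions into a
  horizontal strip and a vertical \<open>k\<close>-ribbon; two different decompositions make the rows of its
  matrix linearly dependent.  The third formula follows by Laplace expansion of the modular
  determinant along the column of its last nontrivial row.
\<close>

section \<open>Determinants\<close>

text \<open>The matrices indexed by partitions are infinite, but no infinite sum is ever formed:
  \<open>minor f l r\<close> vanishes unless \<open>l \<le> r\<close>, so a product of two such
  matrices is a finite sum over an interval, and symmetric functions are compared one exponent
  vector at a time. Commutation with \<open>U(x)\<close> works because the row lengths of a
  horizontal strip over a fixed shape vary independently, so that the sum over strips can be carried
  out inside the rows of one determinant. Removal inside is governed by minors of \<open>1/f\<close>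
  at \<open>\<mu>\<close>, \<open>\<eta>\<close>, whereas the theorem speaks of the conjugates; the
  two are linked by the duality between minors of \<open>f\<close> and of \<open>1/f\<close>, which
  costs the sign \<open>(-1)^|\<eta>/\<mu>|\<close>. For \<open>1/(1 - t^n)\<close> this duality is
  read off from the ribbons, whose rows and columns together exceed their boxes by one; the Petrie
  series inherits it from its factors \<open>1/(1 - t)\<close> and \<open>1 - t^k\<close>. Minors
  are taken over an arbitrary commutative ring: over the integers for the two product formulas, over
  the symmetric functions for the third, where the modular Schur function is itself a minor with
  entries \<open>G(k, m)\<close>.\<close>

abbreviation dt :: "nat \<Rightarrow> (nat \<Rightarrow> nat \<Rightarrow> 'a::comm_ring_1) \<Rightarrow> 'a" where
  "dt L A \<equiv> det (mat L L (\<lambda>(i, j). A i j))"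

lemma dt_expand:
  "dt L A = (\<Sum>p | p permutes {..<L}. signof p * (\<Prod>i<L. A i (p i)))"
proof -
  have "dt L A = (\<Sum>p | p permutes {0..<L}. signof p * (\<Prod>i = 0..<L. (mat L L (\<lambda>(i, j). A i j)) $$ (i, p i)))"
    by (rule det_def') simp
  also have "\<dots> = (\<Sum>p | p permutes {0..<L}. signof p * (\<Prod>i = 0..<L. A i (p i)))"
  proof (intro sum.cong refl arg_cong2[where f = "(*)"] prod.cong, goal_cases)
    case (1 p i)
    then have "p i < L" using permutes_in_image[of p "{0..<L}" i] by auto
    then show ?case using 1 by auto
  qed
  finally show ?thesis by (simp add: atLeast0LessThan)
qed

lemma dt_cong: "(\<And>i j. i < L \<Longrightarrow> j < L \<Longrightarrow> A i j = B i j) \<Longrightarrow> dt L A = dt L B"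
  by (intro arg_cong[of _ _ det] eq_matI) auto

lemma dt_transpose: "dt L A = dt L (\<lambda>i j. A j i)"
proof -
  have "dt L A = det (transpose_mat (mat L L (\<lambda>(i, j). A i j)))"
    by (rule det_transpose[symmetric]) auto
  also have "transpose_mat (mat L L (\<lambda>(i, j). A i j)) = mat L L (\<lambda>(i, j). A j i)"
    by (rule eq_matI) auto
  finally show ?thesis .
qed

lemma dt_mult: "dt L A * dt L B = dt L (\<lambda>i j. \<Sum>k<L. A i k * B k j)"
proof -
  have "dt L A * dt L B = det (mat L L (\<lambda>(i, j). A i j) * mat L L (\<lambda>(i, j). B i j))"
    by (rule det_mult[symmetric]) auto
  also have "mat L L (\<lambda>(i, j). A i j) * mat L L (\<lambda>(i, j). B i j) =
      mat L L (\<lambda>(i, j). \<Sum>k<L. A i k * B k j)"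
    by (rule eq_matI) (auto simp: scalar_prod_def atLeast0LessThan intro!: sum.cong)
  finally show ?thesis .
qed

text \<open>Frobenius--Koenig: a permutation without a zero factor would embed \<open>R\<close> into
  the complement of \<open>C\<close>, which is too small. Most vanishing results below are
  instances, usually with \<open>card R + card C = L + 1\<close>.\<close>

lemma dt_zero_block:
  assumes RC: "R \<subseteq> {..<L}" "C \<subseteq> {..<L}" "L < card R + card C"
    and z: "\<And>i j. i \<in> R \<Longrightarrow> j \<in> C \<Longrightarrow> A i j = 0"
  shows "dt L A = 0"
  unfolding dt_expand
proof (rule sum.neutral, clarify)
  fix p assume p: "p permutes {..<L}"
  have "\<exists>i\<in>R. p i \<in> C"
  proof (rule ccontr)
    assume "\<not> ?thesis"
    then have "p ` R \<subseteq> {..<L} - C" using permutes_image[OF p] RC(1) by blast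
    then have "card (p ` R) \<le> card ({..<L} - C)" by (intro card_mono) auto
    moreover have "card (p ` R) = card R" 
      by (intro card_image inj_on_subset[OF permutes_inj_on[OF p]]) auto
    moreover have "card ({..<L} - C) = L - card C"
      using RC(2) by (simp add: card_Diff_subset finite_subset)
    moreover have "card C \<le> L" using card_mono[OF _ RC(2)] by simp
    ultimately show False using RC(3) by linarith
  qed
  then obtain i where "i \<in> R" "p i \<in> C" by blast
  then have "(\<Prod>i<L. A i (p i)) = 0"
    using RC(1) z by (intro prod_zero) auto
  then show "signof p * (\<Prod>i<L. A i (p i)) = 0" by simp
qed

lemma dt_id_only:
  assumes "\<And>p. p permutes {..<L} \<Longrightarrow> p \<noteq> id \<Longrightarrow> \<exists>i<L. A i (p i) = 0"
  shows "dt L A = (\<Prod>i<L. A i i)"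
proof -
  have "dt L A = (\<Sum>p\<in>{id}. signof p * (\<Prod>i<L. A i (p i)))"
    unfolding dt_expand
  proof (rule sum.mono_neutral_right, goal_cases)
    case 3
    show ?case
    proof
      fix p assume "p \<in> {p. p permutes {..<L}} - {id}"
      then obtain i where "i < L" "A i (p i) = 0" using assms[of p] by auto
      then have "(\<Prod>i<L. A i (p i)) = 0" by (intro prod_zero) auto
      then show "signof p * (\<Prod>i<L. A i (p i)) = 0" by simp
    qed
  qed (auto simp: finite_permutations permutes_id)
  then show ?thesis by simp
qed

lemma dt_upper:
  assumes "\<And>i j. i < L \<Longrightarrow> j < i \<Longrightarrow> A i j = 0"
  shows "dt L A = (\<Prod>i<L. A i i)"
proof -
  have "dt L A = prod_list (diag_mat (mat L L (\<lambda>(i, j). A i j)))"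
    using assms by (intro det_upper_triangular[of _ L]) (auto intro!: upper_triangularI)
  then show ?thesis by (simp add: prod_list_diag_prod atLeast0LessThan)
qed

lemma dt_lower:
  assumes "\<And>i j. j < L \<Longrightarrow> i < j \<Longrightarrow> A i j = 0"
  shows "dt L A = (\<Prod>i<L. A i i)"
  by (subst dt_transpose) (rule dt_upper, use assms in auto)

text \<open>The increasing injection of the naturals that misses \<open>i\<close>; composing the
  entries with it deletes a row or a column.\<close>

abbreviation skip :: "nat \<Rightarrow> nat \<Rightarrow> nat" where
  "skip i i' \<equiv> (if i' < i then i' else Suc i')"

lemma dt_laplace_col:
  assumes "j < Suc L"
  shows "dt (Suc L) A = (\<Sum>i<Suc L. A i j * ((-1) ^ (i + j) * dt L (\<lambda>i' j'. A (skip i i') (skip j j'))))"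
proof -
  let ?A = "mat (Suc L) (Suc L) (\<lambda>(i, j). A i j)"
  have "det ?A = (\<Sum>i<Suc L. ?A $$ (i, j) * cofactor ?A i j)"
    by (rule laplace_expansion_column) (use assms in auto)
  also have "\<dots> = (\<Sum>i<Suc L. A i j * ((-1) ^ (i + j) * dt L (\<lambda>i' j'. A (skip i i') (skip j j'))))"
  proof (rule sum.cong[OF refl])
    fix i assume "i \<in> {..<Suc L}"
    then have i: "i < Suc L" by simp
    have "mat_delete ?A i j = mat L L (\<lambda>(i', j'). A (skip i i') (skip j j'))"
      using i assms by (intro eq_matI) (auto simp: mat_delete_def)
    then show "?A $$ (i, j) * cofactor ?A i j = A i j * ((-1) ^ (i + j) * dt L (\<lambda>i' j'. A (skip i i') (skip j j')))"
      using i assms by (simp add: cofactor_def)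
  qed
  finally show ?thesis .
qed

lemma dt_laplace_row:
  assumes "i < Suc L"
  shows "dt (Suc L) A = (\<Sum>j<Suc L. A i j * ((-1) ^ (i + j) * dt L (\<lambda>i' j'. A (skip i i') (skip j j'))))"
proof -
  have "dt (Suc L) A = dt (Suc L) (\<lambda>i j. A j i)" by (rule dt_transpose)
  also have "\<dots> = (\<Sum>j<Suc L. A i j * ((-1) ^ (j + i) * dt L (\<lambda>i' j'. A (skip i j') (skip j i'))))"
    by (rule dt_laplace_col[OF assms])
  also have "\<dots> = (\<Sum>j<Suc L. A i j * ((-1) ^ (i + j) * dt L (\<lambda>i' j'. A (skip i i') (skip j j'))))"
  proof (intro sum.cong refl)
    fix j
    have "dt L (\<lambda>i' j'. A (skip i j') (skip j i')) = dt L (\<lambda>i' j'. A (skip i i') (skip j j'))"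
      by (rule dt_transpose)
    then show "A i j * ((-1) ^ (j + i) * dt L (\<lambda>i' j'. A (skip i j') (skip j i'))) =
        A i j * ((-1) ^ (i + j) * dt L (\<lambda>i' j'. A (skip i i') (skip j j')))"
      by (simp only: add.commute)
  qed
  finally show ?thesis .
qed

lemma dt_single_col:
  assumes "i < Suc L" "j < Suc L" "\<And>i'. i' < Suc L \<Longrightarrow> i' \<noteq> i \<Longrightarrow> A i' j = 0"
  shows "dt (Suc L) A = A i j * ((-1) ^ (i + j) * dt L (\<lambda>i' j'. A (skip i i') (skip j j')))"
proof -
  have "(\<Sum>i'<Suc L. A i' j * ((-1) ^ (i' + j) * dt L (\<lambda>i'' j'. A (skip i' i'') (skip j j')))) =
      (\<Sum>i'\<in>{i}. A i' j * ((-1) ^ (i' + j) * dt L (\<lambda>i'' j'. A (skip i' i'') (skip j j'))))"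
    using assms by (intro sum.mono_neutral_right) auto
  then show ?thesis by (simp only: dt_laplace_col[OF assms(2)] sum.insert sum.empty finite.emptyI) simp
qed

lemma dt_single_row:
  assumes "i < Suc L" "j < Suc L" "\<And>j'. j' < Suc L \<Longrightarrow> j' \<noteq> j \<Longrightarrow> A i j' = 0"
  shows "dt (Suc L) A = A i j * ((-1) ^ (i + j) * dt L (\<lambda>i' j'. A (skip i i') (skip j j')))"
proof -
  have "(\<Sum>j'<Suc L. A i j' * ((-1) ^ (i + j') * dt L (\<lambda>i'' j''. A (skip i i'') (skip j' j'')))) =
      (\<Sum>j'\<in>{j}. A i j' * ((-1) ^ (i + j') * dt L (\<lambda>i'' j''. A (skip i i'') (skip j' j''))))"
    using assms by (intro sum.mono_neutral_right) auto
  then show ?thesis by (simp only: dt_laplace_row[OF assms(1)] sum.insert sum.empty finite.emptyI) simp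
qed

text \<open>The last row of such a matrix is \<open>(0, ..., 0, 1)\<close>, so the order can be
  lowered one at a time.\<close>

lemma dt_stable:
  assumes "K \<le> L" "\<And>i j. K \<le> i \<Longrightarrow> i < L \<Longrightarrow> j < i \<Longrightarrow> A i j = 0"
    and "\<And>i. K \<le> i \<Longrightarrow> i < L \<Longrightarrow> A i i = 1"
  shows "dt L A = dt K A"
  using assms
proof (induction L)
  case (Suc L)
  show ?case
  proof (cases "K = Suc L")
    case False
    with Suc.prems have KL: "K \<le> L" by simp
    have "dt (Suc L) A = A L L * ((-1) ^ (L + L) * dt L (\<lambda>i' j'. A (skip L i') (skip L j')))"
      by (rule dt_single_row) (use Suc.prems KL in auto)
    also have "dt L (\<lambda>i' j'. A (skip L i') (skip L j')) = dt L A"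
      by (rule dt_cong) simp
    also have "dt L A = dt K A"
      by (rule Suc.IH) (use KL Suc.prems in auto)
    also have "A L L = 1" using Suc.prems KL by simp
    finally show ?thesis by (simp flip: mult_2)
  qed simp
qed simp

text \<open>Each row sum expands on its own, so a sum over a product of index sets is a single
  determinant. The Cauchy--Binet formula uses this to expand, the sums over horizontal strips use it
  to fold.\<close>

lemma dt_multilinear:
  assumes "\<And>i. i < L \<Longrightarrow> finite (C i)"
  shows "dt L (\<lambda>i j. \<Sum>c\<in>C i. w i c * A i c j) =
    (\<Sum>c\<in>Pi\<^sub>E {..<L} C. (\<Prod>i<L. w i (c i)) * dt L (\<lambda>i j. A i (c i) j))"
proof -
  have "dt L (\<lambda>i j. \<Sum>c\<in>C i. w i c * A i c j) =
      (\<Sum>p | p permutes {..<L}. signof p * (\<Sum>c\<in>Pi\<^sub>E {..<L} C. \<Prod>i<L. w i (c i) * A i (c i) (p i)))"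
    unfolding dt_expand by (subst prod_sum_PiE) (use assms in auto)
  also have "\<dots> = (\<Sum>c\<in>Pi\<^sub>E {..<L} C. (\<Prod>i<L. w i (c i)) * dt L (\<lambda>i j. A i (c i) j))"
    unfolding dt_expand sum_distrib_left
    by (subst sum.swap) (simp add: prod.distrib mult_ac)
  finally show ?thesis .
qed

lemma dt_multilinear_col:
  assumes "\<And>j. j < L \<Longrightarrow> finite (C j)"
  shows "dt L (\<lambda>i j. \<Sum>c\<in>C j. w j c * A i j c) =
    (\<Sum>c\<in>Pi\<^sub>E {..<L} C. (\<Prod>j<L. w j (c j)) * dt L (\<lambda>i j. A i j (c j)))"
proof -
  have "dt L (\<lambda>i j. \<Sum>c\<in>C j. w j c * A i j c) = dt L (\<lambda>i j. \<Sum>c\<in>C i. w i c * A j i c)"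
    by (rule dt_transpose)
  also have "\<dots> = (\<Sum>c\<in>Pi\<^sub>E {..<L} C. (\<Prod>i<L. w i (c i)) * dt L (\<lambda>i j. A j i (c i)))"
    by (rule dt_multilinear[OF assms])
  also have "\<dots> = (\<Sum>c\<in>Pi\<^sub>E {..<L} C. (\<Prod>j<L. w j (c j)) * dt L (\<lambda>i j. A i j (c j)))"
    by (intro sum.cong refl arg_cong2[where f = "(*)"]) (rule dt_transpose)
  finally show ?thesis .
qed

lemma dt_permute_rows:
  assumes "p permutes {..<L}"
  shows "dt L (\<lambda>i j. A (p i) j) = signof p * dt L A"
proof -
  have pL: "p i < L" if "i < L" for i using permutes_in_image[OF assms, of i] that by simp
  have "det (mat L L (\<lambda>(i, j). mat L L (\<lambda>(i, j). A i j) $$ (p i, j))) = signof p * dt L A"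
    by (rule det_permute_rows) (use assms in \<open>auto simp: atLeast0LessThan\<close>)
  moreover have "mat L L (\<lambda>(i, j). mat L L (\<lambda>(i, j). A i j) $$ (p i, j)) = mat L L (\<lambda>(i, j). A (p i) j)"
    by (rule eq_matI) (auto simp: pL)
  ultimately show ?thesis by simp
qed

lemma dt_equal_rows:
  assumes "i < L" "i' < L" "i \<noteq> i'" "\<And>j. j < L \<Longrightarrow> A i j = A i' j"
  shows "dt L A = 0"
  by (rule det_identical_rows[of _ L i i']) (use assms in \<open>auto intro!: eq_vecI\<close>)


section \<open>Partitions and Toeplitz minors\<close>

lemma down_closed_nat_eq:
  fixes S :: "nat set"
  assumes "finite S" "\<And>i j. j \<in> S \<Longrightarrow> i \<le> j \<Longrightarrow> i \<in> S"
  shows "S = {..<card S}"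
proof (cases "S = {}")
  case False
  have "S = {..Max S}" 
  proof
    show "{..Max S} \<subseteq> S" using assms(2)[OF Max_in[OF assms(1) False]] by blast
  qed (use assms(1) in auto)
  then have "card S = Suc (Max S)" by (metis card_atMost)
  then show ?thesis using \<open>S = {..Max S}\<close> by (metis lessThan_Suc_atMost)
qed simp

lemma is_partitionD: "is_partition p \<Longrightarrow> i \<le> j \<Longrightarrow> p j \<le> p i"
  by (auto simp: is_partition_def antimono_def)

lemma partition_support:
  assumes "is_partition p"
  shows "{i. p i \<noteq> 0} = {..<plength p}"
  unfolding plength_def
proof (rule down_closed_nat_eq)
  show "finite {i. p i \<noteq> 0}" using assms by (simp add: is_partition_def)
  fix i j assume "j \<in> {i. p i \<noteq> 0}" "i \<le> j"
  then show "i \<in> {i. p i \<noteq> 0}" using is_partitionD[OF assms, of i j] by auto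
qed

lemma partition_nonzero_iff: "is_partition p \<Longrightarrow> p i \<noteq> 0 \<longleftrightarrow> i < plength p"
  using partition_support by auto

lemma partition_zero: "is_partition p \<Longrightarrow> plength p \<le> i \<Longrightarrow> p i = 0"
  using partition_nonzero_iff[of p i] by auto

lemma plength_le_iff: "is_partition p \<Longrightarrow> plength p \<le> L \<longleftrightarrow> p L = 0"
  using partition_nonzero_iff[of p L] by auto

lemma is_partitionI:
  assumes "\<And>i. p (Suc i) \<le> p i" "\<And>i. L \<le> i \<Longrightarrow> p i = 0"
  shows "is_partition p"
  unfolding is_partition_def
proof
  show "antimono p" using assms(1) by (rule decseq_SucI)
  have "{i. p i \<noteq> 0} \<subseteq> {..<L}" using assms(2) not_less by blast
  then show "finite {i. p i \<noteq> 0}" by (rule finite_subset) simp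
qed

lemma plength_mono: "is_partition l \<Longrightarrow> is_partition r \<Longrightarrow> l \<le> r \<Longrightarrow> plength l \<le> plength r"
  by (metis le_funD le_zero_eq plength_le_iff order_refl)

lemma is_partition_zero [simp]: "is_partition (\<lambda>_. 0)"
  by (rule is_partitionI[of _ 0]) auto

lemma plength_zero [simp]: "plength (\<lambda>_. 0) = 0"
  by (simp add: plength_def)

definition psize :: "(nat \<Rightarrow> nat) \<Rightarrow> nat" where
  "psize p = (\<Sum>i<plength p. p i)"

lemma psize_eq:
  assumes "is_partition p" "plength p \<le> L"
  shows "psize p = (\<Sum>i<L. p i)"
  unfolding psize_def
  by (rule sum.mono_neutral_left) (use assms partition_zero in auto)

lemma psize_zero [simp]: "psize (\<lambda>_. 0) = 0"
  by (simp add: psize_def)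

lemma skew_Sigma:
  assumes "is_partition r" "plength r \<le> L"
  shows "skew r l = Sigma {..<L} (\<lambda>i. {l i..<r i})"
proof -
  have "i < L" if "j < r i" for i j
    using partition_zero[OF assms(1), of i] assms(2) that by (cases "i < L") auto
  then show ?thesis by (auto simp: skew_def)
qed

lemma finite_skew: "is_partition r \<Longrightarrow> finite (skew r l)"
  by (subst skew_Sigma[OF _ order_refl]) auto

lemma card_skew_sum:
  assumes "is_partition r" "plength r \<le> L"
  shows "card (skew r l) = (\<Sum>i<L. r i - l i)"
  by (subst skew_Sigma[OF assms]) simp

lemma card_skew:
  assumes "is_partition r" "is_partition l" "l \<le> r"
  shows "card (skew r l) + psize l = psize r"
proof -
  have "card (skew r l) + psize l = (\<Sum>i<plength r. (r i - l i) + l i)"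
    using card_skew_sum[OF assms(1) order_refl] psize_eq[OF assms(2) plength_mono[OF assms(2,1,3)]]
    by (simp add: sum.distrib)
  also have "\<dots> = psize r"
    using assms(3) by (simp add: psize_def le_fun_def)
  finally show ?thesis .
qed

lemma card_diagram: "is_partition r \<Longrightarrow> card (diagram r) = psize r"
  using card_skew[of r "\<lambda>_. 0"] by (auto simp: le_fun_def)

lemma skew_empty_iff: 
  assumes le: "l \<le> r" shows "skew r l = {} \<longleftrightarrow> l = r"
proof
  assume e: "skew r l = {}"
  have "(i, l i) \<notin> skew r l" for i using e by simp
  then have "r i \<le> l i" for i by (auto simp: skew_def not_less)
  then show "l = r" using le by (intro ext antisym) (auto simp: le_fun_def)
qed (auto simp: skew_def)

lemma psize_mono:
  assumes "is_partition r" "is_partition l" "l \<le> r"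
  shows "psize l \<le> psize r"
  using card_skew[OF assms] by simp

lemma psize_eq_imp_eq:
  assumes "is_partition r" "is_partition l" "l \<le> r" "psize l = psize r"
  shows "l = r"
  using card_skew[OF assms(1-3)] assms(4) finite_skew[OF assms(1), of l] skew_empty_iff[OF assms(3)] by simp

lemma partition_le_psize:
  assumes "is_partition p" shows "p i \<le> psize p"
proof (cases "i < plength p")
  case True
  then show ?thesis unfolding psize_def by (intro member_le_sum) auto
qed (use partition_zero[OF assms] in auto)

lemma plength_le_psize:
  assumes "is_partition p" shows "plength p \<le> psize p"
proof -
  have "(\<Sum>i<plength p. 1) \<le> psize p"
    unfolding psize_def by (rule sum_mono) (use partition_nonzero_iff[OF assms] in \<open>auto simp: Suc_le_eq\<close>)
  then show ?thesis by simp
qed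

lemma finite_partitions_bounded: "finite {p. is_partition p \<and> psize p \<le> s}"
proof (rule finite_subset)
  show "{p. is_partition p \<and> psize p \<le> s} \<subseteq>
     {f. \<forall>i. (i \<in> {..<s} \<longrightarrow> f i \<in> {..s}) \<and> (i \<notin> {..<s} \<longrightarrow> f i = 0)}"
  proof (clarify, intro conjI impI)
    fix p i assume p: "is_partition p" "psize p \<le> s"
    show "p i \<in> {..s}" using partition_le_psize[OF p(1), of i] p(2) by simp
    assume "i \<notin> {..<s}"
    then show "p i = 0" using plength_le_psize[OF p(1)] p by (intro partition_zero) auto
  qed
  show "finite {f :: nat \<Rightarrow> nat. \<forall>i. (i \<in> {..<s} \<longrightarrow> f i \<in> {..s}) \<and> (i \<notin> {..<s} \<longrightarrow> f i = 0)}"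
    by (rule finite_set_of_finite_funs) auto
qed

lemma finite_partitions_below:
  assumes "is_partition r" shows "finite {p. is_partition p \<and> p \<le> r}"
  by (rule finite_subset[OF _ finite_partitions_bounded[of "psize r"]]) (use psize_mono assms in auto)

section \<open>Conjugate partitions\<close>

lemma conj_part_iff:
  assumes "is_partition p" shows "i < conj_part p j \<longleftrightarrow> j < p i"
proof -
  have "{i. j < p i} = {..<card {i. j < p i}}"
  proof (rule down_closed_nat_eq)
    show "finite {i. j < p i}"
      by (rule finite_subset[of _ "{i. p i \<noteq> 0}"]) (use assms in \<open>auto simp: is_partition_def\<close>)
    fix i i' assume "i' \<in> {i. j < p i}" "i \<le> i'"
    then show "i \<in> {i. j < p i}" using is_partitionD[OF assms, of i i'] by auto
  qed
  then show ?thesis unfolding conj_part_def by blast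
qed

lemma is_partition_conj [simp]:
  assumes "is_partition p" shows "is_partition (conj_part p)"
proof (rule is_partitionI)
  fix i show "conj_part p (Suc i) \<le> conj_part p i"
    using conj_part_iff[OF assms, of "conj_part p i" i] conj_part_iff[OF assms, of "conj_part p i" "Suc i"]
    by linarith
next
  fix i assume "p 0 \<le> i"
  then have "\<not> 0 < conj_part p i" using conj_part_iff[OF assms, of 0 i] by simp
  then show "conj_part p i = 0" by simp
qed

lemma conj_conj [simp]: 
  assumes "is_partition p" shows "conj_part (conj_part p) = p"
proof
  fix i
  have "j < conj_part (conj_part p) i \<longleftrightarrow> j < p i" for j
    using conj_part_iff[OF is_partition_conj[OF assms]] conj_part_iff[OF assms] by simp
  from this[of "p i"] this[of "conj_part (conj_part p) i"]
  show "conj_part (conj_part p) i = p i" by linarith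
qed

lemma conj_mono:
  assumes "is_partition l" "is_partition r" "l \<le> r" shows "conj_part l \<le> conj_part r"
  unfolding le_fun_def
proof
  fix j show "conj_part l j \<le> conj_part r j"
    using conj_part_iff[OF assms(1), of "conj_part r j" j] conj_part_iff[OF assms(2), of "conj_part r j" j]
      le_funD[OF assms(3), of "conj_part r j"] by linarith
qed

lemma conj_le_iff: 
  assumes "is_partition l" "is_partition r" 
  shows "conj_part l \<le> conj_part r \<longleftrightarrow> l \<le> r"
  using conj_mono[OF assms] conj_mono[OF is_partition_conj[OF assms(1)] is_partition_conj[OF assms(2)]] assms
  by auto

lemma skew_conj:
  assumes "is_partition l" "is_partition r" 
  shows "skew (conj_part r) (conj_part l) = prod.swap ` skew r l"
proof -
  have "conj_part l i \<le> j \<longleftrightarrow> l j \<le> i" for i j using conj_part_iff[OF assms(1), of j i] by linarith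
  then show ?thesis using conj_part_iff[OF assms(2)] by (auto simp: skew_def image_iff prod.swap_def)
qed

lemma card_skew_conj:
  assumes "is_partition l" "is_partition r" 
  shows "card (skew (conj_part r) (conj_part l)) = card (skew r l)"
  unfolding skew_conj[OF assms] by (rule card_image) (auto intro: injI)

section \<open>Beads, and determinants in their differences\<close>

definition bead :: "(nat \<Rightarrow> nat) \<Rightarrow> nat \<Rightarrow> int" where
  "bead l i = int (l i) - int i"

lemma bead_less: "is_partition l \<Longrightarrow> i < j \<Longrightarrow> bead l j < bead l i"
  using is_partitionD[of l i j] by (simp add: bead_def)

lemma bead_less_iff: "is_partition l \<Longrightarrow> bead l j < bead l i \<longleftrightarrow> i < j"
  using bead_less by (metis less_asym linorder_neqE_nat less_irrefl)

lemma bead_eq_iff: "is_partition l \<Longrightarrow> bead l j = bead l i \<longleftrightarrow> i = j"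
  using bead_less by (metis linorder_neqE_nat less_irrefl)

lemma bead_le_iff: "is_partition l \<Longrightarrow> bead l j \<le> bead l i \<longleftrightarrow> i \<le> j"
  using bead_less_iff by (metis not_less)

definition toep :: "nat \<Rightarrow> (int \<Rightarrow> 'a::comm_ring_1) \<Rightarrow> (nat \<Rightarrow> nat) \<Rightarrow> (nat \<Rightarrow> nat) \<Rightarrow> 'a" where
  "toep L f l r = dt L (\<lambda>i j. f (bead r i - bead l j))"

text \<open>For a power series \<open>F = \<Prod>\<^sub>i f(x\<^sub>i)\<close>, where \<open>f\<close> is given by its coefficients and has constant term
  1, \<open>minor f l r\<close> is the coefficient of the Schur function of \<open>r\<close> in the product of \<open>F\<close> and the
  Schur function of \<open>l\<close>.  The order of the matrix does not matter once it is at least both lengths.\<close>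

definition minor :: "(int \<Rightarrow> 'a::comm_ring_1) \<Rightarrow> (nat \<Rightarrow> nat) \<Rightarrow> (nat \<Rightarrow> nat) \<Rightarrow> 'a" where
  "minor f l r = toep (max (plength l) (plength r)) f l r"

text \<open>Coefficients are indexed by all integers and vanish at negative ones, because
  differences of beads have both signs. The constant term 1 makes the minors stable under enlarging
  the matrix.\<close>

definition causal :: "(int \<Rightarrow> 'a::comm_ring_1) \<Rightarrow> bool" where
  "causal f \<longleftrightarrow> (\<forall>e<0. f e = 0) \<and> f 0 = 1"

text \<open>Where the beads of \<open>r\<close> and \<open>l\<close> agree, the diagonal entry is
  \<open>f 0 = 1\<close> and everything to its left has a negative argument.\<close>

lemma toep_stable:
  assumes "causal f" "is_partition l" "is_partition r" "K \<le> L" "\<And>i. K \<le> i \<Longrightarrow> i < L \<Longrightarrow> r i = l i"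
  shows "toep L f l r = toep K f l r"
  unfolding toep_def
proof (rule dt_stable[OF assms(4)])
  fix i assume i: "K \<le> i" "i < L"
  then have b: "bead r i = bead l i" using assms(5) by (simp add: bead_def)
  then show "f (bead r i - bead l i) = 1" using assms(1) by (simp add: causal_def)
  fix j assume "j < i"
  then have "bead r i < bead l j" using b bead_less[OF assms(2)] by simp
  then show "f (bead r i - bead l j) = 0" using assms(1) by (simp add: causal_def)
qed

lemma minor_toep:
  assumes "causal f" "is_partition l" "is_partition r" "plength l \<le> L" "plength r \<le> L"
  shows "minor f l r = toep L f l r"
  unfolding minor_def
  by (rule toep_stable[symmetric]) (use assms in \<open>auto simp: partition_zero\<close>)

text \<open>The beads of \<open>r\<close> from row \<open>i\<close> on all lie below the beads of
  \<open>l\<close> up to row \<open>i\<close>, so a block of \<open>L - i\<close> rows and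
  \<open>i + 1\<close> columns vanishes.\<close>

lemma toep_zero:
  assumes "causal f" "is_partition l" "is_partition r" "i < L" "r i < l i"
  shows "toep L f l r = 0"
  unfolding toep_def
proof (rule dt_zero_block[where R = "{i..<L}" and C = "{..i}"])
  fix i' j assume "i' \<in> {i..<L}" "j \<in> {..i}"
  then have "bead r i' \<le> bead r i" "bead r i < bead l i" "bead l i \<le> bead l j"
    using assms by (auto simp: bead_le_iff) (simp add: bead_def)
  then show "f (bead r i' - bead l j) = 0" using assms(1) by (simp add: causal_def)
qed (use assms in auto)

lemma minor_zero:
  assumes "causal f" "is_partition l" "is_partition r" "\<not> l \<le> r"
  shows "minor f l r = 0"
proof -
  obtain i where i: "r i < l i" using assms(4) by (auto simp: le_fun_def not_le)
  then have "i < plength l" using partition_nonzero_iff[OF assms(2), of i] by auto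
  then show ?thesis unfolding minor_def using assms i by (intro toep_zero[of f l r i]) auto
qed

lemma minor_self:
  assumes "causal f" "is_partition l" 
  shows "minor f l l = 1"
  using toep_stable[OF assms assms(2), of 0 "plength l"] by (simp add: minor_def toep_def)


section \<open>Ribbons\<close>

text \<open>A ribbon in rows \<open>p, ..., q\<close> by row lengths: consecutive rows share exactly
  one column. On beads, \<open>t' (Suc i) = Suc (t i)\<close> says that a bead stays in place while
  its index grows by one; altogether one bead jumps from \<open>bead t q\<close> up by
  \<open>n\<close> and lands as number \<open>p\<close>.\<close>

definition rib :: "nat \<Rightarrow> nat \<Rightarrow> nat \<Rightarrow> (nat \<Rightarrow> nat) \<Rightarrow> (nat \<Rightarrow> nat) \<Rightarrow> bool" where
  "rib p q n t t' \<longleftrightarrow> p \<le> q \<and> (\<forall>i. i < p \<or> q < i \<longrightarrow> t' i = t i) \<and>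
     (\<forall>i. p \<le> i \<and> i < q \<longrightarrow> t' (Suc i) = Suc (t i)) \<and>
     bead t' p = bead t q + int n \<and> t p < t' p"

lemma ribD:
  assumes "rib p q n t t'"
  shows "p \<le> q" "i < p \<or> q < i \<Longrightarrow> t' i = t i" "p \<le> i \<Longrightarrow> i < q \<Longrightarrow> t' (Suc i) = Suc (t i)"
    "bead t' p = bead t q + int n" "t p < t' p"
  using assms by (auto simp: rib_def)

lemma rib_less:
  assumes "rib p q n t t'" "is_partition t" "p \<le> i" "i \<le> q"
  shows "t i < t' i"
proof (cases "i = p")
  case False
  then obtain i' where i': "i = Suc i'" using assms(3) by (cases i) auto
  then have "t' i = Suc (t i')" using ribD(3)[OF assms(1), of i'] assms False by auto
  then show ?thesis using is_partitionD[OF assms(2), of i' i] i' by simp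
qed (use ribD[OF assms(1)] in simp)

lemma rib_in_rows:
  assumes "rib p q n t t'" "t i < t' i"
  shows "p \<le> i" "i \<le> q"
  using ribD(2)[OF assms(1), of i] assms(2) by force+

lemma rib_le: "rib p q n t t' \<Longrightarrow> is_partition t \<Longrightarrow> t \<le> t'"
  unfolding le_fun_def
proof
  fix i assume r: "rib p q n t t'" and t: "is_partition t"
  show "t i \<le> t' i"
    using rib_less[OF r t, of i] ribD(2)[OF r, of i] by linarith
qed

lemma rib_fst:
  assumes "rib p q n t t'" "is_partition t"
  shows "fst ` skew t' t = {p..q}"
proof
  show "fst ` skew t' t \<subseteq> {p..q}" using rib_in_rows[OF assms(1)] by (force simp: skew_def)
  show "{p..q} \<subseteq> fst ` skew t' t"
  proof
    fix i assume "i \<in> {p..q}"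
    then have "(i, t i) \<in> skew t' t" using rib_less[OF assms] by (simp add: skew_def)
    then show "i \<in> fst ` skew t' t" by force
  qed
qed

lemma rib_num_rows:
  assumes "rib p q n t t'" "is_partition t"
  shows "num_rows (skew t' t) = Suc (q - p)" "height (skew t' t) = q - p"
  using ribD(1)[OF assms(1)] by (auto simp: num_rows_def height_def rib_fst[OF assms])

lemma rib_northeastmost:
  assumes "rib p q n t t'" "is_partition t" "is_partition t'"
  shows "northeastmost (skew t' t) (p, t' p - 1)"
  unfolding northeastmost_def
proof (intro conjI ballI)
  show "(p, t' p - 1) \<in> skew t' t" using ribD(5)[OF assms(1)] by (auto simp: skew_def)
  fix c assume c: "c \<in> skew t' t"
  then have "t (fst c) < t' (fst c)" by (auto simp: skew_def)
  then show "fst (p, t' p - 1) \<le> fst c" using rib_in_rows[OF assms(1)] by simp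
  then have "t' (fst c) \<le> t' p" using is_partitionD[OF assms(3)] by simp
  then show "snd c \<le> snd (p, t' p - 1)" using c by (auto simp: skew_def)
qed

lemma rib_southwestmost:
  assumes "rib p q n t t'" "is_partition t"
  shows "southwestmost (skew t' t) (q, t q)"
  unfolding southwestmost_def
proof (intro conjI ballI)
  show "(q, t q) \<in> skew t' t" using rib_less[OF assms, of q] ribD(1)[OF assms(1)] by (auto simp: skew_def)
  fix c assume c: "c \<in> skew t' t"
  then have "t (fst c) < t' (fst c)" by (auto simp: skew_def)
  then show "fst c \<le> fst (q, t q)" using rib_in_rows[OF assms(1)] by simp
  then have "t q \<le> t (fst c)" using is_partitionD[OF assms(2)] by simp
  then show "snd (q, t q) \<le> snd c" using c by (auto simp: skew_def)
qed

lemma northeastmost_unique: "northeastmost B b \<Longrightarrow> northeastmost B c \<Longrightarrow> b = c"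
  unfolding northeastmost_def by (metis order_antisym prod_eqI)

lemma southwestmost_unique: "southwestmost B b \<Longrightarrow> southwestmost B c \<Longrightarrow> b = c"
  unfolding southwestmost_def by (metis order_antisym prod_eqI)

text \<open>The added row lengths are differences of beads, and all beads but the jumping one
  cancel.\<close>

lemma rib_card:
  assumes r: "rib p q n t t'" and t: "is_partition t" "is_partition t'"
  shows "card (skew t' t) = n"
proof -
  define L where "L = max (Suc q) (plength t')"
  have pq: "p \<le> q" "q < L" using ribD(1)[OF r] by (auto simp: L_def)
  have "int (card (skew t' t)) = int (\<Sum>i<L. t' i - t i)"
    using card_skew_sum[OF t(2), of L t] by (simp add: L_def)
  also have "\<dots> = (\<Sum>i<L. bead t' i - bead t i)"
    using rib_le[OF r t(1)] by (simp add: bead_def le_fun_def of_nat_diff)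
  also have "\<dots> = (\<Sum>i\<in>{p..q}. bead t' i - bead t i)"
    by (rule sum.mono_neutral_right) (use pq ribD(2)[OF r] in \<open>auto simp: bead_def\<close>)
  also have "\<dots> = (\<Sum>i\<in>{p..q}. bead t' i) - (\<Sum>i\<in>{p..q}. bead t i)"
    by (simp add: sum_subtractf)
  also have "(\<Sum>i\<in>{p..q}. bead t' i) = bead t' p + (\<Sum>i\<in>{p..<q}. bead t' (Suc i))"
    using pq(1) by (induction q rule: dec_induct) auto
  also have "(\<Sum>i\<in>{p..<q}. bead t' (Suc i)) = (\<Sum>i\<in>{p..<q}. bead t i)"
    using ribD(3)[OF r] by (intro sum.cong) (auto simp: bead_def)
  also have "(\<Sum>i\<in>{p..q}. bead t i) = (\<Sum>i\<in>{p..<q}. bead t i) + bead t q"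
    using pq by (simp flip: atLeastLessThanSuc_atLeastAtMost)
  finally show ?thesis using ribD(4)[OF r] by simp
qed

section \<open>Agreement with the definition of ribbons by connected boxes\<close>

abbreviation box_adj :: "(nat \<times> nat) set \<Rightarrow> ((nat \<times> nat) \<times> nat \<times> nat) set" where
  "box_adj B \<equiv> {(x, y). x \<in> B \<and> y \<in> B \<and> adjacent x y}"

lemma adjacent_sym: "adjacent x y \<longleftrightarrow> adjacent y x"
  by (simp add: adjacent_def abs_minus_commute)

text \<open>A discrete intermediate value argument: a step between neighbours changes the row by at
  most one, and then keeps the column.\<close>

lemma box_path_crosses_row:
  assumes "(b, c) \<in> (box_adj B)\<^sup>*" "fst b \<le> i" "i < fst c"
  shows "\<exists>j. (i, j) \<in> B \<and> (Suc i, j) \<in> B"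
  using assms(1,3)
proof (induction rule: rtrancl_induct)
  case base
  then show ?case using assms(2) by simp
next
  case (step y z)
  show ?case
  proof (cases "i < fst y")
    case False
    then have "fst y = i" "fst z = Suc i" "snd y = snd z" 
      using step.hyps(2) step.prems by (auto simp: adjacent_def)
    then show ?thesis using step.hyps(2) by (metis (mono_tags, lifting) case_prodD mem_Collect_eq prod.collapse)
  qed (use step.IH in simp)
qed

text \<open>Connectedness forces consecutive rows between the extreme ones to share a column, and
  the absence of a 2 by 2 block forbids a second shared column.\<close>

lemma ribbon_imp_rib:
  assumes t: "is_partition t" "is_partition t'" "t \<le> t'" and rb: "ribbon (skew t' t)"
  shows "\<exists>p q. rib p q (card (skew t' t)) t t'"
proof -
  let ?B = "skew t' t"
  have ne: "?B \<noteq> {}" and fin: "finite ?B" using rb finite_skew[OF t(2)] by (auto simp: ribbon_def box_connected_def)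
  define p where "p = Min (fst ` ?B)"
  define q where "q = Max (fst ` ?B)"
  have pB: "p \<in> fst ` ?B" and qB: "q \<in> fst ` ?B" using ne fin unfolding p_def q_def by auto
  have bnd: "p \<le> fst c" "fst c \<le> q" if "c \<in> ?B" for c
    using that fin unfolding p_def q_def by auto
  have out: "t' i = t i" if "i < p \<or> q < i" for i
  proof -
    have "(i, t i) \<notin> ?B" using bnd that by fastforce
    then show ?thesis using le_funD[OF t(3), of i] by (simp add: skew_def)
  qed
  have cons: "t' (Suc i) = Suc (t i)" if i: "p \<le> i" "i < q" for i
  proof -
    obtain b c where bc: "b \<in> ?B" "fst b = p" "c \<in> ?B" "fst c = q" using pB qB by auto
    then have "(b, c) \<in> (box_adj ?B)\<^sup>*" using rb by (auto simp: ribbon_def box_connected_def)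
    then obtain j where j: "(i, j) \<in> ?B" "(Suc i, j) \<in> ?B"
      using box_path_crosses_row[of b c ?B i] i bc by auto
    have "\<not> Suc (t i) < t' (Suc i)"
    proof
      assume a: "Suc (t i) < t' (Suc i)"
      then have "{(i, t i), (Suc i, t i), (i, Suc (t i)), (Suc i, Suc (t i))} \<subseteq> ?B"
        using is_partitionD[OF t(1), of i "Suc i"] is_partitionD[OF t(2), of i "Suc i"] by (auto simp: skew_def)
      then show False using rb unfolding ribbon_def by blast
    qed
    then show ?thesis using j by (auto simp: skew_def)
  qed
  have tp: "t p < t' p" using pB by (auto simp: skew_def)
  have pq: "p \<le> q" using bnd[of "SOME c. c \<in> ?B"] ne some_in_eq[of ?B] by auto
  then have "bead t q \<le> bead t p" "bead t p < bead t' p" using tp t by (auto simp: bead_le_iff) (simp add: bead_def)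
  then have "rib p q (nat (bead t' p - bead t q)) t t'"
    using out cons tp pq by (simp add: rib_def)
  from this rib_card[OF this t(1,2)] show ?thesis by auto
qed

lemma rib_imp_ribbon:
  assumes r: "rib p q n t t'" and t: "is_partition t" "is_partition t'"
  shows "ribbon (skew t' t)"
proof -
  let ?B = "skew t' t"
  have row: "((i, t i + d), (i, t i)) \<in> (box_adj ?B)\<^sup>*" if "(i, t i + d) \<in> ?B" for i d
    using that
  proof (induction d)
    case (Suc d)
    have "(i, t i + d) \<in> ?B" using Suc.prems by (auto simp: skew_def)
    then have "((i, t i + Suc d), (i, t i + d)) \<in> box_adj ?B" using Suc.prems by (auto simp: adjacent_def)
    then show ?case using Suc.IH[OF \<open>(i, t i + d) \<in> ?B\<close>] by (rule converse_rtrancl_into_rtrancl)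
  qed simp
  \<comment> \<open>Every box is linked to the southwest box: walk to the left end of its row, step
    down, repeat; \<open>q - i\<close> counts the rows that remain.\<close>
  have base: "((i, j), (q, t q)) \<in> (box_adj ?B)\<^sup>*" if "(i, j) \<in> ?B" for i j
    using that
  proof (induction "q - i" arbitrary: i j)
    case 0
    then have "i = q" using rib_in_rows[OF r, of i] by (auto simp: skew_def)
    then show ?case using row[of i "j - t i"] 0 by (auto simp: skew_def)
  next
    case (Suc d)
    have i: "p \<le> i" "i < q" using rib_in_rows[OF r, of i] Suc by (auto simp: skew_def)
    have 1: "((i, j), (i, t i)) \<in> (box_adj ?B)\<^sup>*"
      using row[of i "j - t i"] Suc.prems by (auto simp: skew_def)
    have in1: "(i, t i) \<in> ?B" using Suc.prems by (auto simp: skew_def)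
    have in2: "(Suc i, t i) \<in> ?B"
      using ribD(3)[OF r i] is_partitionD[OF t(1), of i "Suc i"] by (auto simp: skew_def)
    have 2: "((i, t i), (Suc i, t i)) \<in> box_adj ?B" using in1 in2 by (auto simp: adjacent_def)
    have 3: "((Suc i, t i), (q, t q)) \<in> (box_adj ?B)\<^sup>*"
      by (rule Suc.hyps(1)[OF _ in2]) (use Suc.hyps(2) in simp)
    show ?case using 1 2 3 by (meson rtrancl.rtrancl_into_rtrancl rtrancl_trans)
  qed
  have "sym ((box_adj ?B)\<^sup>*)" by (intro sym_rtrancl symI) (auto simp: adjacent_sym)
  then have "(b, c) \<in> (box_adj ?B)\<^sup>*" if "b \<in> ?B" "c \<in> ?B" for b c
    using base[of "fst b" "snd b"] base[of "fst c" "snd c"] that by (auto dest: symD intro: rtrancl_trans)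
  moreover have "?B \<noteq> {}" using rib_southwestmost[OF r t(1)] by (auto simp: southwestmost_def)
  ultimately have "box_connected ?B" by (auto simp: box_connected_def)
  moreover have "\<not> (\<exists>i j. {(i, j), (Suc i, j), (i, Suc j), (Suc i, Suc j)} \<subseteq> ?B)"
  proof
    assume "\<exists>i j. {(i, j), (Suc i, j), (i, Suc j), (Suc i, Suc j)} \<subseteq> ?B"
    then obtain i j where ij: "(i, j) \<in> ?B" "(Suc i, Suc j) \<in> ?B" by auto
    then have "p \<le> i" "Suc i \<le> q" using rib_in_rows[OF r, of i] rib_in_rows[OF r, of "Suc i"] by (auto simp: skew_def)
    then show False using ribD(3)[OF r, of i] ij by (auto simp: skew_def)
  qed
  ultimately show ?thesis using t rib_le[OF r t(1)] by (auto simp: ribbon_def is_skew_diagram_def)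
qed

lemma ribbon_iff_rib:
  assumes "is_partition t" "is_partition t'" "t \<le> t'"
  shows "ribbon (skew t' t) \<and> card (skew t' t) = n \<longleftrightarrow> (\<exists>p q. rib p q n t t')"
proof
  assume "ribbon (skew t' t) \<and> card (skew t' t) = n"
  then show "\<exists>p q. rib p q n t t'" using ribbon_imp_rib[OF assms] by auto
next
  assume "\<exists>p q. rib p q n t t'"
  then show "ribbon (skew t' t) \<and> card (skew t' t) = n"
    using rib_imp_ribbon[OF _ assms(1,2)] rib_card[OF _ assms(1,2)] by auto
qed

section \<open>Transposition of ribbons\<close>

lemma ribbon_swap:
  assumes "ribbon B" shows "ribbon (prod.swap ` B)"
proof -
  let ?C = "prod.swap ` B"
  have "is_skew_diagram ?C"
  proof -
    obtain l u where lu: "is_partition l" "is_partition u" "u \<le> l" "B = skew l u"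
      using assms unfolding ribbon_def is_skew_diagram_def by blast
    then have "?C = skew (conj_part l) (conj_part u)" using skew_conj by simp
    then show ?thesis using lu conj_mono is_partition_conj unfolding is_skew_diagram_def by blast
  qed
  moreover have "box_connected ?C"
    unfolding box_connected_def
  proof (intro conjI ballI)
    show "?C \<noteq> {}" using assms by (auto simp: ribbon_def box_connected_def)
    fix b c assume "b \<in> ?C" "c \<in> ?C"
    then obtain b' c' where bc: "b = prod.swap b'" "b' \<in> B" "c = prod.swap c'" "c' \<in> B" by auto
    then have "(b', c') \<in> (box_adj B)\<^sup>*" using assms by (auto simp: ribbon_def box_connected_def)
    then have "(prod.swap b', prod.swap c') \<in> (box_adj ?C)\<^sup>*"
    proof (induction rule: rtrancl_induct)
      case (step y z)
      have "(prod.swap y, prod.swap z) \<in> box_adj ?C"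
        using step.hyps(2) by (auto simp: adjacent_def add.commute)
      then show ?case using step.IH by (rule rtrancl_into_rtrancl[rotated])
    qed simp
    then show "(b, c) \<in> (box_adj ?C)\<^sup>*" using bc by simp
  qed
  moreover have "\<not> (\<exists>i j. {(i, j), (Suc i, j), (i, Suc j), (Suc i, Suc j)} \<subseteq> ?C)"
  proof
    assume "\<exists>i j. {(i, j), (Suc i, j), (i, Suc j), (Suc i, Suc j)} \<subseteq> ?C"
    then obtain i j where "{(j, i), (Suc j, i), (j, Suc i), (Suc j, Suc i)} \<subseteq> B" by (auto simp: image_iff)
    then show False using assms unfolding ribbon_def by blast
  qed
  ultimately show ?thesis by (simp add: ribbon_def)
qed

lemma northeastmost_swap: "northeastmost (prod.swap ` B) (prod.swap b) \<longleftrightarrow> southwestmost B b"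
  by (cases b) (auto simp: northeastmost_def southwestmost_def)

lemma southwestmost_swap: "southwestmost (prod.swap ` B) (prod.swap b) \<longleftrightarrow> northeastmost B b"
  by (cases b) (auto simp: northeastmost_def southwestmost_def)

text \<open>The rows of the transposed ribbon are the columns \<open>t q, ..., t' p - 1\<close> of
  the given one. They are found without computing with conjugates: transposition exchanges the two
  extreme boxes, and these determine the rows.\<close>

lemma rib_conj:
  assumes r: "rib p q n t t'" and t: "is_partition t" "is_partition t'"
  shows "rib (t q) (t' p - 1) n (conj_part t) (conj_part t')"
proof -
  let ?t = "conj_part t" and ?t' = "conj_part t'"
  have sw: "skew ?t' ?t = prod.swap ` skew t' t" using skew_conj t by simp
  obtain p' q' where r': "rib p' q' n ?t ?t'"
    using ribbon_imp_rib[of ?t ?t'] t sw ribbon_swap[OF rib_imp_ribbon[OF r t]] conj_mono rib_le[OF r t(1)]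
      card_skew_conj[OF t] rib_card[OF r t] by auto
  have "northeastmost (skew ?t' ?t) (prod.swap (q, t q))"
    unfolding sw northeastmost_swap by (rule rib_southwestmost[OF r t(1)])
  then have "p' = t q" using northeastmost_unique rib_northeastmost[OF r'] t by fastforce
  moreover have "southwestmost (skew ?t' ?t) (prod.swap (p, t' p - 1))"
    unfolding sw southwestmost_swap by (rule rib_northeastmost[OF r t])
  then have "q' = t' p - 1" using southwestmost_unique rib_southwestmost[OF r'] t by fastforce
  ultimately show ?thesis using r' by simp
qed

lemma rib_rows_unique:
  assumes "rib p q n t t'" "rib p' q' n' t t'" "is_partition t"
  shows "p = p'" "q = q'"
  using rib_fst[OF assms(1,3)] rib_fst[OF assms(2,3)] ribD(1)[OF assms(1)] by (auto simp: Icc_eq_Icc)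

text \<open>Rows plus columns of a ribbon exceed its boxes by one. This is what converts signs by
  height into signs by the rows of the transpose.\<close>

lemma ribbon_num_rows_swap:
  assumes t: "is_partition t" "is_partition t'" "t \<le> t'" and rb: "ribbon (skew t' t)"
  shows "num_rows (skew t' t) + num_rows (prod.swap ` skew t' t) = Suc (card (skew t' t))"
proof -
  obtain p q where r: "rib p q (card (skew t' t)) t t'" using ribbon_imp_rib[OF t rb] by auto
  have "num_rows (skew t' t) = Suc (q - p)" "num_rows (prod.swap ` skew t' t) = Suc (t' p - 1 - t q)"
    using rib_num_rows(1)[OF r t(1)] rib_num_rows(1)[OF rib_conj[OF r t(1,2)]] skew_conj t by auto
  moreover have "t q \<le> t p" using ribD(1)[OF r] is_partitionD[OF t(1)] by simp
  ultimately show ?thesis using ribD(1,4,5)[OF r] by (simp add: bead_def)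
qed


section \<open>Horizontal and vertical ribbons as minors\<close>

definition is_chain :: "((nat \<Rightarrow> nat) \<Rightarrow> (nat \<Rightarrow> nat) \<Rightarrow> bool) \<Rightarrow> (nat \<Rightarrow> nat) list \<Rightarrow>
    (nat \<Rightarrow> nat) \<Rightarrow> (nat \<Rightarrow> nat) \<Rightarrow> bool" where
  "is_chain R ts l r \<longleftrightarrow> ts \<noteq> [] \<and> hd ts = l \<and> last ts = r \<and> (\<forall>t\<in>set ts. is_partition t) \<and>
     (\<forall>i. Suc i < length ts \<longrightarrow> R (ts ! i) (ts ! Suc i))"

text \<open>The ending box is topmost in its column of the whole skew shape exactly if there is no
  row above it or the box above it lies in \<open>l\<close>.\<close>

definition hstep :: "nat \<Rightarrow> (nat \<Rightarrow> nat) \<Rightarrow> (nat \<Rightarrow> nat) \<Rightarrow> (nat \<Rightarrow> nat) \<Rightarrow> bool" where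
  "hstep n l t t' \<longleftrightarrow> (\<exists>p q. rib p q n t t' \<and> (p = 0 \<or> t' p \<le> l (p - 1)))"

text \<open>The transposed condition: the starting box is leftmost in its row of the whole skew
  shape. Together with \<open>l \<le> t\<close> it forces \<open>t q = l q\<close>.\<close>

definition vstep :: "nat \<Rightarrow> (nat \<Rightarrow> nat) \<Rightarrow> (nat \<Rightarrow> nat) \<Rightarrow> (nat \<Rightarrow> nat) \<Rightarrow> bool" where
  "vstep n l t t' \<longleftrightarrow> (\<exists>p q. rib p q n t t' \<and> t q \<le> l q)"

lemma list_steps_mono:
  fixes ts :: "(nat \<Rightarrow> nat) list"
  assumes "\<And>i. Suc i < length ts \<Longrightarrow> ts ! i \<le> ts ! Suc i" "i \<le> j" "j < length ts"
  shows "ts ! i \<le> ts ! j"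
  using assms(2,3)
proof (induction j rule: dec_induct)
  case (step j)
  then show ?case using assms(1)[of j] by (auto intro: order.trans)
qed simp

lemma list_steps_bounds:
  fixes ts :: "(nat \<Rightarrow> nat) list"
  assumes "\<And>i. Suc i < length ts \<Longrightarrow> ts ! i \<le> ts ! Suc i" "i < length ts"
  shows "hd ts \<le> ts ! i" "ts ! i \<le> last ts"
proof -
  have ne: "ts \<noteq> []" using assms(2) by auto
  show "hd ts \<le> ts ! i" using list_steps_mono[of ts 0 i, OF assms(1)] assms(2) ne by (simp add: hd_conv_nth)
  show "ts ! i \<le> last ts" 
    using list_steps_mono[of ts i "length ts - 1", OF assms(1)] assms(2) ne by (simp add: last_conv_nth)
qed

lemma is_chain_step:
  assumes "is_chain R ts l r" "Suc i < length ts"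
  shows "R (ts ! i) (ts ! Suc i)" "is_partition (ts ! i)" "is_partition (ts ! Suc i)"
  using assms by (auto simp: is_chain_def)

lemma is_chain_ends: "is_chain R ts l r \<Longrightarrow> is_partition l \<and> is_partition r"
  unfolding is_chain_def by auto

text \<open>A box above the ending box always lies in \<open>r\<close>, so being outside
  \<open>r/l\<close> means lying in \<open>l\<close>. The step condition therefore does not mention
  \<open>r\<close>, and chains can be built by appending one step at a time.\<close>

lemma ribbon_chain_iff_hstep: "ribbon_chain n r l ts \<longleftrightarrow> is_chain (hstep n l) ts l r"
proof
  assume c: "ribbon_chain n r l ts"
  then have parts: "is_partition t" if "t \<in> set ts" for t using that by (auto simp: ribbon_chain_def)
  have mono: "ts ! i \<le> ts ! Suc i" if "Suc i < length ts" for i using c that by (auto simp: ribbon_chain_def)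
  have "hstep n l (ts ! i) (ts ! Suc i)" if i: "Suc i < length ts" for i
  proof -
    let ?t = "ts ! i" and ?t' = "ts ! Suc i"
    have t: "is_partition ?t" "is_partition ?t'" using parts i by auto
    have "ribbon (skew ?t' ?t) \<and> card (skew ?t' ?t) = n" using c i by (auto simp: ribbon_chain_def)
    then obtain p q where r: "rib p q n ?t ?t'" using ribbon_iff_rib[OF t mono[OF i]] by auto
    have "\<exists>b. northeastmost (skew ?t' ?t) b \<and> (\<forall>c \<in> skew r l. snd c = snd b \<longrightarrow> fst b \<le> fst c)"
      using c i unfolding ribbon_chain_def by blast
    then obtain b where b: "northeastmost (skew ?t' ?t) b"
        "\<And>c. c \<in> skew r l \<Longrightarrow> snd c = snd b \<Longrightarrow> fst b \<le> fst c" by blast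
    have beq: "b = (p, ?t' p - 1)" using northeastmost_unique[OF b(1) rib_northeastmost[OF r t]] .
    have "p = 0 \<or> ?t' p \<le> l (p - 1)"
    proof (rule ccontr)
      assume a: "\<not> ?thesis"
      have "?t' (p - 1) \<le> r (p - 1)"
        using list_steps_bounds(2)[of ts "Suc i", OF mono i] c by (auto simp: ribbon_chain_def le_fun_def)
      moreover have "?t' p \<le> ?t' (p - 1)" using is_partitionD[OF t(2)] by simp
      ultimately have "(p - 1, ?t' p - 1) \<in> skew r l" using a by (auto simp: skew_def)
      then show False using b(2)[of "(p - 1, ?t' p - 1)"] beq a by (cases p) auto
    qed
    then show ?thesis using r by (auto simp: hstep_def)
  qed
  then show "is_chain (hstep n l) ts l r" using c by (auto simp: ribbon_chain_def is_chain_def)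
next
  assume c: "is_chain (hstep n l) ts l r"
  then have l: "is_partition l" using is_chain_ends by blast
  have "ts ! i \<le> ts ! Suc i \<and> ribbon (skew (ts ! Suc i) (ts ! i)) \<and>
        card (skew (ts ! Suc i) (ts ! i)) = n \<and>
        (\<exists>b. northeastmost (skew (ts ! Suc i) (ts ! i)) b \<and>
             (\<forall>c \<in> skew r l. snd c = snd b \<longrightarrow> fst b \<le> fst c))" if i: "Suc i < length ts" for i
  proof -
    let ?t = "ts ! i" and ?t' = "ts ! Suc i"
    note t = is_chain_step(2,3)[OF c i]
    obtain p q where r: "rib p q n ?t ?t'" and p: "p = 0 \<or> ?t' p \<le> l (p - 1)"
      using is_chain_step(1)[OF c i] by (auto simp: hstep_def)
    have le: "?t \<le> ?t'" by (rule rib_le[OF r t(1)])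
    have "\<forall>c \<in> skew r l. snd c = ?t' p - 1 \<longrightarrow> p \<le> fst c"
    proof (intro ballI impI, rule ccontr)
      fix c assume c: "c \<in> skew r l" "snd c = ?t' p - 1" "\<not> p \<le> fst c"
      then have "l (p - 1) \<le> l (fst c)" by (intro is_partitionD[OF l]) auto
      then show False using c p ribD(5)[OF r] by (auto simp: skew_def)
    qed
    then show ?thesis using le ribbon_iff_rib[OF t le] r rib_northeastmost[OF r t] by fastforce
  qed
  then show "ribbon_chain n r l ts" using c by (auto simp: ribbon_chain_def is_chain_def)
qed

lemma hstep_conj_iff_vstep:
  assumes l: "is_partition l" and t: "is_partition t" "is_partition t'"
  shows "hstep n (conj_part l) (conj_part t) (conj_part t') \<longleftrightarrow> vstep n l t t'"
proof -
  \<comment> \<open>Column \<open>t q\<close> is the first column of the ribbon and ends in row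
    \<open>q\<close>, hence \<open>conj_part t' (t q) = Suc q\<close>; the condition on columns
    becomes one on row \<open>q\<close>.\<close>
  have cond: "t q = 0 \<or> conj_part t' (t q) \<le> conj_part l (t q - 1) \<longleftrightarrow> t q \<le> l q" if r: "rib p q n t t'" for p q
  proof -
    have "q < conj_part t' (t q)" "\<not> Suc q < conj_part t' (t q)"
      using rib_less[OF r t(1), of q] ribD(1)[OF r] ribD(2)[OF r, of "Suc q"] is_partitionD[OF t(1), of q "Suc q"]
      by (auto simp: conj_part_iff[OF t(2)])
    then have "conj_part t' (t q) = Suc q" by simp
    then show ?thesis using conj_part_iff[OF l, of q "t q - 1"] by (auto simp: Suc_le_eq)
  qed
  show ?thesis
  proof
    assume "hstep n (conj_part l) (conj_part t) (conj_part t')"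
    then obtain p' q' where r': "rib p' q' n (conj_part t) (conj_part t')"
        and p': "p' = 0 \<or> conj_part t' p' \<le> conj_part l (p' - 1)" by (auto simp: hstep_def)
    obtain p q where r: "rib p q n t t'" using rib_conj[OF r'] t by auto
    have "p' = t q" using rib_rows_unique(1)[OF r' rib_conj[OF r t]] t by simp
    then show "vstep n l t t'" using cond[OF r] p' r by (auto simp: vstep_def)
  next
    assume "vstep n l t t'"
    then obtain p q where r: "rib p q n t t'" and q: "t q \<le> l q" by (auto simp: vstep_def)
    then show "hstep n (conj_part l) (conj_part t) (conj_part t')"
      using rib_conj[OF r t] cond[OF r] unfolding hstep_def by blast
  qed
qed

lemma ribbon_chain_iff_vstep:
  assumes lr: "is_partition l" "is_partition r"
  shows "ribbon_chain n (conj_part r) (conj_part l) ts \<longleftrightarrow>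
    (\<forall>t\<in>set ts. is_partition t) \<and> is_chain (vstep n l) (map conj_part ts) l r"
proof (cases "ts \<noteq> [] \<and> (\<forall>t\<in>set ts. is_partition t)")
  case True
  then have ne: "ts \<noteq> []" and parts: "\<And>t. t \<in> set ts \<Longrightarrow> is_partition t" by auto
  have ends: "hd ts = conj_part l \<longleftrightarrow> hd (map conj_part ts) = l" "last ts = conj_part r \<longleftrightarrow> last (map conj_part ts) = r"
    using ne lr parts[of "hd ts"] parts[of "last ts"] by (auto simp: hd_map last_map)
  have step: "hstep n (conj_part l) (ts ! i) (ts ! Suc i) \<longleftrightarrow> vstep n l (conj_part (ts ! i)) (conj_part (ts ! Suc i))"
    if "Suc i < length ts" for i
    using hstep_conj_iff_vstep[OF lr(1), of "conj_part (ts ! i)" "conj_part (ts ! Suc i)" n] that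
      parts[of "ts ! i"] parts[of "ts ! Suc i"] by simp
  show ?thesis
    unfolding ribbon_chain_iff_hstep is_chain_def using step ends parts ne by auto
qed (auto simp: ribbon_chain_def is_chain_def)

text \<open>The hypotheses on \<open>v\<close> place the position \<open>v - q\<close> strictly
  between the beads \<open>q + 1\<close> and \<open>q\<close> of \<open>r\<close>. Bead
  \<open>p\<close> of \<open>r\<close> moves down to this free position and becomes number
  \<open>q\<close>.\<close>

lemma unrib:
  assumes r: "is_partition r" and pq: "p \<le> q" and v: "v < r q" "r (Suc q) \<le> v"
    and n: "bead r p = int v - int q + int n"
  shows "\<exists>t. is_partition t \<and> rib p q n t r \<and> t q = v"
proof -
  define t where "t i = (if i < p \<or> q < i then r i else if i < q then r (Suc i) - 1 else v)" for i
  have le: "t i \<le> r i" for i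
    using v is_partitionD[OF r, of i "Suc i"] by (auto simp: t_def)
  have pos: "0 < r (Suc i)" if "i < q" for i
    using v is_partitionD[OF r, of "Suc i" q] that by auto
  have "is_partition t"
  proof (rule is_partitionI[of _ "max (plength r) (Suc q)"])
    fix i
    show "t (Suc i) \<le> t i"
    proof (cases "i < p \<or> q \<le> i")
      case True
      then show ?thesis using le[of "Suc i"] is_partitionD[OF r, of i "Suc i"] v pq by (auto simp: t_def)
    next
      case False
      then show ?thesis using v is_partitionD[OF r, of "Suc i" "Suc (Suc i)"] pq
        by (cases "Suc i = q") (auto simp: t_def)
    qed
    assume "max (plength r) (Suc q) \<le> i"
    then show "t i = 0" using partition_zero[OF r] by (auto simp: t_def)
  qed
  moreover have "rib p q n t r"
    using pq n pos v is_partitionD[OF r, of p "Suc p"] 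
    by (auto simp: rib_def t_def bead_def) (metis One_nat_def Suc_pred diff_less less_le_trans not_le zero_less_one le_less not_less_eq_eq)
  ultimately show ?thesis using pq by (auto simp: t_def)
qed

text \<open>The coefficients of \<open>1 / (1 - t\<^sup>n)\<close> and of \<open>1 - t\<^sup>n\<close>.\<close>

definition geom :: "nat \<Rightarrow> int \<Rightarrow> int" where
  "geom n e = (if 0 \<le> e \<and> int n dvd e then 1 else 0)"

definition geom_inv :: "nat \<Rightarrow> int \<Rightarrow> int" where
  "geom_inv n e = (if e = 0 then 1 else if e = int n then -1 else 0)"

lemma causal_geom [simp]: "causal (geom n)"
  by (simp add: causal_def geom_def)

lemma causal_geom_inv [simp]: "causal (geom_inv n)"
  by (auto simp: causal_def geom_inv_def)

text \<open>Multiplying the series by \<open>1 - t^n\<close> leaves only the constant term, so its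
  coefficients at \<open>e\<close> and \<open>e - n\<close> differ only for
  \<open>e = 0\<close>.\<close>

lemma geom_shift:
  assumes "e \<noteq> 0" "0 < n" shows "geom n (e - int n) = geom n e"
proof (cases "int n dvd e \<and> 0 \<le> e")
  case True
  then have "int n \<le> e" using zdvd_imp_le[of "int n" e] assms by simp
  then show ?thesis using True by (simp add: geom_def)
next
  case False
  have "int n dvd e - int n \<longleftrightarrow> int n dvd e" by (simp add: dvd_diff_left_iff)
  then show ?thesis using False by (auto simp: geom_def)
qed

text \<open>Apart from the jumping bead both partitions have the same beads in the same order, so
  the cofactors belonging to that bead are equal up to sign.\<close>

lemma rib_bead_skip:
  assumes "rib p q n t t'"
  shows "bead t' (skip p i) = bead t (skip q i)"
  using ribD[OF assms] by (auto simp: bead_def)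

lemma minus_one_power_diff:
  assumes "p \<le> q" shows "(-1 :: 'a::comm_ring_1) ^ (p + j) = (-1) ^ (q - p) * (-1) ^ (q + j)"
proof -
  have "(q - p) + (q + j) = p + j + 2 * (q - p)" using assms by simp
  then have "(-1 :: 'a) ^ (q - p) * (-1) ^ (q + j) = (-1) ^ (p + j + 2 * (q - p))"
    by (simp only: flip: power_add)
  then show ?thesis by (simp add: power_add)
qed

text \<open>Away from the beads of \<open>l\<close> a row of the matrix does not change when its bead moves by \<open>n\<close>.\<close>

lemma rib_minor_geom:
  assumes r: "rib p q n t t'" and t: "is_partition t" "is_partition t'" "is_partition l" "l \<le> t'"
    and n: "0 < n" and p: "p = 0 \<or> t' p \<le> l (p - 1)" "l p < t' p"
  shows "minor (geom n) l t' = (-1) ^ (q - p) * minor (geom n) l t"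
proof -
  have q: "q < plength t'" 
    using rib_less[OF r t(1), of q] ribD(1)[OF r] partition_nonzero_iff[OF t(2), of q] by auto
  then obtain K where K: "plength t' = Suc K" by (cases "plength t'") auto
  have len: "plength t \<le> Suc K" "plength l \<le> Suc K"
    using plength_mono rib_le[OF r t(1)] t K by metis+
  have pq: "p \<le> q" "p < Suc K" "q < Suc K" using ribD(1)[OF r] q K by auto
  have row: "geom n (bead t' p - bead l j) = geom n (bead t q - bead l j)" for j
  proof -
    have "bead t' p \<noteq> bead l j"
    proof (cases "p \<le> j")
      case True
      then have "bead l j \<le> bead l p" using t by (simp add: bead_le_iff)
      then show ?thesis using p by (simp add: bead_def)
    next
      case False
      then have "bead l (p - 1) \<le> bead l j" "bead t' p < bead l (p - 1)" using t p by (auto simp: bead_le_iff) (simp add: bead_def)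
      then show ?thesis by simp
    qed
    moreover have e: "bead t q - bead l j = bead t' p - bead l j - int n" using ribD(4)[OF r] by simp
    ultimately show ?thesis unfolding e using geom_shift[of "bead t' p - bead l j" n] n by simp
  qed
  have "minor (geom n) l t' = toep (Suc K) (geom n) l t'" 
    using t len K by (intro minor_toep) auto
  also have "\<dots> = (\<Sum>j<Suc K. geom n (bead t' p - bead l j) * ((-1) ^ (p + j) *
      dt K (\<lambda>i' j'. geom n (bead t' (skip p i') - bead l (skip j j')))))"
    unfolding toep_def by (rule dt_laplace_row[OF pq(2)])
  also have "\<dots> = (\<Sum>j<Suc K. (-1) ^ (q - p) * (geom n (bead t q - bead l j) * ((-1) ^ (q + j) *
      dt K (\<lambda>i' j'. geom n (bead t (skip q i') - bead l (skip j j'))))))"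
    unfolding row rib_bead_skip[OF r] minus_one_power_diff[OF pq(1)] by (simp add: mult_ac)
  also have "\<dots> = (-1) ^ (q - p) * toep (Suc K) (geom n) l t"
    unfolding toep_def dt_laplace_row[OF pq(3)] sum_distrib_left ..
  also have "toep (Suc K) (geom n) l t = minor (geom n) l t"
    using t len K by (intro minor_toep[symmetric]) auto
  finally show ?thesis .
qed

text \<open>The column of the bead \<open>l q\<close> has a single nonzero entry, before and after the move.\<close>

lemma rib_minor_geom_inv:
  assumes r: "rib p q n t t'" and t: "is_partition t" "is_partition t'" "is_partition l" "l \<le> t'"
    and q: "t q = l q" and n: "0 < n"
  shows "minor (geom_inv n) l t' = (-1) ^ Suc (q - p) * minor (geom_inv n) l t"
proof -
  have tq: "t q < t' q" using rib_less[OF r t(1), of q] ribD(1)[OF r] by simp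
  then have "q < plength t'" using partition_nonzero_iff[OF t(2), of q] by auto
  then obtain K where K: "plength t' = Suc K" by (cases "plength t'") auto
  have len: "plength t \<le> Suc K" "plength l \<le> Suc K"
    using plength_mono rib_le[OF r t(1)] t K by metis+
  have pq: "p \<le> q" "p < Suc K" "q < Suc K" using ribD(1)[OF r] \<open>q < plength t'\<close> K by auto
  have aq: "bead l q = bead t q" using q by (simp add: bead_def)
  have tb: "bead t' p = bead t q + int n" by (rule ribD(4)[OF r])
  have 1: "bead t i \<noteq> bead t' p" for i
  proof (cases "i < p \<or> q < i")
    case True
    then have "bead t i = bead t' i" using ribD(2)[OF r, of i] by (simp add: bead_def)
    then show ?thesis using True pq bead_eq_iff[OF t(2), of i p] by auto
  next
    case False
    then have "bead t i \<le> bead t p" using t by (simp add: bead_le_iff)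
    then show ?thesis using ribD(5)[OF r] by (simp add: bead_def)
  qed
  have 2: "bead t' i \<noteq> bead t q" for i
  proof (cases "i \<le> q")
    case True
    then have "bead t' q \<le> bead t' i" using t by (simp add: bead_le_iff)
    then show ?thesis using tq by (simp add: bead_def)
  next
    case False
    then have "bead t' i = bead t i" using ribD(2)[OF r, of i] by (simp add: bead_def)
    then show ?thesis using False bead_eq_iff[OF t(1), of i q] by auto
  qed
  have "minor (geom_inv n) l t' = toep (Suc K) (geom_inv n) l t'" 
    using t len K by (intro minor_toep) auto
  also have "\<dots> = geom_inv n (bead t' p - bead l q) * ((-1) ^ (p + q) *
      dt K (\<lambda>i' j'. geom_inv n (bead t' (skip p i') - bead l (skip q j'))))"
    unfolding toep_def
    by (rule dt_single_col[OF pq(2,3)]) (use aq tb 2 bead_eq_iff[OF t(2), of _ p] in \<open>auto simp: geom_inv_def algebra_simps\<close>)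
  also have "geom_inv n (bead t' p - bead l q) = -1" using aq tb n by (simp add: geom_inv_def)
  also have "dt K (\<lambda>i' j'. geom_inv n (bead t' (skip p i') - bead l (skip q j'))) =
      dt K (\<lambda>i' j'. geom_inv n (bead t (skip q i') - bead l (skip q j')))"
    unfolding rib_bead_skip[OF r] ..
  also have "-1 * ((-1) ^ (p + q) * dt K (\<lambda>i' j'. geom_inv n (bead t (skip q i') - bead l (skip q j')))) =
      (-1) ^ Suc (q - p) * (geom_inv n (bead t q - bead l q) * ((-1) ^ (q + q) *
      dt K (\<lambda>i' j'. geom_inv n (bead t (skip q i') - bead l (skip q j')))))"
    unfolding minus_one_power_diff[OF pq(1)] using aq by (simp add: geom_inv_def)
  also have "geom_inv n (bead t q - bead l q) * ((-1) ^ (q + q) *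
      dt K (\<lambda>i' j'. geom_inv n (bead t (skip q i') - bead l (skip q j')))) = toep (Suc K) (geom_inv n) l t"
    unfolding toep_def
    by (rule dt_single_col[OF pq(3,3), symmetric]) (use aq tb 1 bead_eq_iff[OF t(1)] in \<open>auto simp: geom_inv_def algebra_simps\<close>)
  also have "toep (Suc K) (geom_inv n) l t = minor (geom_inv n) l t"
    using t len K by (intro minor_toep[symmetric]) auto
  finally show ?thesis .
qed


text \<open>Stated for any commutative monoid: it multiplies up the signs of the steps and, applied
  to powers of 2, adds up their sizes.\<close>

lemma chain_product:
  assumes c: "is_chain R ts l r"
    and le: "\<And>t t'. R t t' \<Longrightarrow> is_partition t \<Longrightarrow> t \<le> t'"
    and F: "\<And>t t'. R t t' \<Longrightarrow> is_partition t \<Longrightarrow> is_partition t' \<Longrightarrow> l \<le> t \<Longrightarrow> F t' = s t t' * F t"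
  shows "(F r :: 'a :: comm_monoid_mult) = (\<Prod>i<length ts - 1. s (ts ! i) (ts ! Suc i)) * F l"
proof -
  have ne: "ts \<noteq> []" using c by (simp add: is_chain_def)
  have mono: "ts ! i \<le> ts ! Suc i" if "Suc i < length ts" for i
    using le is_chain_step[OF c that] by blast
  have "F (ts ! m) = (\<Prod>i<m. s (ts ! i) (ts ! Suc i)) * F l" if "m < length ts" for m
    using that
  proof (induction m)
    case 0
    then show ?case using c ne by (simp add: is_chain_def hd_conv_nth)
  next
    case (Suc m)
    have "l \<le> ts ! m" using list_steps_bounds(1)[of ts m, OF mono] c Suc.prems by (auto simp: is_chain_def)
    then have "F (ts ! Suc m) = s (ts ! m) (ts ! Suc m) * F (ts ! m)"
      using F is_chain_step[OF c Suc.prems] by blast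
    then show ?case using Suc by (simp add: mult_ac)
  qed
  from this[of "length ts - 1"] show ?thesis using c ne by (simp add: is_chain_def last_conv_nth)
qed

lemma hstep_le: "hstep n l t t' \<Longrightarrow> is_partition t \<Longrightarrow> t \<le> t'"
  by (auto simp: hstep_def rib_le)

lemma vstep_le: "vstep n l t t' \<Longrightarrow> is_partition t \<Longrightarrow> t \<le> t'"
  by (auto simp: vstep_def rib_le)

lemma chain_le:
  assumes "is_chain R ts l r" "\<And>t t'. R t t' \<Longrightarrow> is_partition t \<Longrightarrow> t \<le> t'"
  shows "l \<le> r"
proof -
  have "hd ts \<le> ts ! (length ts - 1)"
    by (rule list_steps_bounds(1)) (use assms is_chain_step[OF assms(1)] in \<open>auto simp: is_chain_def\<close>)
  then show ?thesis using assms(1) by (auto simp: is_chain_def last_conv_nth)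
qed

lemma hstep_minor:
  assumes "hstep n l t t'" "is_partition t" "is_partition t'" "is_partition l" "l \<le> t" "0 < n"
  shows "minor (geom n) l t' = (-1) ^ height (skew t' t) * minor (geom n) l t"
proof -
  obtain p q where r: "rib p q n t t'" and p: "p = 0 \<or> t' p \<le> l (p - 1)"
    using assms(1) by (auto simp: hstep_def)
  have "l p < t' p" using le_funD[OF assms(5), of p] ribD(5)[OF r] by simp
  moreover have "l \<le> t'" using assms(5) rib_le[OF r assms(2)] by simp
  ultimately show ?thesis
    using rib_minor_geom[OF r assms(2,3,4) _ assms(6) p] rib_num_rows(2)[OF r assms(2)] by simp
qed

lemma vstep_minor:
  assumes "vstep n l t t'" "is_partition t" "is_partition t'" "is_partition l" "l \<le> t" "0 < n"
  shows "minor (geom_inv n) l t' = (-1) ^ num_rows (skew t' t) * minor (geom_inv n) l t"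
proof -
  obtain p q where r: "rib p q n t t'" and "t q \<le> l q"
    using assms(1) by (auto simp: vstep_def)
  then have q: "t q = l q" using le_funD[OF assms(5), of q] by simp
  have "l \<le> t'" using assms(5) rib_le[OF r assms(2)] by simp
  then show ?thesis
    using rib_minor_geom_inv[OF r assms(2,3,4) _ q assms(6)] rib_num_rows(1)[OF r assms(2)] by simp
qed

text \<open>Let \<open>p\<close> be the first row where \<open>l\<close> and \<open>r\<close>
  differ. Then \<open>y = bead r p\<close> is no bead of \<open>l\<close>, so its row equals the row
  of position \<open>y - n\<close>. If that position were occupied, two rows would coincide; if it
  were too low, the row would vanish. Hence the bead can move down by \<open>n\<close>.\<close>

lemma hstep_exists:
  assumes l: "is_partition l" and r: "is_partition r" and lr: "l \<noteq> r" and n: "0 < n"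
    and nz: "minor (geom n) l r \<noteq> 0"
  shows "\<exists>t. is_partition t \<and> t \<noteq> r \<and> hstep n l t r \<and> minor (geom n) l t \<noteq> 0"
proof -
  define L where "L = plength r"
  have le: "l \<le> r" using minor_zero[of "geom n", OF causal_geom l r] nz by auto
  have nzt: "toep L (geom n) l r \<noteq> 0"
    using minor_toep[of "geom n" l r L] plength_mono[OF l r le] nz l r by (simp add: L_def)
  have ex: "\<exists>i. l i \<noteq> r i" using lr by auto
  define p where "p = (LEAST i. l i \<noteq> r i)"
  have "l p \<noteq> r p" using LeastI_ex[OF ex] by (simp add: p_def)
  then have lp: "l p < r p" using le_funD[OF le, of p] by simp
  have below: "l i = r i" if "i < p" for i using not_less_Least that by (auto simp: p_def)
  have pL: "p < L" using lp partition_nonzero_iff[OF r, of p] by (simp add: L_def)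
  define y where "y = bead r p"
  have row: "geom n (y - bead l j) = geom n (y - int n - bead l j)" for j
  proof -
    have "y \<noteq> bead l j"
    proof (cases "p \<le> j")
      case True
      then have "bead l j \<le> bead l p" using l by (simp add: bead_le_iff)
      then show ?thesis using lp by (simp add: y_def bead_def)
    next
      case False
      then have "bead l j = bead r j" using below[of j] by (simp add: bead_def)
      then show ?thesis using False bead_eq_iff[OF r, of p j] by (auto simp: y_def)
    qed
    then show ?thesis using geom_shift[of "y - bead l j" n] n by (simp add: algebra_simps)
  qed
  \<comment> \<open>The first \<open>L\<close> beads of \<open>l\<close> are at least
    \<open>1 - L\<close>, so at a position \<open>-L\<close> or lower the whole row is zero.\<close>
  have low: "- int L < y - int n"
  proof (rule ccontr)
    assume a: "\<not> ?thesis"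
    have "toep L (geom n) l r = 0"
      unfolding toep_def
    proof (rule dt_zero_block[where R = "{p}" and C = "{..<L}"])
      fix i j assume "i \<in> {p}" "j \<in> {..<L}"
      then have "geom n (bead r i - bead l j) = geom n (y - int n - bead l j)" using row[of j] by (simp add: y_def)
      moreover have "y - int n - bead l j < 0" using a \<open>j \<in> {..<L}\<close> by (simp add: bead_def)
      ultimately show "geom n (bead r i - bead l j) = 0" by (simp add: geom_def)
    qed (use pL in auto)
    then show False using nzt by simp
  qed
  have free: "bead r i \<noteq> y - int n" if "i < L" for i
  proof
    assume i: "bead r i = y - int n"
    have "toep L (geom n) l r = 0"
      unfolding toep_def
    proof (rule dt_equal_rows[of p L i])
      fix j show "geom n (bead r p - bead l j) = geom n (bead r i - bead l j)"
        using row[of j] i by (simp add: y_def)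
    qed (use i n pL that in \<open>auto simp: y_def\<close>)
    then show False using nzt by simp
  qed
  define S where "S = {i. i < L \<and> y - int n < bead r i}"
  have S: "finite S" "p \<in> S" using pL n by (auto simp: S_def y_def)
  \<comment> \<open>The last row whose bead lies above \<open>y - n\<close>: after the move the bead
    has this index, and \<open>v\<close> is the row length that puts it at
    \<open>y - n\<close>.\<close>
  define q where "q = Max S"
  have q: "q \<in> S" "p \<le> q" using Max_in S by (auto simp: q_def)
  then have qL: "q < L" "y - int n < bead r q" by (auto simp: S_def)
  define v where "v = nat (y - int n + int q)"
  have vlow: "int (r (Suc q)) \<le> y - int n + int q"
  proof (cases "Suc q < L")
    case True
    have "Suc q \<notin> S" using Max_ge[OF S(1), of "Suc q"] by (auto simp: q_def)
    then have "bead r (Suc q) < y - int n" using free[OF True] True by (simp add: S_def)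
    then show ?thesis by (simp add: bead_def)
  next
    case False
    then have "r (Suc q) = 0" using partition_zero[OF r] by (simp add: L_def)
    then show ?thesis using False low by simp
  qed
  then have v: "int v = y - int n + int q" by (simp add: v_def)
  have "\<exists>t. is_partition t \<and> rib p q n t r \<and> t q = v"
    by (rule unrib[OF r q(2)]) (use v vlow qL in \<open>auto simp: bead_def y_def\<close>)
  then obtain t where t: "is_partition t" "rib p q n t r" by blast
  have pc: "p = 0 \<or> r p \<le> l (p - 1)"
    using below[of "p - 1"] is_partitionD[OF r, of "p - 1" p] by (cases p) auto
  have "minor (geom n) l r = (-1) ^ (q - p) * minor (geom n) l t"
    by (rule rib_minor_geom[OF t(2,1) r l le n pc lp])
  then have "minor (geom n) l t \<noteq> 0" using nz by auto
  moreover have "t \<noteq> r" using ribD(5)[OF t(2)] by auto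
  ultimately show ?thesis using t pc by (auto simp: hstep_def)
qed

text \<open>The dual choice: \<open>q\<close> is the last row where \<open>l\<close> and
  \<open>r\<close> differ, and \<open>bead l q\<close> is no bead of \<open>r\<close>. Its column
  can be nonzero only at a bead of \<open>r\<close> that is \<open>n\<close> higher, and this bead
  can move down to the vacant position.\<close>

lemma vstep_exists:
  assumes l: "is_partition l" and r: "is_partition r" and lr: "l \<noteq> r" and n: "0 < n"
    and nz: "minor (geom_inv n) l r \<noteq> 0"
  shows "\<exists>t. is_partition t \<and> t \<noteq> r \<and> vstep n l t r \<and> minor (geom_inv n) l t \<noteq> 0"
proof -
  define L where "L = plength r"
  have le: "l \<le> r" using minor_zero[of "geom_inv n", OF causal_geom_inv l r] nz by auto
  have nzt: "toep L (geom_inv n) l r \<noteq> 0"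
    using minor_toep[of "geom_inv n" l r L] plength_mono[OF l r le] nz l r by (simp add: L_def)
  define S where "S = {i. l i \<noteq> r i}"
  have SL: "S \<subseteq> {..<L}"
  proof
    fix i assume "i \<in> S"
    then have "r i \<noteq> 0" using le_funD[OF le, of i] by (auto simp: S_def)
    then show "i \<in> {..<L}" using partition_nonzero_iff[OF r] by (simp add: L_def)
  qed
  then have S: "finite S" "S \<noteq> {}" using lr by (auto simp: S_def intro: finite_subset)
  define q where "q = Max S"
  have "q \<in> S" using Max_in[OF S] by (simp add: q_def)
  then have q: "q < L" "l q < r q" using SL le_funD[OF le, of q] by (auto simp: S_def)
  have above: "l i = r i" if "q < i" for i
    using Max_ge[OF S(1), of i] that by (auto simp: q_def S_def)
  have "\<exists>p<L. geom_inv n (bead r p - bead l q) \<noteq> 0"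
  proof (rule ccontr)
    assume "\<not> ?thesis"
    then have "toep L (geom_inv n) l r = 0"
      unfolding toep_def by (intro dt_zero_block[where R = "{..<L}" and C = "{q}"]) (use q in auto)
    then show False using nzt by simp
  qed
  then obtain p where p: "p < L" "geom_inv n (bead r p - bead l q) \<noteq> 0" by blast
  have up: "bead l q < bead r i" if "i \<le> q" for i
  proof -
    have "bead r q \<le> bead r i" using that r by (simp add: bead_le_iff)
    then show ?thesis using q by (simp add: bead_def)
  qed
  have dn: "bead r i < bead l q" if "q < i" for i
    using bead_less[OF l that] above[OF that] by (simp add: bead_def)
  have pq: "p \<le> q" and yp: "bead r p = bead l q + int n"
    using p(2) up[of p] dn[of p] by (auto simp: geom_inv_def split: if_splits) (meson not_le)+
  have "\<exists>t. is_partition t \<and> rib p q n t r \<and> t q = l q"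
  proof (rule unrib[OF r pq])
    show "r (Suc q) \<le> l q" using above[of "Suc q"] is_partitionD[OF l, of q "Suc q"] by simp
  qed (use q yp in \<open>auto simp: bead_def\<close>)
  then obtain t where t: "is_partition t" "rib p q n t r" "t q = l q" by blast
  have "minor (geom_inv n) l r = (-1) ^ Suc (q - p) * minor (geom_inv n) l t"
    by (rule rib_minor_geom_inv[OF t(2,1) r l le t(3) n])
  then have "minor (geom_inv n) l t \<noteq> 0" using nz by auto
  moreover have "t \<noteq> r" using ribD(5)[OF t(2)] by auto
  moreover have "vstep n l t r" unfolding vstep_def using t(2,3) by (intro exI conjI) auto
  ultimately show ?thesis using t(1) by blast
qed

lemma is_chain_single: "is_partition l \<Longrightarrow> is_chain R [l] l l"
  by (simp add: is_chain_def)

lemma is_chain_snoc: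
  assumes c: "is_chain R ts l t" and "R t r" "is_partition r"
  shows "is_chain R (ts @ [r]) l r"
  unfolding is_chain_def
proof (intro conjI allI impI)
  have ne: "ts \<noteq> []" using c by (simp add: is_chain_def)
  then show "hd (ts @ [r]) = l" using c by (simp add: is_chain_def)
  show "\<forall>t\<in>set (ts @ [r]). is_partition t" using c assms(3) by (auto simp: is_chain_def)
  fix i assume "Suc i < length (ts @ [r])"
  then consider "Suc i < length ts" | "Suc i = length ts" by fastforce
  then show "R ((ts @ [r]) ! i) ((ts @ [r]) ! Suc i)"
  proof cases
    case 1
    then show ?thesis using is_chain_step(1)[OF c 1] by (simp add: nth_append)
  next
    case 2
    then have "ts ! i = t" using c ne by (metis diff_Suc_1 is_chain_def last_conv_nth)
    then show ?thesis using 2 assms(2) by (simp add: nth_append)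
  qed
qed auto

text \<open>Steps are peeled off at the outer end, and \<open>P\<close> survives each of them; it
  will be the nonvanishing of the minor with \<open>l\<close>.\<close>

lemma chain_exists:
  assumes "is_partition r" "P r" "is_partition l"
    and step: "\<And>r. is_partition r \<Longrightarrow> P r \<Longrightarrow> r \<noteq> l \<Longrightarrow> 
      \<exists>t. is_partition t \<and> t \<noteq> r \<and> R t r \<and> P t"
    and le: "\<And>t t'. R t t' \<Longrightarrow> is_partition t \<Longrightarrow> t \<le> t'"
  shows "\<exists>ts. is_chain R ts l r"
  using assms(1,2)
proof (induction "psize r" arbitrary: r rule: less_induct)
  case less
  show ?case
  proof (cases "r = l")
    case True
    then show ?thesis using is_chain_single[OF assms(3)] by blast
  next
    case False
    then obtain t where t: "is_partition t" "t \<noteq> r" "R t r" "P t" using step[OF less.prems] by blast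
    have "psize t < psize r"
      using psize_mono[OF less.prems(1) t(1) le] psize_eq_imp_eq[OF less.prems(1) t(1) le] t by force
    then obtain ts where "is_chain R ts l t" using less.hyps t by blast
    then show ?thesis using is_chain_snoc t less.prems by blast
  qed
qed

text \<open>Along a chain every step contributes its sign, starting from
  \<open>minor (geom n) l l = 1\<close>; if there is no chain, the minor must vanish. As the minor
  does not refer to a chain, the sign is independent of the chain chosen.\<close>

lemma minor_geom:
  assumes l: "is_partition l" and r: "is_partition r" and n: "0 < n"
  shows "minor (geom n) l r = (if \<exists>w. horizontal_ribbon n r l w then sgn_ribbon n r l else 0)"
proof (cases "\<exists>ts. ribbon_chain n r l ts")
  case True
  define ts where "ts = (SOME ts. ribbon_chain n r l ts)"
  have rc: "ribbon_chain n r l ts" using someI_ex[OF True] by (simp add: ts_def)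
  then have c: "is_chain (hstep n l) ts l r" by (simp add: ribbon_chain_iff_hstep)
  have "minor (geom n) l r = (\<Prod>i<length ts - 1. (-1) ^ height (skew (ts ! Suc i) (ts ! i))) * minor (geom n) l l"
    by (rule chain_product[OF c hstep_le hstep_minor]) (use l n in auto)
  moreover have "\<exists>w. horizontal_ribbon n r l w"
    unfolding horizontal_ribbon_def using rc by (metis Suc_pred length_greater_0_conv ribbon_chain_def)
  ultimately show ?thesis using minor_self[of "geom n" l] l by (simp add: sgn_ribbon_def ts_def Let_def)
next
  case False
  then have nh: "\<not> (\<exists>w. horizontal_ribbon n r l w)" by (auto simp: horizontal_ribbon_def)
  have "minor (geom n) l r = 0"
  proof (rule ccontr)
    assume nz: "minor (geom n) l r \<noteq> 0"
    have "\<exists>ts. is_chain (hstep n l) ts l r"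
    proof (rule chain_exists[where P = "\<lambda>r. minor (geom n) l r \<noteq> 0", OF r nz l _ hstep_le])
      fix r assume "is_partition r" "minor (geom n) l r \<noteq> 0" "r \<noteq> l"
      then show "\<exists>t. is_partition t \<and> t \<noteq> r \<and> hstep n l t r \<and> minor (geom n) l t \<noteq> 0"
        using hstep_exists[OF l _ _ n] by metis
    qed
    then show False using False by (simp add: ribbon_chain_iff_hstep)
  qed
  then show ?thesis using nh by simp
qed

lemma sgn_vertical_alt:
  assumes "is_partition l" "is_partition r" "ts = (SOME ts. ribbon_chain n (conj_part r) (conj_part l) ts)"
    "ribbon_chain n (conj_part r) (conj_part l) ts"
  shows "sgn_vertical n r l = (\<Prod>i<length ts - 1. (-1) ^ num_rows (skew (conj_part (ts ! Suc i)) (conj_part (ts ! i))))"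
  unfolding sgn_vertical_def Let_def assms(3)[symmetric]
  using assms(4) by (intro prod.cong refl) (simp add: skew_conj ribbon_chain_def)

lemma minor_geom_inv:
  assumes l: "is_partition l" and r: "is_partition r" and n: "0 < n"
  shows "minor (geom_inv n) l r = (if vertical_ribbon n r l then sgn_vertical n r l else 0)"
proof (cases "\<exists>ts. ribbon_chain n (conj_part r) (conj_part l) ts")
  case True
  define ts where "ts = (SOME ts. ribbon_chain n (conj_part r) (conj_part l) ts)"
  have rc: "ribbon_chain n (conj_part r) (conj_part l) ts" using someI_ex[OF True] by (simp add: ts_def)
  then have c: "is_chain (vstep n l) (map conj_part ts) l r" using ribbon_chain_iff_vstep[OF l r] by blast
  have "minor (geom_inv n) l r = (\<Prod>i<length (map conj_part ts) - 1. 
      (-1) ^ num_rows (skew (map conj_part ts ! Suc i) (map conj_part ts ! i))) * minor (geom_inv n) l l"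
    by (rule chain_product[OF c vstep_le vstep_minor]) (use l n in auto)
  moreover have "vertical_ribbon n r l"
    unfolding vertical_ribbon_def horizontal_ribbon_def using rc 
    by (metis Suc_pred length_greater_0_conv ribbon_chain_def)
  ultimately show ?thesis using minor_self[of "geom_inv n" l] l sgn_vertical_alt[OF l r ts_def rc] by simp
next
  case False
  then have nh: "\<not> vertical_ribbon n r l" by (auto simp: horizontal_ribbon_def vertical_ribbon_def)
  have "minor (geom_inv n) l r = 0"
  proof (rule ccontr)
    assume nz: "minor (geom_inv n) l r \<noteq> 0"
    have "\<exists>ts. is_chain (vstep n l) ts l r"
    proof (rule chain_exists[where P = "\<lambda>r. minor (geom_inv n) l r \<noteq> 0", OF r nz l _ vstep_le])
      fix r assume "is_partition r" "minor (geom_inv n) l r \<noteq> 0" "r \<noteq> l"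
      then show "\<exists>t. is_partition t \<and> t \<noteq> r \<and> vstep n l t r \<and> minor (geom_inv n) l t \<noteq> 0"
        using vstep_exists[OF l _ _ n] by metis
    qed
    then obtain ts where c: "is_chain (vstep n l) ts l r" by blast
    then have "map conj_part (map conj_part ts) = ts" "\<forall>t\<in>set (map conj_part ts). is_partition t"
      by (auto simp: is_chain_def intro!: map_idI)
    then have "ribbon_chain n (conj_part r) (conj_part l) (map conj_part ts)"
      using ribbon_chain_iff_vstep[OF l r] c by simp
    then show False using False by blast
  qed
  then show ?thesis using nh by simp
qed

lemma ribbon_chain_card:
  assumes "ribbon_chain n r l ts"
  shows "l \<le> r" "psize r = psize l + n * (length ts - 1)"
proof -
  have c: "is_chain (hstep n l) ts l r" using assms by (simp add: ribbon_chain_iff_hstep)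
  show "l \<le> r" by (rule chain_le[OF c hstep_le])
  \<comment> \<open>\<open>chain_product\<close> is multiplicative; powers of 2 let it sum the
    ribbon sizes.\<close>
  have "2 ^ psize r = (\<Prod>i<length ts - 1. 2 ^ n) * (2 ^ psize l :: nat)"
  proof (rule chain_product[OF c hstep_le])
    fix t t' assume "hstep n l t t'" "is_partition t" "is_partition t'"
    then have "psize t' = n + psize t"
      using card_skew[of t' t] rib_card rib_le by (fastforce simp: hstep_def)
    then show "2 ^ psize t' = 2 ^ n * (2 ^ psize t :: nat)" by (simp add: power_add)
  qed
  then have "2 ^ psize r = (2 ^ (psize l + n * (length ts - 1)) :: nat)"
    by (simp add: power_add power_mult)
  then show "psize r = psize l + n * (length ts - 1)" by simp
qed

lemma horizontal_ribbon_size: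
  assumes "horizontal_ribbon n r l w" shows "l \<le> r" "psize r = psize l + n * w"
  using assms ribbon_chain_card[of n r l] unfolding horizontal_ribbon_def by force+

text \<open>One chain of the conjugates serves both sides. Each ribbon contributes
  \<open>(-1)^n\<close> to the comparison, since its rows before and after transposition add up to
  \<open>n + 1\<close>, and \<open>n\<close> times the number of ribbons is
  \<open>card (skew r l)\<close>.\<close>

lemma minor_geom_inv_conj:
  assumes l: "is_partition l" and r: "is_partition r" and n: "0 < n"
  shows "minor (geom_inv n) l r = (-1) ^ card (skew r l) * minor (geom n) (conj_part l) (conj_part r)"
proof (cases "vertical_ribbon n r l")
  case True
  then have ex: "\<exists>ts. ribbon_chain n (conj_part r) (conj_part l) ts"
    by (auto simp: vertical_ribbon_def horizontal_ribbon_def)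
  define ts where "ts = (SOME ts. ribbon_chain n (conj_part r) (conj_part l) ts)"
  have rc: "ribbon_chain n (conj_part r) (conj_part l) ts" using someI_ex[OF ex] by (simp add: ts_def)
  have "psize (conj_part r) = psize (conj_part l) + n * (length ts - 1)" "conj_part l \<le> conj_part r"
    using ribbon_chain_card[OF rc] by auto
  then have cs: "card (skew r l) = n * (length ts - 1)"
    using card_skew[of "conj_part r" "conj_part l"] card_skew_conj[OF l r] l r by simp
  have "sgn_vertical n r l = (\<Prod>i<length ts - 1. (-1) ^ num_rows (prod.swap ` skew (ts ! Suc i) (ts ! i)))"
    by (simp add: sgn_vertical_def ts_def Let_def)
  also have "\<dots> = (\<Prod>i<length ts - 1. (-1) ^ n * (-1) ^ height (skew (ts ! Suc i) (ts ! i)))"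
  proof (intro prod.cong refl)
    fix i assume "i \<in> {..<length ts - 1}"
    then have i: "Suc i < length ts" by auto
    let ?B = "skew (ts ! Suc i) (ts ! i)"
    have B: "ts ! i \<le> ts ! Suc i" "ribbon ?B" "card ?B = n" "is_partition (ts ! i)" "is_partition (ts ! Suc i)"
      using rc i by (auto simp: ribbon_chain_def)
    have "num_rows ?B + num_rows (prod.swap ` ?B) = Suc n"
      using ribbon_num_rows_swap[OF B(4,5,1,2)] B(3) by simp
    moreover have "0 < num_rows ?B"
      using ribbon_imp_rib[OF B(4,5,1,2)] rib_num_rows(1) B(4) by auto
    ultimately have "n = num_rows (prod.swap ` ?B) + height ?B" by (simp add: height_def)
    then have "(-1 :: int) ^ n * (-1) ^ height ?B = (-1) ^ (num_rows (prod.swap ` ?B) + 2 * height ?B)"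
      by (simp flip: power_add add: mult_2 add.assoc)
    then show "(-1) ^ num_rows (prod.swap ` ?B) = (-1 :: int) ^ n * (-1) ^ height ?B"
      by (simp add: power_add)
  qed
  also have "\<dots> = (-1) ^ card (skew r l) * sgn_ribbon n (conj_part r) (conj_part l)"
    by (simp add: cs prod.distrib power_mult sgn_ribbon_def ts_def Let_def)
  finally show ?thesis
    using True minor_geom_inv[OF l r n] minor_geom[of "conj_part l" "conj_part r" n] l r n
    by (simp add: vertical_ribbon_def)
next
  case False
  then show ?thesis
    using minor_geom_inv[OF l r n] minor_geom[of "conj_part l" "conj_part r" n] l r n
    by (simp add: vertical_ribbon_def)
qed


section \<open>The Cauchy--Binet formula\<close>

text \<open>The index of a bead is the number of beads above it, so the set determines the
  sequence.\<close>

lemma bead_set_eq_imp_eq: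
  assumes l: "is_partition l" "plength l \<le> L" and r: "is_partition r" "plength r \<le> L"
    and eq: "bead l ` {..<L} = bead r ` {..<L}"
  shows "l = r"
proof
  have above: "card {x \<in> bead t ` {..<L}. bead t i < x} = i" if "is_partition t" "i < L" for t i
  proof -
    have "{x \<in> bead t ` {..<L}. bead t i < x} = bead t ` {..<i}"
      using that by (auto simp: bead_less_iff)
    moreover have "inj_on (bead t) {..<i}" using that(1) by (auto simp: inj_on_def bead_eq_iff)
    ultimately show ?thesis by (simp add: card_image)
  qed
  fix i
  show "l i = r i"
  proof (cases "i < L")
    case True
    then have "bead l i \<in> bead r ` {..<L}" using eq by blast
    then obtain j where j: "j < L" "bead l i = bead r j" by auto
    then have "i = j" using above[OF l(1) True] above[OF r(1) j(1)] eq by simp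
    then show ?thesis using j by (simp add: bead_def)
  next
    case False
    then show ?thesis using l r partition_zero[of l i] partition_zero[of r i] by simp
  qed
qed

text \<open>Distinct integers in decreasing order drop by at least one per index, so adding the
  index gives a weakly decreasing sequence. The bound \<open>1 - L\<close> keeps the last row length
  nonnegative.\<close>

lemma bead_set_exists:
  assumes S: "finite S" "card S = L" "S \<subseteq> {1 - int L..}"
  shows "\<exists>l. is_partition l \<and> plength l \<le> L \<and> bead l ` {..<L} = S"
proof -
  define xs where "xs = sorted_list_of_set S"
  have xs: "sorted_wrt (<) xs" "length xs = L" "set xs = S"
    using S by (auto simp: xs_def)
  define s where "s i = xs ! (L - 1 - i)" for i
  have dec: "s j < s i" if "i < j" "j < L" for i j
    using sorted_wrt_nth_less[OF xs(1), of "L - 1 - j" "L - 1 - i"] that xs(2) by (simp add: s_def)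
  have dec': "s j + int j \<le> s i + int i" if "i \<le> j" "j < L" for i j
    using that
  proof (induction j rule: dec_induct)
    case (step j)
    then show ?case using dec[of j "Suc j"] by simp
  qed simp
  have sS: "s ` {..<L} = S"
  proof -
    have "S = (!) xs ` {..<L}" using xs by (auto simp: set_conv_nth)
    also have "{..<L} = (\<lambda>i. L - 1 - i) ` {..<L}"
    proof (intro equalityI subsetI)
      fix i assume "i \<in> {..<L}"
      then show "i \<in> (\<lambda>i. L - 1 - i) ` {..<L}" by (intro image_eqI[of _ _ "L - 1 - i"]) auto
    qed auto
    finally show ?thesis by (simp add: image_image s_def)
  qed
  have pos: "0 \<le> s i + int i" if "i < L" for i
  proof -
    have "s (L - 1) \<in> S" using sS that by auto
    then have "1 - int L \<le> s (L - 1)" using S(3) by auto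
    then show ?thesis using dec'[of i "L - 1"] that by linarith
  qed
  define l where "l i = (if i < L then nat (s i + int i) else 0)" for i
  have "is_partition l"
  proof (rule is_partitionI[of _ L])
    fix i show "l (Suc i) \<le> l i" using dec'[of i "Suc i"] by (auto simp: l_def)
  qed (simp add: l_def)
  moreover from this have "plength l \<le> L" by (simp add: plength_le_iff l_def)
  moreover have "bead l i = s i" if "i < L" for i using pos[OF that] that by (simp add: bead_def l_def)
  then have "bead l ` {..<L} = S" using sS by (auto simp: image_iff)
  ultimately show ?thesis by blast
qed

definition conv :: "(int \<Rightarrow> 'a::comm_ring_1) \<Rightarrow> (int \<Rightarrow> 'a) \<Rightarrow> int \<Rightarrow> 'a" where
  "conv f g e = (\<Sum>c\<in>{0..e}. f c * g (e - c))"

lemma causal_conv: "causal f \<Longrightarrow> causal g \<Longrightarrow> causal (conv f g)"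
  by (auto simp: causal_def conv_def)

text \<open>The range of summation may be enlarged beyond the nonzero terms, so that one range
  serves all entries of a matrix.\<close>

lemma conv_window:
  assumes "causal f" "causal g" "lo \<le> a" "b \<le> hi"
  shows "conv f g (b - a) = (\<Sum>c\<in>{lo..hi}. g (b - c) * f (c - a))"
proof -
  have "(\<Sum>c\<in>{lo..hi}. g (b - c) * f (c - a)) = (\<Sum>c\<in>{a..b}. g (b - c) * f (c - a))"
    by (rule sum.mono_neutral_right) (use assms in \<open>auto simp: causal_def\<close>)
  also have "\<dots> = (\<Sum>c\<in>{0..b - a}. g (b - a - c) * f c)"
    by (rule sum.reindex_bij_witness[of _ "\<lambda>c. c + a" "\<lambda>c. c - a"]) (auto simp: algebra_simps)
  finally show ?thesis by (simp add: conv_def mult.commute)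
qed

text \<open>The Cauchy--Binet formula: the injective choices in the multilinear expansion are
  the arrangements of the bead sets of the intermediate partitions.\<close>

lemma toep_mult:
  assumes f: "causal f" and g: "causal g" and l: "is_partition l" and r: "is_partition r"
    and N: "N = {v. is_partition v \<and> plength v \<le> L \<and> bead v ` {..<L} \<subseteq> {1 - int L..int (r 0)}}"
  shows "toep L (conv f g) l r = (\<Sum>v\<in>N. toep L f l v * toep L g v r)"
proof -
  let ?C = "{1 - int L..int (r 0)}"
  let ?F = "\<lambda>c. (\<Prod>i<L. g (bead r i - c i)) * dt L (\<lambda>i j. f (c i - bead l j))"
  let ?P = "{p. p permutes {..<L}}"
  let ?I = "{c \<in> Pi\<^sub>E {..<L} (\<lambda>_. ?C). inj_on c {..<L}}"
  let ?phi = "\<lambda>(v, p). restrict (\<lambda>i. bead v (p i)) {..<L}"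
  have "toep L (conv f g) l r = dt L (\<lambda>i j. \<Sum>c\<in>?C. g (bead r i - c) * f (c - bead l j))"
    unfolding toep_def
  proof (rule dt_cong)
    fix i j assume "i < L" "j < L"
    then have "1 - int L \<le> bead l j" "bead r i \<le> int (r 0)" using is_partitionD[OF r, of 0 i] by (auto simp: bead_def)
    then show "conv f g (bead r i - bead l j) = (\<Sum>c\<in>?C. g (bead r i - c) * f (c - bead l j))"
      by (rule conv_window[OF f g])
  qed
  also have "\<dots> = (\<Sum>c\<in>Pi\<^sub>E {..<L} (\<lambda>_. ?C). ?F c)"
    by (rule dt_multilinear) simp
  also have "\<dots> = (\<Sum>c\<in>?I. ?F c)"
  proof (rule sum.mono_neutral_right)
    show "finite (Pi\<^sub>E {..<L} (\<lambda>_. ?C))" by (intro finite_PiE) auto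
    show "\<forall>c\<in>Pi\<^sub>E {..<L} (\<lambda>_. ?C) - ?I. ?F c = 0"
    proof
      fix c assume "c \<in> Pi\<^sub>E {..<L} (\<lambda>_. ?C) - ?I"
      then obtain i j where ij: "i < L" "j < L" "i \<noteq> j" "c i = c j" by (auto simp: inj_on_def)
      then have "dt L (\<lambda>i j. f (c i - bead l j)) = 0" by (intro dt_equal_rows[of i L j]) auto
      then show "?F c = 0" by simp
    qed
  qed auto
  also have "\<dots> = (\<Sum>vp\<in>N \<times> ?P. ?F (?phi vp))"
  proof (rule sum.reindex_bij_betw[symmetric])
    show "bij_betw ?phi (N \<times> ?P) ?I"
    proof (rule bij_betw_imageI)
      show "inj_on ?phi (N \<times> ?P)"
      proof (rule inj_onI, clarify)
        fix v p v' p'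
        assume v: "v \<in> N" "v' \<in> N" and p: "p permutes {..<L}" "p' permutes {..<L}"
          and eq: "restrict (\<lambda>i. bead v (p i)) {..<L} = restrict (\<lambda>i. bead v' (p' i)) {..<L}"
        have e: "bead v (p i) = bead v' (p' i)" if "i < L" for i
          using fun_cong[OF eq, of i] that by simp
        have "bead v ` {..<L} = bead v ` p ` {..<L}" "bead v' ` {..<L} = bead v' ` p' ` {..<L}"
          using p by (simp_all add: permutes_image)
        then have "bead v ` {..<L} = bead v' ` {..<L}" using e by (auto simp: image_image)
        then have vv: "v = v'" using bead_set_eq_imp_eq[of v L v'] v by (simp add: N)
        have "p i = p' i" for i
        proof (cases "i < L")
          case True
          then show ?thesis using e[OF True] v vv by (simp add: N bead_eq_iff)
        next
          case False
          then show ?thesis using p by (simp add: permutes_def)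
        qed
        then show "v = v' \<and> p = p'" using vv by auto
      qed
      show "?phi ` (N \<times> ?P) = ?I"
      proof
        show "?phi ` (N \<times> ?P) \<subseteq> ?I"
        proof (rule subsetI)
          fix c assume "c \<in> ?phi ` (N \<times> ?P)"
          then obtain v p where v: "v \<in> N" and p: "p permutes {..<L}"
            and c: "c = restrict (\<lambda>i. bead v (p i)) {..<L}" by auto
          have pL: "p i < L" if "i < L" for i using permutes_in_image[OF p, of i] that by simp
          have "bead v (p i) \<in> ?C" if "i < L" for i
            using v pL[OF that] by (auto simp: N)
          then have "c \<in> Pi\<^sub>E {..<L} (\<lambda>_. ?C)" unfolding c by auto
          moreover have "inj_on c {..<L}"
            using v permutes_inj[OF p] unfolding c by (auto simp: N inj_on_def bead_eq_iff)
          ultimately show "c \<in> ?I" by blast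
        qed
        show "?I \<subseteq> ?phi ` (N \<times> ?P)"
        proof
          fix c assume c: "c \<in> ?I"
          let ?S = "c ` {..<L}"
          have S: "finite ?S" "card ?S = L" "?S \<subseteq> ?C" using c by (auto simp: card_image)
          then obtain v where v: "is_partition v" "plength v \<le> L" "bead v ` {..<L} = ?S"
            using bead_set_exists[of ?S L] by (metis Icc_subset_Ici_iff order.trans order_refl)
          have b: "bij_betw (bead v) {..<L} ?S"
            using v by (auto simp: bij_betw_def inj_on_def bead_eq_iff)
          have bc: "bij_betw c {..<L} ?S" using c by (simp add: inj_on_imp_bij_betw)
          define p where "p i = (if i < L then the_inv_into {..<L} (bead v) (c i) else i)" for i
          have "bij_betw (the_inv_into {..<L} (bead v) \<circ> c) {..<L} {..<L}"
            by (rule bij_betw_trans[OF bc bij_betw_the_inv_into[OF b]])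
          then have "bij_betw p {..<L} {..<L}"
            by (rule bij_betw_cong[THEN iffD1, rotated]) (simp add: p_def)
          then have p: "p permutes {..<L}" by (rule bij_imp_permutes) (simp add: p_def)
          have "c = restrict (\<lambda>i. bead v (p i)) {..<L}"
          proof
            fix i
            show "c i = restrict (\<lambda>i. bead v (p i)) {..<L} i"
            proof (cases "i < L")
              case True
              then show ?thesis using f_the_inv_into_f_bij_betw[OF b, of "c i"] by (auto simp: p_def)
            qed (use c in \<open>auto simp: PiE_def extensional_def\<close>)
          qed
          moreover have "v \<in> N" using v S by (simp add: N)
          ultimately show "c \<in> ?phi ` (N \<times> ?P)" using p by (auto intro!: image_eqI[of _ _ "(v, p)"])
        qed
      qed
    qed
  qed
  also have "\<dots> = (\<Sum>v\<in>N. \<Sum>p\<in>?P. ?F (?phi (v, p)))"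
    by (simp only: sum.cartesian_product split_def prod.collapse)
  also have "\<dots> = (\<Sum>v\<in>N. toep L f l v * toep L g v r)"
  proof (rule sum.cong[OF refl])
    fix v assume "v \<in> N"
    have "?F (?phi (v, p)) = toep L f l v * (signof p * (\<Prod>i<L. g (bead r i - bead v (p i))))"
      if p: "p permutes {..<L}" for p
    proof -
      have "dt L (\<lambda>i j. f (?phi (v, p) i - bead l j)) = dt L (\<lambda>i j. f (bead v (p i) - bead l j))"
        by (rule dt_cong) simp
      also have "\<dots> = signof p * toep L f l v"
        unfolding toep_def by (rule dt_permute_rows[OF p])
      finally show ?thesis by (simp add: mult_ac)
    qed
    then have "(\<Sum>p\<in>?P. ?F (?phi (v, p))) =
        (\<Sum>p\<in>?P. toep L f l v * (signof p * (\<Prod>i<L. g (bead r i - bead v (p i)))))"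
      by (intro sum.cong) auto
    also have "\<dots> = toep L f l v * toep L g v r"
      unfolding toep_def[of L g] dt_expand by (simp add: sum_distrib_left)
    finally show "(\<Sum>p\<in>?P. ?F (?phi (v, p))) = toep L f l v * toep L g v r" .
  qed
  finally show ?thesis .
qed

text \<open>The bead sets in the window of \<open>toep_mult\<close> include those of all partitions
  between \<open>l\<close> and \<open>r\<close>; the remaining terms vanish for lack of
  containment.\<close>

lemma minor_mult:
  assumes f: "causal f" and g: "causal g" and l: "is_partition l" and r: "is_partition r"
  shows "minor (conv f g) l r = (\<Sum>v | is_partition v \<and> l \<le> v \<and> v \<le> r. minor f l v * minor g v r)"
proof -
  define L where "L = max (plength l) (plength r)"
  define N where "N = {v. is_partition v \<and> plength v \<le> L \<and> bead v ` {..<L} \<subseteq> {1 - int L..int (r 0)}}"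
  have L: "plength l \<le> L" "plength r \<le> L" by (auto simp: L_def)
  have sub: "{v. is_partition v \<and> l \<le> v \<and> v \<le> r} \<subseteq> N"
  proof clarify
    fix v assume v: "is_partition v" "v \<le> r"
    have "v i \<le> r 0" for i using le_funD[OF v(2), of i] is_partitionD[OF r, of 0 i] by linarith
    then have "bead v i \<in> {1 - int L..int (r 0)}" if "i < L" for i using that by (simp add: bead_def) (metis diff_le_eq int_plus le_add1 of_nat_mono order_trans)
    then show "v \<in> N" using v plength_mono[OF v(1) r v(2)] L by (auto simp: N_def)
  qed
  have finN: "finite N"
  proof (rule finite_subset)
    show "N \<subseteq> {f. \<forall>i. (i \<in> {..<L} \<longrightarrow> f i \<in> {..r 0}) \<and> (i \<notin> {..<L} \<longrightarrow> f i = 0)}"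
    proof (clarify, intro conjI impI)
      fix v i assume v: "v \<in> N"
      then have vp: "is_partition v" "plength v \<le> L" by (auto simp: N_def)
      show "v i = 0" if "i \<notin> {..<L}" using that vp by (intro partition_zero) auto
      assume "i \<in> {..<L}"
      then have "bead v 0 \<in> bead v ` {..<L}" by (intro imageI) auto
      then have "bead v 0 \<le> int (r 0)" using v by (auto simp: N_def)
      then show "v i \<in> {..r 0}" using is_partitionD[OF vp(1), of 0 i] by (simp add: bead_def)
    qed
    show "finite {f :: nat \<Rightarrow> nat. \<forall>i. (i \<in> {..<L} \<longrightarrow> f i \<in> {..r 0}) \<and> (i \<notin> {..<L} \<longrightarrow> f i = 0)}"
      by (rule finite_set_of_finite_funs) auto
  qed
  have "minor (conv f g) l r = (\<Sum>v\<in>N. toep L f l v * toep L g v r)"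
    using toep_mult[OF f g l r N_def] minor_toep[OF causal_conv[OF f g] l r L] by simp
  also have "\<dots> = (\<Sum>v\<in>N. minor f l v * minor g v r)"
  proof (rule sum.cong[OF refl])
    fix v assume "v \<in> N"
    then have "is_partition v" "plength v \<le> L" by (auto simp: N_def)
    then show "toep L f l v * toep L g v r = minor f l v * minor g v r"
      using minor_toep[OF f l _ L(1), of v] minor_toep[OF g _ r _ L(2), of v] by simp
  qed
  also have "\<dots> = (\<Sum>v | is_partition v \<and> l \<le> v \<and> v \<le> r. minor f l v * minor g v r)"
  proof (rule sum.mono_neutral_right[OF finN sub], rule ballI)
    fix v assume v: "v \<in> N - {v. is_partition v \<and> l \<le> v \<and> v \<le> r}"
    then have "is_partition v" "\<not> l \<le> v \<or> \<not> v \<le> r" by (auto simp: N_def)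
    then show "minor f l v * minor g v r = 0"
      using minor_zero[OF f l, of v] minor_zero[OF g _ r, of v] by auto
  qed
  finally show ?thesis .
qed

section \<open>Power series identities and the inverse matrix of minors\<close>

definition genfps :: "(int \<Rightarrow> 'a::comm_ring_1) \<Rightarrow> 'a fps" where
  "genfps f = Abs_fps (\<lambda>n. f (int n))"

lemma genfps_nth [simp]: "fps_nth (genfps f) n = f (int n)"
  by (simp add: genfps_def)

lemma genfps_conv: "genfps (conv f g) = genfps f * genfps g"
proof (rule fps_ext)
  fix n
  have "conv f g (int n) = (\<Sum>c\<in>int ` {0..n}. f c * g (int n - c))"
    unfolding conv_def by (simp add: image_int_atLeastAtMost)
  also have "\<dots> = (\<Sum>i=0..n. f (int i) * g (int (n - i)))"
    by (subst sum.reindex) (auto simp: of_nat_diff intro!: sum.cong)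
  finally show "fps_nth (genfps (conv f g)) n = fps_nth (genfps f * genfps g) n"
    by (simp add: fps_mult_nth)
qed

lemma genfps_inject:
  assumes "causal f" "causal g" "genfps f = genfps g" shows "f = g"
proof
  fix e
  show "f e = g e"
  proof (cases "0 \<le> e")
    case True
    then show ?thesis using arg_cong[OF assms(3), of "\<lambda>F. fps_nth F (nat e)"] by simp
  qed (use assms in \<open>simp add: causal_def\<close>)
qed

definition delta :: "int \<Rightarrow> int" where
  "delta e = (if e = 0 then 1 else 0)"

lemma genfps_delta: "genfps delta = 1"
  by (rule fps_ext) (simp add: delta_def)

lemma causal_delta [simp]: "causal delta"
  by (simp add: causal_def delta_def)

lemma genfps_geom_inv: "0 < n \<Longrightarrow> genfps (geom_inv n) = 1 - fps_X ^ n"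
  by (intro fps_ext) (auto simp: geom_inv_def)

lemma genfps_geom_mult_inv:
  assumes "0 < n" shows "genfps (geom n) * genfps (geom_inv n) = 1"
proof (rule fps_ext)
  fix m
  have "fps_nth (genfps (geom n) * genfps (geom_inv n)) m = geom n (int m) - (if m < n then 0 else geom n (int (m - n)))"
    unfolding genfps_geom_inv[OF assms] by (simp add: right_diff_distrib fps_X_power_mult_right_nth)
  also have "\<dots> = (if m = 0 then 1 else 0)"
  proof (cases "m = 0")
    case False
    then have "geom n (int m) = geom n (int m - int n)" using geom_shift[of "int m" n] assms by simp
    then show ?thesis using False by (auto simp: of_nat_diff geom_def)
  qed (use assms in \<open>simp add: geom_def\<close>)
  finally show "fps_nth (genfps (geom n) * genfps (geom_inv n)) m = fps_nth 1 m" by simp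
qed

text \<open>If \<open>l i < r i\<close>, the beads of \<open>r\<close> up to row \<open>i\<close>
  all lie above the beads of \<open>l\<close> from row \<open>i\<close> on, which gives a zero
  block.\<close>

lemma minor_delta:
  assumes l: "is_partition l" and r: "is_partition r"
  shows "minor delta l r = (if l = r then 1 else 0)"
proof (cases "l \<le> r \<and> l \<noteq> r")
  case True
  then obtain i where "l i \<noteq> r i" by auto
  then have i: "l i < r i" using True by (simp add: le_fun_def le_neq_implies_less)
  then have iL: "i < plength r" using partition_nonzero_iff[OF r, of i] by auto
  have "dt (plength r) (\<lambda>i j. delta (bead r i - bead l j)) = 0"
  proof (rule dt_zero_block[where R = "{..i}" and C = "{i..<plength r}"])
    fix i' j assume "i' \<in> {..i}" "j \<in> {i..<plength r}"
    then have "bead r i \<le> bead r i'" "bead l j \<le> bead l i" "bead l i < bead r i"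
      using i l r by (auto simp: bead_le_iff) (simp add: bead_def)
    then show "delta (bead r i' - bead l j) = 0" by (simp add: delta_def)
  qed (use iL in auto)
  then show ?thesis using True minor_toep[OF causal_delta l r, of "plength r"] plength_mono[OF l r]
    by (simp add: toep_def)
next
  case False
  then show ?thesis using minor_zero[OF causal_delta l r] minor_self[OF causal_delta l] by auto
qed

lemma minor_inverse:
  fixes f g :: "int \<Rightarrow> int"
  assumes "causal f" "causal g" "genfps f * genfps g = 1" "is_partition l" "is_partition r"
  shows "(\<Sum>v | is_partition v \<and> l \<le> v \<and> v \<le> r. minor f l v * minor g v r) = (if l = r then 1 else 0)"
proof -
  have "conv f g = delta"
    by (rule genfps_inject) (use assms causal_conv in \<open>auto simp: genfps_conv genfps_delta\<close>)
  then show ?thesis using minor_mult[OF assms(1,2,4,5)] minor_delta[OF assms(4,5)] by simp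
qed


section \<open>Petrie minors\<close>

text \<open>All columns change at once, each by a multiple of its original neighbour. Written as a
  product with a unitriangular matrix, this leaves no question about the order of the
  operations.\<close>

lemma dt_col_prev:
  "dt L (\<lambda>i j. A i j - (if j = 0 then 0 else w j * A i (j - 1))) = dt L A"
proof -
  define E where "E k j = (if k = j then 1 else if Suc k = j then - w j else 0)" for k j
  have "dt L A * dt L E = dt L (\<lambda>i j. \<Sum>k<L. A i k * E k j)" by (rule dt_mult)
  moreover have "dt L E = 1" by (subst dt_upper) (auto simp: E_def)
  moreover have "dt L (\<lambda>i j. \<Sum>k<L. A i k * E k j) =
      dt L (\<lambda>i j. A i j - (if j = 0 then 0 else w j * A i (j - 1)))"
  proof (rule dt_cong)
    fix i j assume "j < L"
    have "(\<Sum>k<L. A i k * E k j) = (\<Sum>k<L. (if k = j then A i k else 0) + (if Suc k = j then - w j * A i k else 0))"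
      by (intro sum.cong) (auto simp: E_def)
    also have "\<dots> = A i j + (\<Sum>k<L. if Suc k = j then - w j * A i k else 0)"
      using \<open>j < L\<close> by (simp add: sum.distrib)
    also have "\<dots> = A i j - (if j = 0 then 0 else w j * A i (j - 1))"
      using \<open>j < L\<close> by (cases j) auto
    finally show "(\<Sum>k<L. A i k * E k j) = A i j - (if j = 0 then 0 else w j * A i (j - 1))" .
  qed
  ultimately show ?thesis by simp
qed

lemma dt_row_prev:
  "dt L (\<lambda>i j. A i j - (if i = 0 then 0 else w i * A (i - 1) j)) = dt L A"
proof -
  have "dt L (\<lambda>i j. A i j - (if i = 0 then 0 else w i * A (i - 1) j)) =
      dt L (\<lambda>j i. A i j - (if i = 0 then 0 else w i * A (i - 1) j))" by (rule dt_transpose)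
  also have "\<dots> = dt L (\<lambda>j i. A i j)" by (rule dt_col_prev)
  also have "\<dots> = dt L A" by (rule dt_transpose)
  finally show ?thesis .
qed

lemma dt_col_next:
  "dt L (\<lambda>i j. A i j - (if Suc j < L then w j * A i (Suc j) else 0)) = dt L A"
proof -
  define E where "E k j = (if k = j then 1 else if k = Suc j then - w j else 0)" for k j
  have "dt L A * dt L E = dt L (\<lambda>i j. \<Sum>k<L. A i k * E k j)" by (rule dt_mult)
  moreover have "dt L E = 1" by (subst dt_lower) (auto simp: E_def)
  moreover have "dt L (\<lambda>i j. \<Sum>k<L. A i k * E k j) =
      dt L (\<lambda>i j. A i j - (if Suc j < L then w j * A i (Suc j) else 0))"
  proof (rule dt_cong)
    fix i j assume "j < L"
    have "(\<Sum>k<L. A i k * E k j) = (\<Sum>k<L. (if k = j then A i k else 0) + (if k = Suc j then - w j * A i k else 0))"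
      by (intro sum.cong) (auto simp: E_def)
    also have "\<dots> = A i j - (if Suc j < L then w j * A i (Suc j) else 0)"
      using \<open>j < L\<close> by (simp add: sum.distrib)
    finally show "(\<Sum>k<L. A i k * E k j) = A i j - (if Suc j < L then w j * A i (Suc j) else 0)" .
  qed
  ultimately show ?thesis by simp
qed

text \<open>\<open>E\<close> is the identity matrix with column \<open>q\<close> replaced by the
  indicator of \<open>Q\<close>. It need not be triangular, but every permutation other than the
  identity meets one of its zeros.\<close>

lemma dt_col_sum:
  assumes q: "q \<in> Q" "Q \<subseteq> {..<L}"
  shows "dt L (\<lambda>i j. if j = q then \<Sum>k\<in>Q. A i k else A i j) = dt L A"
proof -
  define E :: "nat \<Rightarrow> nat \<Rightarrow> 'a" where "E k j = (if j = q then of_bool (k \<in> Q) else of_bool (k = j))" for k j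
  have "dt L A * dt L E = dt L (\<lambda>i j. \<Sum>k<L. A i k * E k j)" by (rule dt_mult)
  moreover have "dt L E = (\<Prod>i<L. E i i)"
  proof (rule dt_id_only, rule ccontr)
    fix p assume p: "p permutes {..<L}" "p \<noteq> id" "\<not> (\<exists>i<L. E i (p i) = 0)"
    obtain i where i: "p i \<noteq> i" using p(2) by (auto simp: fun_eq_iff)
    then have "i < L" using p(1) by (auto simp: permutes_def)
    then have "p i = q" using p(3) i by (auto simp: E_def split: if_splits)
    moreover have "q < L" using q by auto
    then have "p q = q" using p(3) by (auto simp: E_def split: if_splits)
    ultimately have "i = q" using permutes_inj[OF p(1)] by (metis injD)
    then show False using i \<open>p q = q\<close> by simp
  qed
  moreover have "(\<Prod>i<L. E i i) = 1" using q by (intro prod.neutral) (auto simp: E_def)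
  moreover have "dt L (\<lambda>i j. \<Sum>k<L. A i k * E k j) = dt L (\<lambda>i j. if j = q then \<Sum>k\<in>Q. A i k else A i j)"
  proof (rule dt_cong)
    fix i j assume "j < L"
    have "(\<Sum>k<L. A i k * of_bool (k \<in> Q)) = (\<Sum>k\<in>Q. A i k)"
      by (rule sum.mono_neutral_cong_right) (use q in auto)
    moreover have "(\<Sum>k<L. A i k * of_bool (k = j)) = (\<Sum>k\<in>{j}. A i k)"
      by (rule sum.mono_neutral_cong_right) (use \<open>j < L\<close> in auto)
    ultimately show "(\<Sum>k<L. A i k * E k j) = (if j = q then \<Sum>k\<in>Q. A i k else A i j)"
      by (simp add: E_def)
  qed
  ultimately show ?thesis by simp
qed

section \<open>Horizontal strips and the gaps between beads\<close>

definition hstrip :: "(nat \<Rightarrow> nat) \<Rightarrow> (nat \<Rightarrow> nat) \<Rightarrow> bool" where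
  "hstrip u v \<longleftrightarrow> (\<forall>i. u i \<le> v i \<and> v (Suc i) \<le> u i)"

lemma hstrip_le: "hstrip u v \<Longrightarrow> u \<le> v"
  by (auto simp: hstrip_def le_fun_def)

lemma horizontal_strip_iff_hstrip:
  assumes "is_partition u" "is_partition v" "u \<le> v"
  shows "horizontal_strip v u \<longleftrightarrow> hstrip u v"
proof
  assume h: "horizontal_strip v u"
  have "v (Suc i) \<le> u i" for i
  proof (rule ccontr)
    assume "\<not> v (Suc i) \<le> u i"
    then have "(i, u i) \<in> skew v u" "(Suc i, u i) \<in> skew v u"
      using is_partitionD[OF assms(1), of i "Suc i"] is_partitionD[OF assms(2), of i "Suc i"] by (auto simp: skew_def)
    then show False using h unfolding horizontal_strip_def by fastforce
  qed
  then show "hstrip u v" using assms(3) by (auto simp: hstrip_def le_fun_def)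
next
  assume h: "hstrip u v"
  have aux: False if "(i, j) \<in> skew v u" "(i', j) \<in> skew v u" "i < i'" for i i' j
  proof -
    have "v i' \<le> v (Suc i)" using is_partitionD[OF assms(2)] that(3) by simp
    also have "\<dots> \<le> u i" using h by (simp add: hstrip_def)
    finally show False using that by (auto simp: skew_def)
  qed
  show "horizontal_strip v u"
    unfolding horizontal_strip_def
  proof (clarsimp)
    fix i j i' assume "(i, j) \<in> skew v u" "(i', j) \<in> skew v u"
    then show "i = i'" using aux by (metis linorder_neqE_nat)
  qed
qed

text \<open>Position \<open>x\<close> lies between the beads \<open>j\<close> and \<open>j - 1\<close> of \<open>l\<close>; a horizontal strip over \<open>l\<close> has
  exactly one bead in each of these gaps.\<close>

definition bead_gap :: "(nat \<Rightarrow> nat) \<Rightarrow> nat \<Rightarrow> int \<Rightarrow> bool" where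
  "bead_gap l j x \<longleftrightarrow> bead l j \<le> x \<and> (j = 0 \<or> x < bead l (j - 1))"

lemma bead_gap_unique:
  assumes l: "is_partition l" and g: "bead_gap l i x" "bead_gap l j x" shows "i = j"
proof -
  have False if "i < j" "bead_gap l i x" "bead_gap l j x" for i j
  proof -
    have "bead l (j - 1) \<le> bead l i" using that l by (simp add: bead_le_iff)
    then show False using that by (auto simp: bead_gap_def)
  qed
  then show ?thesis using g by (metis linorder_neqE_nat)
qed

lemma hstrip_iff_bead_gap: "hstrip l r \<longleftrightarrow> (\<forall>i. bead_gap l i (bead r i))"
proof -
  have "(\<forall>i. bead_gap l i (bead r i)) \<longleftrightarrow> (\<forall>i. l i \<le> r i) \<and> (\<forall>i. i = 0 \<or> r i \<le> l (i - 1))"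
    by (auto simp: bead_gap_def bead_def)
  also have "(\<forall>i. i = 0 \<or> r i \<le> l (i - 1)) \<longleftrightarrow> (\<forall>i. r (Suc i) \<le> l i)"
  proof (intro iffI allI)
    fix i assume "\<forall>i. i = 0 \<or> r i \<le> l (i - 1)"
    from spec[OF this, of "Suc i"] show "r (Suc i) \<le> l i" by simp
  next
    fix i assume "\<forall>i. r (Suc i) \<le> l i"
    then show "i = 0 \<or> r i \<le> l (i - 1)" by (cases i) auto
  qed
  finally show ?thesis by (auto simp: hstrip_def)
qed

text \<open>Column \<open>j\<close> holds the indicators of \<open>bead l j \<le> x\<close>, and
  differences of neighbouring columns are indicators of gaps. For a horizontal strip the matrix
  becomes the identity.\<close>

lemma minor_geom_one:
  assumes l: "is_partition l" and r: "is_partition r"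
  shows "minor (geom 1) l r = (if hstrip l r then 1 else 0)"
proof (cases "l \<le> r")
  case False
  then show ?thesis using minor_zero[OF causal_geom l r] hstrip_le by auto
next
  case True
  define L where "L = plength r"
  have "minor (geom 1) l r = toep L (geom 1) l r"
    using minor_toep[OF causal_geom l r] plength_mono[OF l r True] by (simp add: L_def)
  also have "\<dots> = dt L (\<lambda>i j. geom 1 (bead r i - bead l j) - (if j = 0 then 0 else 1 * geom 1 (bead r i - bead l (j - 1))))"
    unfolding toep_def by (rule dt_col_prev[symmetric])
  also have "\<dots> = dt L (\<lambda>i j. of_bool (bead_gap l j (bead r i)))"
  proof (rule dt_cong)
    fix i j
    show "geom 1 (bead r i - bead l j) - (if j = 0 then 0 else 1 * geom 1 (bead r i - bead l (j - 1))) =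
        of_bool (bead_gap l j (bead r i))"
      using bead_le_iff[OF l, of j "j - 1"] by (auto simp: geom_def bead_gap_def)
  qed
  also have "\<dots> = (if hstrip l r then 1 else 0)"
  proof (cases "hstrip l r")
    case True
    then have "bead_gap l j (bead r i) \<longleftrightarrow> i = j" for i j
      using bead_gap_unique[OF l] by (auto simp: hstrip_iff_bead_gap)
    then show ?thesis using True by (simp add: dt_upper)
  next
    case False
    then have "\<not> (\<forall>i. r (Suc i) \<le> l i)" using True by (auto simp: hstrip_def le_fun_def)
    \<comment> \<open>Then the first \<open>i + 2\<close> beads of \<open>r\<close> lie at or above
      \<open>bead l i\<close>, hence in none of the gaps below it.\<close>
    then obtain i where i: "l i < r (Suc i)" by (auto simp: not_le)
    then have iL: "Suc i < L" using partition_nonzero_iff[OF r, of "Suc i"] by (auto simp: L_def)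
    have "dt L (\<lambda>i j. of_bool (bead_gap l j (bead r i)) :: int) = 0"
    proof (rule dt_zero_block[where R = "{..Suc i}" and C = "{Suc i..<L}"])
      fix i' j assume "i' \<in> {..Suc i}" "j \<in> {Suc i..<L}"
      then have "bead r (Suc i) \<le> bead r i'" "bead l (j - 1) \<le> bead l i" "bead l i \<le> bead r (Suc i)" "j \<noteq> 0"
        using i l r by (auto simp: bead_le_iff) (simp add: bead_def)
      then have "\<not> bead_gap l j (bead r i')" by (auto simp: bead_gap_def)
      then show "of_bool (bead_gap l j (bead r i')) = (0 :: int)" by simp
    qed (use iL in auto)
    then show ?thesis using False by simp
  qed
  finally show ?thesis .
qed

text \<open>The coefficients of \<open>1 + t + \<dots> + t\<^bsup>k-1\<^esup>\<close> and of its inverse \<open>(1 - t) / (1 - t\<^sup>k)\<close>.\<close>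

definition petrie_seq :: "nat \<Rightarrow> int \<Rightarrow> int" where
  "petrie_seq k e = (if 0 \<le> e \<and> e < int k then 1 else 0)"

definition petrie_seq_inv :: "nat \<Rightarrow> int \<Rightarrow> int" where
  "petrie_seq_inv k = conv (geom_inv 1) (geom k)"

lemma causal_petrie_seq [simp]: "0 < k \<Longrightarrow> causal (petrie_seq k)"
  by (simp add: causal_def petrie_seq_def)

lemma causal_petrie_seq_inv [simp]: "causal (petrie_seq_inv k)"
  unfolding petrie_seq_inv_def by (rule causal_conv) auto

lemma petrie_seq_conv:
  assumes "0 < k" shows "petrie_seq k = conv (geom 1) (geom_inv k)"
proof (rule genfps_inject)
  show "genfps (petrie_seq k) = genfps (conv (geom 1) (geom_inv k))"
    unfolding genfps_conv genfps_geom_inv[OF assms]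
    by (rule fps_ext) (auto simp: right_diff_distrib fps_X_power_mult_right_nth petrie_seq_def geom_def)
  show "causal (conv (geom 1) (geom_inv k))" by (rule causal_conv) auto
qed (use assms in auto)

lemma genfps_petrie_seq_mult_inv:
  assumes "0 < k" shows "genfps (petrie_seq k) * genfps (petrie_seq_inv k) = 1"
proof -
  have "genfps (petrie_seq k) * genfps (petrie_seq_inv k) =
      (genfps (geom 1) * genfps (geom_inv 1)) * (genfps (geom k) * genfps (geom_inv k))"
    unfolding petrie_seq_conv[OF assms] petrie_seq_inv_def genfps_conv by (simp only: mult_ac)
  then show ?thesis by (simp add: genfps_geom_mult_inv assms)
qed

text \<open>A Petrie coefficient is the difference of two step functions shifted by
  \<open>k\<close>. After subtracting neighbouring columns a row has at most two nonzero entries: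
  \<open>1\<close> at the gap of \<open>bead r i\<close> and \<open>-1\<close> at the gap of
  \<open>bead r i - k\<close>.\<close>

lemma minor_petrie_gap:
  assumes l: "is_partition l" and r: "is_partition r" and "l \<le> r" and k: "0 < k"
  shows "minor (petrie_seq k) l r = dt (plength r) 
    (\<lambda>i j. of_bool (bead_gap l j (bead r i)) - of_bool (bead_gap l j (bead r i - int k)))"
proof -
  define L where "L = plength r"
  have "minor (petrie_seq k) l r = toep L (petrie_seq k) l r"
    using minor_toep[OF causal_petrie_seq[OF k] l r] plength_mono[OF l r assms(3)] by (simp add: L_def)
  also have "\<dots> = dt L (\<lambda>i j. petrie_seq k (bead r i - bead l j) - (if j = 0 then 0 else 1 * petrie_seq k (bead r i - bead l (j - 1))))"
    unfolding toep_def by (rule dt_col_prev[symmetric])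
  also have "\<dots> = dt L (\<lambda>i j. of_bool (bead_gap l j (bead r i)) - of_bool (bead_gap l j (bead r i - int k)))"
  proof (rule dt_cong)
    fix i j
    have "petrie_seq k (bead r i - bead l m) = of_bool (bead l m \<le> bead r i) - of_bool (bead l m \<le> bead r i - int k)" for m
      by (auto simp: petrie_seq_def)
    moreover have "of_bool (bead_gap l j x) = (of_bool (bead l j \<le> x) - (if j = 0 then 0 else of_bool (bead l (j - 1) \<le> x)) :: int)" for x
      using bead_le_iff[OF l, of j "j - 1"] by (auto simp: bead_gap_def)
    ultimately show "petrie_seq k (bead r i - bead l j) - (if j = 0 then 0 else 1 * petrie_seq k (bead r i - bead l (j - 1))) =
        of_bool (bead_gap l j (bead r i)) - of_bool (bead_gap l j (bead r i - int k))" by simp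
  qed
  finally show ?thesis by (simp add: L_def)
qed

text \<open>A nonzero determinant has a nonzero term in its expansion, and \<open>geom_inv k\<close>
  is nonzero only at \<open>0\<close> and \<open>k\<close>.\<close>

lemma minor_geom_inv_choice:
  assumes v: "is_partition v" and r: "is_partition r" and nz: "minor (geom_inv k) v r \<noteq> 0"
  shows "\<exists>p. p permutes {..<plength r} \<and> (\<forall>i<plength r. bead v (p i) = bead r i \<or> bead v (p i) = bead r i - int k)"
proof -
  let ?L = "plength r"
  have "v \<le> r" using nz minor_zero[OF causal_geom_inv v r] by auto
  then have "toep ?L (geom_inv k) v r \<noteq> 0"
    using nz minor_toep[OF causal_geom_inv v r, of ?L] plength_mono[OF v r] by simp
  then have "\<exists>p\<in>{p. p permutes {..<?L}}. signof p * (\<Prod>i<?L. geom_inv k (bead r i - bead v (p i))) \<noteq> 0"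
    unfolding toep_def dt_expand by (rule contrapos_np) (auto intro: sum.neutral)
  then obtain p where p: "p permutes {..<?L}" "(\<Prod>i<?L. geom_inv k (bead r i - bead v (p i))) \<noteq> 0" by auto
  have "bead v (p i) = bead r i \<or> bead v (p i) = bead r i - int k" if "i < ?L" for i
  proof -
    have "geom_inv k (bead r i - bead v (p i)) \<noteq> 0" using p(2) that by auto
    then show ?thesis by (auto simp: geom_inv_def split: if_splits)
  qed
  then show ?thesis using p(1) by blast
qed

text \<open>Let \<open>p\<close> and \<open>p'\<close> match the beads of \<open>r\<close> with those of \<open>v\<close> and \<open>v'\<close>.  A row on which they
  differ is \<open>\<plusminus>(e\<^sub>i - e\<^sub>j)\<close> with \<open>i\<close>, \<open>j\<close> in the common image of these rows, so the rows on which they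
  differ are linearly dependent; if there are none, some row vanishes.\<close>

lemma minor_petrie_two_decomps:
  assumes l: "is_partition l" and r: "is_partition r" and k: "0 < k" and le: "l \<le> r"
    and v: "is_partition v" "hstrip l v" "minor (geom_inv k) v r \<noteq> 0"
    and v': "is_partition v'" "hstrip l v'" "minor (geom_inv k) v' r \<noteq> 0" and ne: "v \<noteq> v'"
  shows "minor (petrie_seq k) l r = 0"
proof -
  let ?L = "plength r"
  define A :: "nat \<Rightarrow> nat \<Rightarrow> int" where
    "A i j = of_bool (bead_gap l j (bead r i)) - of_bool (bead_gap l j (bead r i - int k))" for i j
  obtain p where p: "p permutes {..<?L}" and pb: "\<And>i. i < ?L \<Longrightarrow> bead v (p i) = bead r i \<or> bead v (p i) = bead r i - int k"
    using minor_geom_inv_choice[OF v(1) r v(3)] by blast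
  obtain p' where p': "p' permutes {..<?L}" and pb': "\<And>i. i < ?L \<Longrightarrow> bead v' (p' i) = bead r i \<or> bead v' (p' i) = bead r i - int k"
    using minor_geom_inv_choice[OF v'(1) r v'(3)] by blast
  have gv: "bead_gap l (p i) (bead v (p i))" for i using v(2) by (simp add: hstrip_iff_bead_gap)
  have gv': "bead_gap l (p' i) (bead v' (p' i))" for i using v'(2) by (simp add: hstrip_iff_bead_gap)
  have A0: "dt ?L A = 0" if z: "i < ?L" "\<And>j. A i j = 0" for i
    by (rule dt_zero_block[where R = "{i}" and C = "{..<?L}"]) (use z in auto)
  have "dt ?L A = 0"
  proof (cases "\<exists>i<?L. p i = p' i \<and> bead v (p i) \<noteq> bead v' (p' i)")
    case True
    then obtain i where i: "i < ?L" "p i = p' i" "bead v (p i) \<noteq> bead v' (p' i)" by blast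
    \<comment> \<open>Here \<open>bead r i\<close> and \<open>bead r i - k\<close> lie in the same
      gap, so the two indicators in this row cancel.\<close>
    have "bead_gap l (p i) (bead r i)" "bead_gap l (p i) (bead r i - int k)"
      using pb[OF i(1)] pb'[OF i(1)] gv[of i] gv'[of i] i(2,3) by auto
    then have "bead_gap l j (bead r i) \<longleftrightarrow> bead_gap l j (bead r i - int k)" for j
      using bead_gap_unique[OF l, of j _ "p i"] by blast
    then have "A i j = 0" for j unfolding A_def by simp
    then show ?thesis using A0 i(1) by blast
  next
    case False
    define R where "R = {i. i < ?L \<and> p i \<noteq> p' i}"
    have Rsub: "R \<subseteq> {..<?L}" by (auto simp: R_def)
    have "R \<noteq> {}"
    proof
      assume "R = {}"
      then have eq: "bead v (p i) = bead v' (p i)" if "i < ?L" for i using False that by (auto simp: R_def)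
      have "v j = v' j" for j
      proof (cases "j < ?L")
        case True
        then have "j \<in> p ` {..<?L}" using permutes_image[OF p] by simp
        then show ?thesis using eq by (auto simp: bead_def)
      next
        case False
        have "v \<le> r" "v' \<le> r" using v v' minor_zero[OF causal_geom_inv _ r] by blast+
        then have "v j \<le> r j" "v' j \<le> r j" by (auto simp: le_fun_def)
        then show ?thesis using partition_zero[OF r, of j] False by simp
      qed
      then show False using ne by auto
    qed
    have same: "p ` R = p' ` R"
    proof -
      have RR: "R = {..<?L} - ({..<?L} - R)" using Rsub by auto
      have "s ` R = {..<?L} - s ` ({..<?L} - R)" if "s permutes {..<?L}" for s
        by (subst RR) (simp only: image_set_diff[OF permutes_inj[OF that]] permutes_image[OF that])
      from this[OF p] this[OF p']
      have "p ` R = {..<?L} - p ` ({..<?L} - R)" "p' ` R = {..<?L} - p' ` ({..<?L} - R)" by auto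
      moreover have "p ` ({..<?L} - R) = p' ` ({..<?L} - R)" by (auto simp: R_def intro!: image_cong)
      ultimately show ?thesis by simp
    qed
    define S where "S = p ` R"
    have S: "S \<subseteq> {..<?L}" "card S = card R" "S \<noteq> {}"
      using permutes_image[OF p] Rsub \<open>R \<noteq> {}\<close> permutes_inj[OF p]
      by (auto simp: S_def intro!: card_image inj_on_subset[of p UNIV])
    then obtain q where q: "q \<in> S" by blast
    have row: "(\<forall>j. A i j = of_bool (j = p i) - of_bool (j = p' i)) \<or> (\<forall>j. A i j = of_bool (j = p' i) - of_bool (j = p i))"
      if "i \<in> R" for i
    proof -
      have i: "i < ?L" "p i \<noteq> p' i" using that by (auto simp: R_def)
      have "bead v (p i) \<noteq> bead v' (p' i)"
        using gv[of i] gv'[of i] bead_gap_unique[OF l, of "p i" _ "p' i"] i(2) by auto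
      then consider "bead v (p i) = bead r i" "bead v' (p' i) = bead r i - int k"
        | "bead v (p i) = bead r i - int k" "bead v' (p' i) = bead r i"
        using pb[OF i(1)] pb'[OF i(1)] by fastforce
      then show ?thesis
      proof cases
        case 1
        then have "bead_gap l j (bead r i) \<longleftrightarrow> j = p i" "bead_gap l j (bead r i - int k) \<longleftrightarrow> j = p' i" for j
          using gv[of i] gv'[of i] bead_gap_unique[OF l, of j _ "p i"] bead_gap_unique[OF l, of j _ "p' i"] by auto
        then show ?thesis by (simp add: A_def)
      next
        case 2
        then have "bead_gap l j (bead r i) \<longleftrightarrow> j = p' i" "bead_gap l j (bead r i - int k) \<longleftrightarrow> j = p i" for j
          using gv[of i] gv'[of i] bead_gap_unique[OF l, of j _ "p i"] bead_gap_unique[OF l, of j _ "p' i"] by auto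
        then show ?thesis by (simp add: A_def)
      qed
    qed
    \<comment> \<open>Collecting the columns of \<open>S\<close> in column \<open>q\<close> makes
      that column vanish on the rows in \<open>R\<close>, each of which has one \<open>1\<close> and
      one \<open>-1\<close>, both within \<open>S\<close>. On these rows only the other
      \<open>card S - 1\<close> columns of \<open>S\<close> survive, one fewer than there are
      rows.\<close>
    have "dt ?L A = dt ?L (\<lambda>i j. if j = q then \<Sum>k\<in>S. A i k else A i j)"
      by (rule dt_col_sum[symmetric, OF q S(1)])
    also have "\<dots> = 0"
    proof (rule dt_zero_block[where R = R and C = "{..<?L} - (S - {q})"])
      have "card ({..<?L} - (S - {q})) = ?L - (card S - 1)"
        using S(1) q finite_subset[OF S(1)] by (subst card_Diff_subset) auto
      moreover have "card S \<le> ?L" using card_mono[OF _ S(1)] by simp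
      moreover have "0 < card S" using q finite_subset[OF S(1)] by (auto simp: card_gt_0_iff)
      ultimately show "?L < card R + card ({..<?L} - (S - {q}))" using S(2) by linarith
      fix i j assume i: "i \<in> R" and j: "j \<in> {..<?L} - (S - {q})"
      have in_S: "p i \<in> S" "p' i \<in> S" using i same by (auto simp: S_def)
      have finS: "finite S" using finite_subset[OF S(1)] by simp
      have "(\<Sum>k\<in>S. of_bool (k = p i) :: int) = 1" "(\<Sum>k\<in>S. of_bool (k = p' i) :: int) = 1"
        using in_S finS by (simp_all add: of_bool_def)
      then have "(\<Sum>k\<in>S. A i k) = 0" using row[OF i] by (auto simp: sum_subtractf)
      moreover have "A i j = 0" if "j \<noteq> q"
      proof -
        have "j \<noteq> p i" "j \<noteq> p' i" using that in_S j by auto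
        then show ?thesis using row[OF i] by auto
      qed
      ultimately show "(if j = q then \<Sum>k\<in>S. A i k else A i j) = 0" by simp
    qed (use Rsub in auto)
    finally show ?thesis .
  qed
  then show ?thesis using minor_petrie_gap[OF l r le k] by (simp add: A_def)
qed

lemma sgn_vertical_nonzero: "sgn_vertical k r l \<noteq> 0"
  by (simp add: sgn_vertical_def Let_def)

lemma proper_decomp_iff:
  assumes l: "is_partition l" and r: "is_partition r" and k: "0 < k"
  shows "proper_decomp k r l v \<longleftrightarrow> is_partition v \<and> hstrip l v \<and> minor (geom_inv k) v r \<noteq> 0"
proof (cases "is_partition v")
  case v: True
  have "minor (geom_inv k) v r \<noteq> 0 \<longleftrightarrow> vertical_ribbon k r v"
    using minor_geom_inv[OF v r k] sgn_vertical_nonzero[of k r v] by simp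
  moreover have "minor (geom_inv k) v r \<noteq> 0 \<Longrightarrow> v \<le> r" using minor_zero[OF causal_geom_inv v r] by blast
  moreover have "l \<le> v \<and> horizontal_strip v l \<longleftrightarrow> hstrip l v"
    using horizontal_strip_iff_hstrip[OF l v] hstrip_le by blast
  ultimately show ?thesis unfolding proper_decomp_def by blast
qed (simp add: proper_decomp_def)

text \<open>For the factors \<open>1/(1 - t)\<close> and \<open>1 - t^k\<close> the Cauchy--Binet
  sum has one signed term per decomposition. A single term is the sign of a good ribbon; if there
  are several, the determinant vanishes by linear dependence, without any inspection of their
  signs.\<close>

lemma minor_petrie:
  assumes l: "is_partition l" and r: "is_partition r" and k: "0 < k"
  shows "minor (petrie_seq k) l r = (if good_proper_ribbon k r l then sgn_good k r l else 0)"
proof -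
  let ?D = "{v. proper_decomp k r l v}"
  have D: "?D = {v. is_partition v \<and> hstrip l v \<and> minor (geom_inv k) v r \<noteq> 0}"
    using proper_decomp_iff[OF l r k] by auto
  have le: "l \<le> r" if "v \<in> ?D" for v using that by (auto simp: proper_decomp_def)
  have "minor (petrie_seq k) l r = (\<Sum>v | is_partition v \<and> l \<le> v \<and> v \<le> r. minor (geom 1) l v * minor (geom_inv k) v r)"
    unfolding petrie_seq_conv[OF k] by (rule minor_mult) (use l r in auto)
  also have "\<dots> = (\<Sum>v\<in>?D. minor (geom_inv k) v r)"
  proof (rule sum.mono_neutral_cong_right)
    show "finite {v. is_partition v \<and> l \<le> v \<and> v \<le> r}"
      by (rule finite_subset[OF _ finite_partitions_below[OF r]]) auto
    show "?D \<subseteq> {v. is_partition v \<and> l \<le> v \<and> v \<le> r}" by (auto simp: proper_decomp_def)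
    show "\<forall>v\<in>{v. is_partition v \<and> l \<le> v \<and> v \<le> r} - ?D. minor (geom 1) l v * minor (geom_inv k) v r = 0"
      unfolding D using minor_geom_one[OF l] by auto
    fix v assume "v \<in> ?D"
    then show "minor (geom 1) l v * minor (geom_inv k) v r = minor (geom_inv k) v r"
      unfolding D using minor_geom_one[OF l] by auto
  qed
  finally have sum: "minor (petrie_seq k) l r = (\<Sum>v\<in>?D. minor (geom_inv k) v r)" .
  show ?thesis
  proof (cases "good_proper_ribbon k r l")
    case True
    then obtain v where v: "proper_decomp k r l v" "\<And>v'. proper_decomp k r l v' \<Longrightarrow> v' = v"
      unfolding good_proper_ribbon_def by blast
    then have "?D = {v}" by blast
    moreover have "(THE v. proper_decomp k r l v) = v" by (rule the_equality) (fact v)+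
    ultimately have "minor (petrie_seq k) l r = minor (geom_inv k) v r" "sgn_good k r l = sgn_vertical k r v"
      using sum by (simp_all add: sgn_good_def)
    then show ?thesis using True minor_geom_inv[OF _ r k, of v] v(1) by (auto simp: proper_decomp_def)
  next
    case False
    show ?thesis
    proof (cases "?D = {}")
      case True
      then show ?thesis using False sum by simp
    next
      case ne: False
      then obtain v v' where "proper_decomp k r l v" "proper_decomp k r l v'" "v \<noteq> v'"
        using False unfolding good_proper_ribbon_def by blast
      then have "minor (petrie_seq k) l r = 0"
        using minor_petrie_two_decomps[OF l r k, of v v'] le proper_decomp_iff[OF l r k] by blast
      then show ?thesis using False by simp
    qed
  qed
qed

text \<open>If row \<open>i\<close> grew by \<open>k\<close> or more, the beads of \<open>r\<close>
  up to row \<open>i\<close> would exceed those of \<open>l\<close> from row \<open>i\<close> on by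
  at least \<open>k\<close>, giving a zero block.\<close>

lemma minor_petrie_row_bound:
  assumes l: "is_partition l" and r: "is_partition r" and k: "0 < k" and nz: "minor (petrie_seq k) l r \<noteq> 0"
  shows "r i - l i < k"
proof (rule ccontr)
  assume a: "\<not> r i - l i < k"
  have le: "l \<le> r" using nz minor_zero[OF causal_petrie_seq[OF k] l r] by auto
  have iL: "i < plength r" using a k partition_nonzero_iff[OF r, of i] by (cases "r i = 0") auto
  have "dt (plength r) (\<lambda>i j. petrie_seq k (bead r i - bead l j)) = 0"
  proof (rule dt_zero_block[where R = "{..i}" and C = "{i..<plength r}"])
    fix i' j assume "i' \<in> {..i}" "j \<in> {i..<plength r}"
    then have "bead r i \<le> bead r i'" "bead l j \<le> bead l i"
      using l r by (auto simp: bead_le_iff)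
    moreover have "bead l i + int k \<le> bead r i" using a k by (simp add: bead_def)
    ultimately show "petrie_seq k (bead r i' - bead l j) = 0" by (simp add: petrie_seq_def)
  qed (use iL in auto)
  then show False using nz minor_toep[OF causal_petrie_seq[OF k] l r, of "plength r"] plength_mono[OF l r le]
    by (simp add: toep_def)
qed

lemma minor_geom_conj:
  assumes l: "is_partition l" and r: "is_partition r" and n: "0 < n"
  shows "minor (geom n) l r = (-1) ^ card (skew r l) * minor (geom_inv n) (conj_part l) (conj_part r)"
  using minor_geom_inv_conj[of "conj_part l" "conj_part r" n] l r n card_skew_conj[OF l r]
  by (simp flip: power_mult_distrib mult.assoc)

text \<open>The duality is applied to both factors of the inverse series: the exponents of the signs
  add along \<open>l \<le> v \<le> r\<close>, and conjugation carries the intermediate partitions to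
  those between the conjugates.\<close>

lemma minor_petrie_inv_conj:
  assumes l: "is_partition l" and r: "is_partition r" and k: "0 < k"
  shows "minor (petrie_seq_inv k) l r = (-1) ^ card (skew r l) * minor (petrie_seq k) (conj_part l) (conj_part r)"
proof -
  let ?l = "conj_part l" and ?r = "conj_part r"
  have "minor (petrie_seq_inv k) l r = (\<Sum>v | is_partition v \<and> l \<le> v \<and> v \<le> r. minor (geom_inv 1) l v * minor (geom k) v r)"
    unfolding petrie_seq_inv_def by (rule minor_mult) (use l r in auto)
  also have "\<dots> = (\<Sum>v | is_partition v \<and> l \<le> v \<and> v \<le> r. 
      (-1) ^ card (skew r l) * (minor (geom 1) ?l (conj_part v) * minor (geom_inv k) (conj_part v) ?r))"
  proof (intro sum.cong refl, clarify)
    fix v assume v: "is_partition v" "l \<le> v" "v \<le> r"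
    have "card (skew r l) = card (skew v l) + card (skew r v)"
      using card_skew[OF v(1) l v(2)] card_skew[OF r v(1,3)] card_skew[OF r l] v by force
    then show "minor (geom_inv 1) l v * minor (geom k) v r =
        (-1) ^ card (skew r l) * (minor (geom 1) ?l (conj_part v) * minor (geom_inv k) (conj_part v) ?r)"
      using minor_geom_inv_conj[OF l v(1), of 1] minor_geom_conj[OF v(1) r k] by (simp add: power_add)
  qed
  also have "\<dots> = (-1) ^ card (skew r l) * 
      (\<Sum>v | is_partition v \<and> l \<le> v \<and> v \<le> r. minor (geom 1) ?l (conj_part v) * minor (geom_inv k) (conj_part v) ?r)"
    by (rule sum_distrib_left[symmetric])
  also have "(\<Sum>v | is_partition v \<and> l \<le> v \<and> v \<le> r. minor (geom 1) ?l (conj_part v) * minor (geom_inv k) (conj_part v) ?r) =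
      (\<Sum>v | is_partition v \<and> ?l \<le> v \<and> v \<le> ?r. minor (geom 1) ?l v * minor (geom_inv k) v ?r)"
  proof (rule sum.reindex_bij_witness[of _ conj_part conj_part])
    fix v assume v: "v \<in> {v. is_partition v \<and> ?l \<le> v \<and> v \<le> ?r}"
    then show "conj_part v \<in> {v. is_partition v \<and> l \<le> v \<and> v \<le> r}"
      using conj_mono[of ?l v] conj_mono[of v ?r] l r by simp
  qed (use conj_mono l r in auto)
  also have "\<dots> = minor (petrie_seq k) ?l ?r"
    unfolding petrie_seq_conv[OF k] by (rule minor_mult[symmetric]) (use l r in auto)
  finally show ?thesis .
qed


section \<open>Commutation with horizontal strips\<close>

text \<open>Congruence modulo \<open>X^(a+1)\<close>: the first row of a horizontal strip may grow
  without bound, while only strips of \<open>a\<close> boxes are wanted.\<close>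

definition agree_upto :: "nat \<Rightarrow> 'a::comm_ring_1 fps \<Rightarrow> 'a fps \<Rightarrow> bool" where
  "agree_upto a F G \<longleftrightarrow> (\<forall>d\<le>a. fps_nth F d = fps_nth G d)"

lemma agree_upto_mult: "agree_upto a F G \<Longrightarrow> agree_upto a F' G' \<Longrightarrow> agree_upto a (F * F') (G * G')"
  by (auto simp: agree_upto_def fps_mult_nth intro!: sum.cong)

lemma agree_upto_refl: "agree_upto a F F"
  by (simp add: agree_upto_def)

lemma agree_upto_sum: "(\<And>x. x \<in> S \<Longrightarrow> agree_upto a (F x) (G x)) \<Longrightarrow> agree_upto a (sum F S) (sum G S)"
  by (auto simp: agree_upto_def fps_sum_nth intro!: sum.cong)

lemma agree_upto_prod: "(\<And>x. x \<in> S \<Longrightarrow> agree_upto a (F x) (G x)) \<Longrightarrow> agree_upto a (prod F S) (prod G S)"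
  by (induction S rule: infinite_finite_induct) (auto simp: agree_upto_mult agree_upto_refl)

lemma agree_upto_dt:
  assumes "\<And>i j. i < L \<Longrightarrow> j < L \<Longrightarrow> agree_upto a (A i j) (B i j)"
  shows "agree_upto a (dt L A) (dt L B)"
  unfolding dt_expand
proof (intro agree_upto_sum agree_upto_mult agree_upto_refl agree_upto_prod)
  fix p i assume "p \<in> {p. p permutes {..<L}}" "i \<in> {..<L}"
  then show "agree_upto a (A i (p i)) (B i (p i))"
    using assms permutes_in_image[of p "{..<L}" i] by auto
qed

lemma dt_fps_const: "dt L (\<lambda>i j. fps_const (A i j)) = fps_const (dt L A)"
proof -
  interpret comm_ring_hom fps_const
    by unfold_locales auto
  have "dt L (\<lambda>i j. fps_const (A i j)) = det (map_mat fps_const (mat L L (\<lambda>(i, j). A i j)))"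
    by (rule arg_cong[of _ _ det], rule eq_matI) auto
  then show ?thesis by (simp only: hom_det)
qed

text \<open>An entry of a determinant summed over all lengths of its row, with each additional box
  marked by \<open>X\<close>.\<close>

definition tailfps :: "(int \<Rightarrow> 'a::comm_ring_1) \<Rightarrow> int \<Rightarrow> 'a fps" where
  "tailfps f e = Abs_fps (\<lambda>d. f (e + int d))"

lemma tailfps_step: "tailfps f e = fps_const (f e) + fps_X * tailfps f (e + 1)"
  by (rule fps_ext) (auto simp: tailfps_def fps_X_mult_nth of_nat_diff algebra_simps)

text \<open>A row length confined to an interval gives a difference of two tails; the second one is
  supplied by a neighbouring row or column.\<close>

lemma tailfps_window:
  "(\<Sum>d\<le>m. fps_X ^ d * fps_const (f (e + int d))) =
     tailfps f e - fps_X ^ Suc m * tailfps f (e + int m + 1)"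
proof (induction m)
  case 0
  show ?case using tailfps_step[of f e] by simp
next
  case (Suc m)
  have "fps_X ^ Suc m * tailfps f (e + int m + 1) =
      fps_X ^ Suc m * fps_const (f (e + int (Suc m))) + fps_X ^ Suc (Suc m) * tailfps f (e + int (Suc m) + 1)"
    by (subst tailfps_step) (simp add: algebra_simps)
  then show ?case using Suc by simp
qed

text \<open>The negative arguments only put a power of \<open>X\<close> in front. This is where the
  whole series of \<open>f\<close> appears as a factor.\<close>

lemma tailfps_nonpos:
  assumes "causal f" shows "tailfps f (- int d) = fps_X ^ d * genfps f"
  by (rule fps_ext)
    (use assms in \<open>auto simp: tailfps_def fps_X_power_mult_nth causal_def of_nat_diff\<close>)

definition hstrip_above :: "(nat \<Rightarrow> nat) \<Rightarrow> nat \<Rightarrow> (nat \<Rightarrow> nat) set" where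
  "hstrip_above u a = {v. is_partition v \<and> hstrip u v \<and> psize v = psize u + a}"

definition hstrip_below :: "(nat \<Rightarrow> nat) \<Rightarrow> nat \<Rightarrow> (nat \<Rightarrow> nat) set" where
  "hstrip_below v a = {u. is_partition u \<and> hstrip u v \<and> psize v = psize u + a}"

lemma psize_diff:
  assumes "is_partition u" "is_partition v" "u \<le> v" "plength v \<le> L"
  shows "psize v = psize u + (\<Sum>i<L. v i - u i)"
  using card_skew[OF assms(2,1,3)] card_skew_sum[OF assms(2,4)] by simp

text \<open>The rows of the partitions that interlace with \<open>u\<close> from above vary independently of each other,
  so that by multilinearity the sum is a single determinant.\<close>

lemma hstrip_above_sum:
  fixes f :: "int \<Rightarrow> 'a::comm_ring_1"
  assumes f: "causal f" and l: "is_partition l" "plength l \<le> K" and u: "is_partition u" "plength u \<le> K"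
  shows "(\<Sum>r\<in>hstrip_above u a. minor f l r) =
    fps_nth (dt (Suc K) (\<lambda>i j. tailfps f (bead u i - bead l j))) a"
proof -
  let ?L = "Suc K"
  \<comment> \<open>Row \<open>0\<close> has no upper bound from interlacing, but a strip of
    \<open>a\<close> boxes cannot exceed \<open>u 0 + a\<close>. The order is \<open>Suc K\<close>
    because the strip may occupy one new row.\<close>
  define hi where "hi i = (if i = 0 then u 0 + a else u (i - 1))" for i
  define C where "C i = {u i..hi i}" for i
  have uhi: "u i \<le> hi i" for i using is_partitionD[OF u(1), of "i - 1" i] by (simp add: hi_def)
  define E where "E c = (\<Sum>i<?L. c i - u i)" for c :: "nat \<Rightarrow> nat"
  let ?D = "\<lambda>c. dt ?L (\<lambda>i j. f (int (c i) - int i - bead l j))"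
  let ?S = "dt ?L (\<lambda>i j. \<Sum>c\<in>C i. fps_X ^ (c - u i) * fps_const (f (int c - int i - bead l j)))"
  have "?S = (\<Sum>c\<in>Pi\<^sub>E {..<?L} C. (\<Prod>i<?L. fps_X ^ (c i - u i)) * dt ?L (\<lambda>i j. fps_const (f (int (c i) - int i - bead l j))))"
    by (rule dt_multilinear) (simp add: C_def)
  also have "\<dots> = (\<Sum>c\<in>Pi\<^sub>E {..<?L} C. fps_X ^ E c * fps_const (?D c))"
    by (simp only: dt_fps_const E_def power_sum)
  finally have S1: "fps_nth ?S a = (\<Sum>c\<in>Pi\<^sub>E {..<?L} C. if E c = a then ?D c else 0)"
    by (simp only: fps_sum_nth) (intro sum.cong refl, simp add: fps_X_power_mult_nth)
  have finC: "finite (Pi\<^sub>E {..<?L} C)" by (intro finite_PiE) (auto simp: C_def)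
  have "(\<Sum>c\<in>Pi\<^sub>E {..<?L} C. if E c = a then ?D c else 0) = (\<Sum>c\<in>{c\<in>Pi\<^sub>E {..<?L} C. E c = a}. ?D c)"
    by (rule sum.mono_neutral_cong_right) (use finC in auto)
  also have "\<dots> = (\<Sum>r\<in>hstrip_above u a. minor f l r)"
  proof (rule sum.reindex_bij_witness[of _ "\<lambda>r. restrict r {..<?L}" "\<lambda>c i. if i < ?L then c i else 0"])
    fix c assume c: "c \<in> {c\<in>Pi\<^sub>E {..<?L} C. E c = a}"
    let ?r = "\<lambda>i. if i < ?L then c i else 0"
    show "restrict ?r {..<?L} = c" using c by (auto simp: PiE_def extensional_def)
    have ci: "u i \<le> c i" "c i \<le> hi i" if "i < ?L" for i using c that by (auto simp: C_def PiE_def Pi_def)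
    have h: "hstrip u ?r"
      unfolding hstrip_def
    proof (intro allI conjI)
      fix i
      show "u i \<le> ?r i" using ci(1)[of i] partition_zero[OF u(1), of i] u(2) by auto
      show "?r (Suc i) \<le> u i" using ci(2)[of "Suc i"] by (auto simp: hi_def)
    qed
    have r: "is_partition ?r"
    proof (rule is_partitionI[of _ ?L])
      fix i have "?r (Suc i) \<le> u i" "u i \<le> ?r i" using h by (auto simp: hstrip_def)
      then show "?r (Suc i) \<le> ?r i" by (rule order.trans)
    qed simp
    have len: "plength ?r \<le> ?L" using plength_le_iff[OF r] by simp
    have "psize ?r = psize u + E c"
      using psize_diff[OF u(1) r hstrip_le[OF h] len] by (simp add: E_def)
    then show "?r \<in> hstrip_above u a" using r h c by (simp add: hstrip_above_def)
    have "minor f l ?r = toep ?L f l ?r" using l by (intro minor_toep[OF f l(1) r _ len]) simp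
    also have "\<dots> = ?D c" unfolding toep_def by (rule dt_cong) (simp add: bead_def)
    finally show "minor f l ?r = ?D c" .
  next
    fix r assume r: "r \<in> hstrip_above u a"
    then have r': "is_partition r" "hstrip u r" "psize r = psize u + a" by (auto simp: hstrip_above_def)
    have "r ?L \<le> u K" using r'(2) by (simp add: hstrip_def)
    also have "u K = 0" using partition_zero[OF u] .
    finally have len: "plength r \<le> ?L" using plength_le_iff[OF r'(1)] by simp
    have z: "r i = 0" if "\<not> i < ?L" for i using partition_zero[OF r'(1), of i] len that by simp
    then show "(\<lambda>i. if i < ?L then restrict r {..<?L} i else 0) = r" by auto
    have E: "E r = a" using psize_diff[OF u(1) r'(1) hstrip_le[OF r'(2)] len] r'(3) by (simp add: E_def)
    have "r i \<in> C i" if "i < ?L" for i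
    proof (cases i)
      case 0
      have "r 0 - u 0 \<le> E r" unfolding E_def by (rule member_le_sum) auto
      then show ?thesis using 0 E r'(2) by (auto simp: C_def hi_def hstrip_def)
    next
      case (Suc i')
      then show ?thesis using r'(2) by (auto simp: C_def hi_def hstrip_def)
    qed
    moreover have "E (restrict r {..<?L}) = E r" unfolding E_def by (rule sum.cong) auto
    ultimately show "restrict r {..<?L} \<in> {c\<in>Pi\<^sub>E {..<?L} C. E c = a}" using E by auto
  qed
  finally have S2: "fps_nth ?S a = (\<Sum>r\<in>hstrip_above u a. minor f l r)" using S1 by simp
  define Phi where "Phi i j = tailfps f (bead u i - bead l j)" for i j
  define w :: "nat \<Rightarrow> 'a fps" where "w i = fps_X ^ Suc (hi i - u i)" for i
  \<comment> \<open>In row \<open>i\<close> the subtracted tail is \<open>w i\<close> times the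
    entry of \<open>Phi\<close> in row \<open>i - 1\<close>; in row \<open>0\<close> it is a
    multiple of \<open>X^(a+1)\<close> and does not reach the coefficient of degree
    \<open>a\<close>.\<close>
  have "agree_upto a ?S (dt ?L (\<lambda>i j. Phi i j - (if i = 0 then 0 else w i * Phi (i - 1) j)))"
  proof (rule agree_upto_dt)
    fix i j
    have "(\<Sum>c\<in>C i. fps_X ^ (c - u i) * fps_const (f (int c - int i - bead l j))) =
        (\<Sum>d\<le>hi i - u i. fps_X ^ d * fps_const (f (bead u i - bead l j + int d)))"
      by (rule sum.reindex_bij_witness[of _ "\<lambda>d. d + u i" "\<lambda>c. c - u i"])
        (use uhi[of i] in \<open>auto simp: C_def bead_def of_nat_diff algebra_simps\<close>)
    also have "\<dots> = Phi i j - w i * tailfps f (bead u i - bead l j + int (hi i - u i) + 1)"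
      unfolding tailfps_window by (simp add: Phi_def w_def)
    also have "agree_upto a \<dots> (Phi i j - (if i = 0 then 0 else w i * Phi (i - 1) j))"
    proof (cases i)
      case 0
      then show ?thesis by (simp add: agree_upto_def w_def hi_def fps_X_power_mult_nth flip: power_Suc)
    next
      case (Suc i')
      then have e: "bead u (Suc i') - bead l j + int (hi (Suc i') - u (Suc i')) + 1 = bead u i' - bead l j"
        using uhi[of i] by (simp add: bead_def hi_def of_nat_diff)
      show ?thesis unfolding Suc e by (simp add: Phi_def agree_upto_refl)
    qed
    finally show "agree_upto a (\<Sum>c\<in>C i. fps_X ^ (c - u i) * fps_const (f (int c - int i - bead l j)))
       (Phi i j - (if i = 0 then 0 else w i * Phi (i - 1) j))" .
  qed
  then have "fps_nth ?S a = fps_nth (dt ?L Phi) a" by (simp add: agree_upto_def dt_row_prev)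
  then show ?thesis using S2 by (simp add: Phi_def)
qed

lemma hstrip_below_sum:
  fixes f :: "int \<Rightarrow> 'a::comm_ring_1"
  assumes f: "causal f" and l: "is_partition l" "plength l \<le> K" and u: "is_partition u" "plength u \<le> K"
  defines "w \<equiv> \<lambda>j. fps_X ^ Suc (l j - l (Suc j))"
  shows "(\<Sum>r\<in>hstrip_below l a. minor f r u) =
    fps_nth (dt K (\<lambda>i j. tailfps f (bead u i - bead l j) - w j * tailfps f (bead u i - bead l (Suc j)))) a"
proof -
  define C where "C i = {l (Suc i)..l i}" for i
  have lS: "l (Suc i) \<le> l i" for i using is_partitionD[OF l(1)] by simp
  define E where "E c = (\<Sum>i<K. l i - c i)" for c :: "nat \<Rightarrow> nat"
  let ?D = "\<lambda>c. dt K (\<lambda>i j. f (bead u i - (int (c j) - int j)))"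
  let ?S = "dt K (\<lambda>i j. \<Sum>c\<in>C j. fps_X ^ (l j - c) * fps_const (f (bead u i - (int c - int j))))"
  have "?S = (\<Sum>c\<in>Pi\<^sub>E {..<K} C. (\<Prod>j<K. fps_X ^ (l j - c j)) * dt K (\<lambda>i j. fps_const (f (bead u i - (int (c j) - int j)))))"
    by (rule dt_multilinear_col) (simp add: C_def)
  also have "\<dots> = (\<Sum>c\<in>Pi\<^sub>E {..<K} C. fps_X ^ E c * fps_const (?D c))"
    by (simp only: dt_fps_const E_def power_sum)
  finally have S1: "fps_nth ?S a = (\<Sum>c\<in>Pi\<^sub>E {..<K} C. if E c = a then ?D c else 0)"
    by (simp only: fps_sum_nth) (intro sum.cong refl, simp add: fps_X_power_mult_nth)
  have finC: "finite (Pi\<^sub>E {..<K} C)" by (intro finite_PiE) (auto simp: C_def)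
  have "(\<Sum>c\<in>Pi\<^sub>E {..<K} C. if E c = a then ?D c else 0) = (\<Sum>c\<in>{c\<in>Pi\<^sub>E {..<K} C. E c = a}. ?D c)"
    by (rule sum.mono_neutral_cong_right) (use finC in auto)
  also have "\<dots> = (\<Sum>r\<in>hstrip_below l a. minor f r u)"
  proof (rule sum.reindex_bij_witness[of _ "\<lambda>r. restrict r {..<K}" "\<lambda>c i. if i < K then c i else 0"])
    fix c assume c: "c \<in> {c\<in>Pi\<^sub>E {..<K} C. E c = a}"
    let ?r = "\<lambda>i. if i < K then c i else 0"
    show "restrict ?r {..<K} = c" using c by (auto simp: PiE_def extensional_def)
    have ci: "l (Suc i) \<le> c i" "c i \<le> l i" if "i < K" for i using c that by (auto simp: C_def PiE_def Pi_def)
    have h: "hstrip ?r l"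
      unfolding hstrip_def
    proof (intro allI conjI)
      fix i
      show "l (Suc i) \<le> ?r i" using ci(1)[of i] partition_zero[OF l(1), of "Suc i"] l(2) by auto
      show "?r i \<le> l i" using ci(2)[of i] by auto
    qed
    have r: "is_partition ?r"
    proof (rule is_partitionI[of _ K])
      fix i have "?r (Suc i) \<le> l (Suc i)" "l (Suc i) \<le> ?r i" using h by (auto simp: hstrip_def)
      then show "?r (Suc i) \<le> ?r i" by (rule order.trans)
    qed simp
    have len: "plength ?r \<le> K" using plength_le_iff[OF r] by simp
    have "psize l = psize ?r + E c"
      using psize_diff[OF r l(1) hstrip_le[OF h] l(2)] by (simp add: E_def)
    then show "?r \<in> hstrip_below l a" using r h c by (simp add: hstrip_below_def)
    have "minor f ?r u = toep K f ?r u" by (rule minor_toep[OF f r u(1) len u(2)])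
    also have "\<dots> = ?D c" unfolding toep_def by (rule dt_cong) (simp add: bead_def)
    finally show "minor f ?r u = ?D c" .
  next
    fix r assume r: "r \<in> hstrip_below l a"
    then have r': "is_partition r" "hstrip r l" "psize l = psize r + a" by (auto simp: hstrip_below_def)
    have len: "plength r \<le> K" using plength_mono[OF r'(1) l(1) hstrip_le[OF r'(2)]] l(2) by simp
    have z: "r i = 0" if "\<not> i < K" for i using partition_zero[OF r'(1), of i] len that by simp
    then show "(\<lambda>i. if i < K then restrict r {..<K} i else 0) = r" by auto
    have E: "E r = a" using psize_diff[OF r'(1) l(1) hstrip_le[OF r'(2)] l(2)] r'(3) by (simp add: E_def)
    have "r i \<in> C i" for i using r'(2) by (auto simp: C_def hstrip_def)
    moreover have "E (restrict r {..<K}) = E r" unfolding E_def by (rule sum.cong) auto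
    ultimately show "restrict r {..<K} \<in> {c\<in>Pi\<^sub>E {..<K} C. E c = a}" using E by auto
  qed
  finally have S2: "fps_nth ?S a = (\<Sum>r\<in>hstrip_below l a. minor f r u)" using S1 by simp
  have "?S = dt K (\<lambda>i j. tailfps f (bead u i - bead l j) - w j * tailfps f (bead u i - bead l (Suc j)))"
  proof (rule dt_cong)
    fix i j
    have "(\<Sum>c\<in>C j. fps_X ^ (l j - c) * fps_const (f (bead u i - (int c - int j)))) =
        (\<Sum>d\<le>l j - l (Suc j). fps_X ^ d * fps_const (f (bead u i - bead l j + int d)))"
      by (rule sum.reindex_bij_witness[of _ "\<lambda>d. l j - d" "\<lambda>c. l j - c"])
        (use lS[of j] in \<open>auto simp: C_def bead_def of_nat_diff algebra_simps\<close>)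
    also have "\<dots> = tailfps f (bead u i - bead l j) -
        w j * tailfps f (bead u i - bead l j + int (l j - l (Suc j)) + 1)"
      unfolding tailfps_window by (simp add: w_def)
    also have "bead u i - bead l j + int (l j - l (Suc j)) + 1 = bead u i - bead l (Suc j)"
      using lS[of j] by (simp add: bead_def of_nat_diff)
    finally show "(\<Sum>c\<in>C j. fps_X ^ (l j - c) * fps_const (f (bead u i - (int c - int j)))) =
      tailfps f (bead u i - bead l j) - w j * tailfps f (bead u i - bead l (Suc j))" .
  qed
  then show ?thesis using S2 by simp
qed

text \<open>Both sides are determinants of tails. Row \<open>K\<close> of \<open>u\<close> is empty,
  so the last row of the larger matrix consists of powers of \<open>X\<close> times the series of
  \<open>f\<close>. The column operations that produce the smaller determinant also clear this row
  up to its last entry, which is that series.\<close>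

theorem hstrip_minor_commute:
  fixes f :: "int \<Rightarrow> 'a::comm_ring_1"
  assumes f: "causal f" and l: "is_partition l" and u: "is_partition u"
  shows "(\<Sum>r\<in>hstrip_above u a. minor f l r) =
    (\<Sum>b\<le>a. f (int b) * (\<Sum>r\<in>hstrip_below l (a - b). minor f r u))"
proof -
  define K where "K = max (plength l) (plength u)"
  have len: "plength l \<le> K" "plength u \<le> K" by (auto simp: K_def)
  define Phi where "Phi i j = tailfps f (bead u i - bead l j)" for i j
  define w :: "nat \<Rightarrow> 'a fps" where "w j = fps_X ^ Suc (l j - l (Suc j))" for j
  let ?B = "\<lambda>i j. Phi i j - (if Suc j < Suc K then w j * Phi i (Suc j) else 0)"
  let ?R = "dt K (\<lambda>i j. Phi i j - w j * Phi i (Suc j))"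
  have lastrow: "Phi K j = fps_X ^ (K + l j - j) * genfps f" if "j \<le> K" for j
  proof -
    have "bead u K - bead l j = - int (K + l j - j)"
      using partition_zero[OF u len(2)] that by (simp add: bead_def of_nat_diff)
    then show ?thesis using tailfps_nonpos[OF f, of "K + l j - j"] by (simp add: Phi_def)
  qed
  have "dt (Suc K) Phi = dt (Suc K) ?B" by (rule dt_col_next[symmetric])
  also have "\<dots> = ?B K K * ((-1) ^ (K + K) * dt K (\<lambda>i' j'. ?B (skip K i') (skip K j')))"
  proof (rule dt_single_row)
    fix j assume "j < Suc K" "j \<noteq> K"
    then have j: "j < K" by simp
    have "l (Suc j) \<le> l j" using is_partitionD[OF l] by simp
    then have "Suc (l j - l (Suc j)) + (K + l (Suc j) - Suc j) = K + l j - j" using j by simp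
    then show "?B K j = 0" using j
      by (simp only: lastrow w_def mult.assoc[symmetric] power_add[symmetric]) 
        (simp add: lastrow w_def mult.assoc[symmetric] flip: power_add power_Suc)
  qed auto
  also have "?B K K = genfps f" using lastrow[of K] partition_zero[OF l len(1)] by simp
  also have "dt K (\<lambda>i' j'. ?B (skip K i') (skip K j')) = ?R" by (rule dt_cong) simp
  finally have Phi: "dt (Suc K) Phi = genfps f * ?R" by (simp flip: mult_2)
  have "(\<Sum>r\<in>hstrip_above u a. minor f l r) = fps_nth (dt (Suc K) Phi) a"
    unfolding Phi_def by (rule hstrip_above_sum[OF f l len(1) u len(2)])
  also have "\<dots> = (\<Sum>b\<le>a. f (int b) * fps_nth ?R (a - b))"
    by (simp add: Phi fps_mult_nth atLeast0AtMost)
  also have "\<dots> = (\<Sum>b\<le>a. f (int b) * (\<Sum>r\<in>hstrip_below l (a - b). minor f r u))"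
    unfolding Phi_def w_def hstrip_below_sum[OF f l len(1) u len(2)] ..
  finally show ?thesis .
qed


section \<open>Fillings and chains of partitions\<close>

text \<open>The common part of semistandard, special ribbon and good proper ribbon tableaux. What
  distinguishes these is a condition on each layer of equal entries, imposed by weights on the chain
  of shapes.\<close>

definition fillings :: "(nat \<Rightarrow> nat) \<Rightarrow> (nat \<Rightarrow> nat) \<Rightarrow> nat \<Rightarrow> (nat \<times> nat \<Rightarrow> nat) set" where
  "fillings u l M = {T \<in> extensional (skew l u). rows_weakly_inc (skew l u) T \<and>
     cols_weakly_inc (skew l u) T \<and> (\<forall>b\<in>skew l u. T b < M)}"

text \<open>The inequality is strict, so that index \<open>0\<close> gives \<open>u\<close> and the
  layer from \<open>i\<close> to \<open>Suc i\<close> consists of the entries equal to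
  \<open>i\<close>.\<close>

definition shape_below :: "(nat \<Rightarrow> nat) \<Rightarrow> (nat \<Rightarrow> nat) \<Rightarrow> (nat \<times> nat \<Rightarrow> nat) \<Rightarrow> nat \<Rightarrow> nat \<Rightarrow> nat" where
  "shape_below u l T i = (\<lambda>r. u r + card {j. (r, j) \<in> skew l u \<and> T (r, j) < i})"

definition between :: "(nat \<Rightarrow> nat) \<Rightarrow> (nat \<Rightarrow> nat) \<Rightarrow> (nat \<Rightarrow> nat) set" where
  "between u l = {v. is_partition v \<and> u \<le> v \<and> v \<le> l}"

lemma finite_between: "is_partition l \<Longrightarrow> finite (between u l)"
  by (rule finite_subset[OF _ finite_partitions_below[of l]]) (auto simp: between_def)

lemma interval_of_down_closed:
  fixes S :: "nat set"
  assumes "finite S" "\<And>j. j \<in> S \<Longrightarrow> a \<le> j" "\<And>i j. j \<in> S \<Longrightarrow> a \<le> i \<Longrightarrow> i \<le> j \<Longrightarrow> i \<in> S"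
  shows "S = {a..<a + card S}"
proof -
  let ?S = "(\<lambda>j. j - a) ` S"
  have inj: "inj_on (\<lambda>j. j - a) S" using assms(2) by (auto simp: inj_on_def) (metis le_add_diff_inverse)
  have "?S = {..<card ?S}"
  proof (rule down_closed_nat_eq)
    fix i j assume "j \<in> ?S" "i \<le> j"
    then obtain k where k: "k \<in> S" "j = k - a" by auto
    then have "i + a \<in> S" using assms(2)[OF k(1)] \<open>i \<le> j\<close> by (intro assms(3)[OF k(1)]) auto
    then show "i \<in> ?S" by (intro image_eqI[of _ _ "i + a"]) auto
  qed (use assms(1) in simp)
  then have S: "?S = {..<card S}" using inj by (simp add: card_image)
  show ?thesis
  proof (intro equalityI subsetI)
    fix j assume j: "j \<in> S"
    then have "j - a \<in> {..<card S}" using S by blast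
    then show "j \<in> {a..<a + card S}" using assms(2)[OF j] by auto
  next
    fix j assume "j \<in> {a..<a + card S}"
    then have "j - a \<in> {..<card S}" by auto
    then obtain k where "k \<in> S" "j - a = k - a" using S by (metis imageE)
    then show "j \<in> S" using assms(2)[of k] \<open>j \<in> {a..<a + card S}\<close> by (metis atLeastLessThan_iff le_add_diff_inverse)
  qed
qed

context
  fixes u l :: "nat \<Rightarrow> nat" and T M
  assumes u: "is_partition u" and l: "is_partition l" and ul: "u \<le> l" and T: "T \<in> fillings u l M"
begin

lemma shape_below_row: "{j. (r, j) \<in> skew l u \<and> T (r, j) < i} = {u r..<shape_below u l T i r}"
  unfolding shape_below_def
proof (rule interval_of_down_closed)
  show "finite {j. (r, j) \<in> skew l u \<and> T (r, j) < i}"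
    by (rule finite_subset[of _ "{..<l r}"]) (auto simp: skew_def)
  fix j assume j: "j \<in> {j. (r, j) \<in> skew l u \<and> T (r, j) < i}"
  then show "u r \<le> j" by (auto simp: skew_def)
  fix j' assume j': "u r \<le> j'" "j' \<le> j"
  then have in_sk: "(r, j') \<in> skew l u" using j by (auto simp: skew_def)
  have "T (r, j') \<le> T (r, j)"
  proof (cases "j' = j")
    case False
    have "rows_weakly_inc (skew l u) T" using T by (simp add: fillings_def)
    then show ?thesis using in_sk j j' False unfolding rows_weakly_inc_def by auto
  qed simp
  then show "j' \<in> {j. (r, j) \<in> skew l u \<and> T (r, j) < i}" using in_sk j by auto
qed

lemma in_skew_shape_below: "b \<in> skew (shape_below u l T i) u \<longleftrightarrow> b \<in> skew l u \<and> T b < i"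
proof (cases b)
  case (Pair r j)
  have "j \<in> {j. (r, j) \<in> skew l u \<and> T (r, j) < i} \<longleftrightarrow> j \<in> {u r..<shape_below u l T i r}"
    by (simp only: shape_below_row)
  then show ?thesis unfolding Pair by (auto simp: skew_def)
qed

lemma shape_below_bounds: "u \<le> shape_below u l T i" "shape_below u l T i \<le> l"
proof -
  show "u \<le> shape_below u l T i" by (simp add: le_fun_def shape_below_def)
  show "shape_below u l T i \<le> l"
    unfolding le_fun_def
  proof
    fix r
    have "card {j. (r, j) \<in> skew l u \<and> T (r, j) < i} \<le> card {u r..<l r}"
      by (rule card_mono) (auto simp: skew_def)
    then show "shape_below u l T i r \<le> l r" using le_funD[OF ul, of r] by (simp add: shape_below_def)
  qed
qed

lemma shape_below_partition: "is_partition (shape_below u l T i)"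
proof (rule is_partitionI[of _ "plength l"])
  fix r
  let ?v = "shape_below u l T i"
  show "?v (Suc r) \<le> ?v r"
  proof (rule ccontr)
    assume a: "\<not> ?thesis"
    have b: "?v (Suc r) \<le> l (Suc r)" "u r \<le> ?v r" using shape_below_bounds by (auto simp: le_fun_def)
    have sk: "(r, ?v r) \<in> skew l u" "(Suc r, ?v r) \<in> skew ?v u"
      using a b is_partitionD[OF l, of r "Suc r"] is_partitionD[OF u, of r "Suc r"] by (auto simp: skew_def)
    then have sk': "(Suc r, ?v r) \<in> skew l u" "T (Suc r, ?v r) < i" using in_skew_shape_below by auto
    have "cols_weakly_inc (skew l u) T" using T by (simp add: fillings_def)
    then have "T (r, ?v r) \<le> T (Suc r, ?v r)" using sk sk' unfolding cols_weakly_inc_def by blast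
    then have "(r, ?v r) \<in> skew ?v u" using sk sk' in_skew_shape_below by auto
    then show False by (auto simp: skew_def)
  qed
next
  fix r assume "plength l \<le> r"
  then show "shape_below u l T i r = 0"
    using shape_below_bounds(2) partition_zero[OF l] by (metis le_funD le_zero_eq)
qed

lemma shape_below_step: "skew (shape_below u l T (Suc i)) (shape_below u l T i) = {b \<in> skew l u. T b = i}"
proof (rule Set.set_eqI)
  fix b :: "nat \<times> nat"
  obtain r j where b: "b = (r, j)" by (cases b)
  have "u r \<le> shape_below u l T i r" using shape_below_bounds by (auto simp: le_fun_def)
  then show "b \<in> skew (shape_below u l T (Suc i)) (shape_below u l T i) \<longleftrightarrow> b \<in> {b \<in> skew l u. T b = i}"
    using in_skew_shape_below[of b i] in_skew_shape_below[of b "Suc i"] unfolding b by (auto simp: skew_def)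
qed

lemma shape_below_mono: "i \<le> j \<Longrightarrow> shape_below u l T i \<le> shape_below u l T j"
proof (rule le_funI)
  fix r assume ij: "i \<le> j"
  have "finite {c. (r, c) \<in> skew l u \<and> T (r, c) < j}"
    by (rule finite_subset[of _ "{..<l r}"]) (auto simp: skew_def)
  then have "card {c. (r, c) \<in> skew l u \<and> T (r, c) < i} \<le> card {c. (r, c) \<in> skew l u \<and> T (r, c) < j}"
    by (rule card_mono) (use ij in auto)
  then show "shape_below u l T i r \<le> shape_below u l T j r" by (simp add: shape_below_def)
qed

lemma shape_below_top: "M \<le> i \<Longrightarrow> shape_below u l T i = l"
proof -
  assume "M \<le> i"
  then have "{j. (r, j) \<in> skew l u \<and> T (r, j) < i} = {u r..<l r}" for r
    using T by (fastforce simp: fillings_def skew_def)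
  then show ?thesis using ul by (simp add: shape_below_def le_fun_def fun_eq_iff)
qed

end

definition glue :: "nat \<Rightarrow> (nat \<Rightarrow> nat) \<Rightarrow> (nat \<Rightarrow> nat) \<Rightarrow> (nat \<Rightarrow> nat) \<Rightarrow> (nat \<times> nat \<Rightarrow> nat) \<Rightarrow> nat \<times> nat \<Rightarrow> nat" where
  "glue M u l v T b = (if b \<in> skew v u then T b else if b \<in> skew l u then M else undefined)"

lemma skew_mono: "v \<le> l \<Longrightarrow> skew v u \<subseteq> skew l u"
  by (auto simp: skew_def le_fun_def intro: less_le_trans)

lemma glue_filling:
  assumes v: "v \<in> between u l" and T: "T \<in> fillings u v M"
  shows "glue M u l v T \<in> fillings u l (Suc M)"
proof -
  have sub: "skew v u \<subseteq> skew l u" using v skew_mono by (auto simp: between_def)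
  have vp: "is_partition v" using v by (simp add: between_def)
  have lt: "T b < M" if "b \<in> skew v u" for b using T that by (simp add: fillings_def)
  have gl: "glue M u l v T b \<le> M" if "b \<in> skew l u" for b using that lt by (auto simp: glue_def less_imp_le)
  have "rows_weakly_inc (skew l u) (glue M u l v T)"
    unfolding rows_weakly_inc_def
  proof (intro allI impI, elim conjE)
    fix i j j' assume b: "(i, j) \<in> skew l u" "(i, j') \<in> skew l u" "j < j'"
    show "glue M u l v T (i, j) \<le> glue M u l v T (i, j')"
    proof (cases "(i, j') \<in> skew v u")
      case True
      then have "(i, j) \<in> skew v u" using b by (auto simp: skew_def)
      then show ?thesis using True T b unfolding fillings_def rows_weakly_inc_def glue_def by auto
    next
      case False
      then show ?thesis using gl[OF b(1)] b by (simp add: glue_def)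
    qed
  qed
  moreover have "cols_weakly_inc (skew l u) (glue M u l v T)"
    unfolding cols_weakly_inc_def
  proof (intro allI impI, elim conjE)
    fix i i' j assume b: "(i, j) \<in> skew l u" "(i', j) \<in> skew l u" "i < i'"
    show "glue M u l v T (i, j) \<le> glue M u l v T (i', j)"
    proof (cases "(i', j) \<in> skew v u")
      case True
      then have "(i, j) \<in> skew v u" using b is_partitionD[OF vp, of i i'] by (auto simp: skew_def)
      then show ?thesis using True T b unfolding fillings_def cols_weakly_inc_def glue_def by auto
    next
      case False
      then show ?thesis using gl[OF b(1)] b by (simp add: glue_def)
    qed
  qed
  moreover have "glue M u l v T \<in> extensional (skew l u)" using sub by (auto simp: glue_def extensional_def)
  ultimately show ?thesis using gl by (auto simp: fillings_def less_Suc_eq_le)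
qed

lemma shape_below_glue:
  assumes v: "v \<in> between u l" and T: "T \<in> fillings u v M" and i: "i \<le> M"
  shows "shape_below u l (glue M u l v T) i = shape_below u v T i"
proof -
  have "(r, j) \<in> skew l u \<and> glue M u l v T (r, j) < i \<longleftrightarrow> (r, j) \<in> skew v u \<and> T (r, j) < i" for r j
    using v skew_mono[of v l u] i by (auto simp: glue_def between_def)
  then show ?thesis by (simp add: shape_below_def)
qed

lemma finite_fillings:
  assumes "is_partition l" shows "finite (fillings u l M)"
proof (rule finite_subset)
  show "fillings u l M \<subseteq> Pi\<^sub>E (skew l u) (\<lambda>_. {..<M})" by (auto simp: fillings_def PiE_def)
  show "finite (Pi\<^sub>E (skew l u) (\<lambda>_. {..<M}))" using finite_skew[OF assms] by (intro finite_PiE) auto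
qed

text \<open>A filling amounts to the shape of its entries below \<open>M\<close>, which may be any
  partition between \<open>u\<close> and \<open>l\<close>, and its restriction to that
  shape.\<close>

lemma sum_fillings_peel:
  assumes u: "is_partition u" and l: "is_partition l" and ul: "u \<le> l"
  shows "(\<Sum>T\<in>fillings u l (Suc M). g T) = (\<Sum>v\<in>between u l. \<Sum>T\<in>fillings u v M. g (glue M u l v T))"
proof -
  have "(\<Sum>v\<in>between u l. \<Sum>T\<in>fillings u v M. g (glue M u l v T)) =
      (\<Sum>(v, T)\<in>Sigma (between u l) (\<lambda>v. fillings u v M). g (glue M u l v T))"
    using finite_between[OF l] finite_fillings by (intro sum.Sigma) (auto simp: between_def)
  also have "\<dots> = (\<Sum>T\<in>fillings u l (Suc M). g T)"
  proof (rule sum.reindex_bij_witness[of _ "\<lambda>T. (shape_below u l T M, restrict T (skew (shape_below u l T M) u))"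
        "\<lambda>(v, T). glue M u l v T"])
    fix vT assume "vT \<in> Sigma (between u l) (\<lambda>v. fillings u v M)"
    then obtain v T where vT: "vT = (v, T)" "v \<in> between u l" "T \<in> fillings u v M" by auto
    have v: "is_partition v" "u \<le> v" using vT by (auto simp: between_def)
    have s: "shape_below u l (glue M u l v T) M = v"
      using shape_below_glue[OF vT(2,3) order_refl] shape_below_top[OF u v(1,2) vT(3) order_refl] by simp
    moreover have "restrict (glue M u l v T) (skew v u) = T"
      using vT(3) by (auto simp: fillings_def extensional_def restrict_def glue_def)
    ultimately show "(shape_below u l (case vT of (v, T) \<Rightarrow> glue M u l v T) M,
        restrict (case vT of (v, T) \<Rightarrow> glue M u l v T)
          (skew (shape_below u l (case vT of (v, T) \<Rightarrow> glue M u l v T) M) u)) = vT"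
      by (simp add: vT(1))
    show "(case vT of (v, T) \<Rightarrow> glue M u l v T) \<in> fillings u l (Suc M)"
      using glue_filling[OF vT(2,3)] by (simp add: vT(1))
    show "g (case vT of (v, T) \<Rightarrow> glue M u l v T) = (case vT of (v, T) \<Rightarrow> g (glue M u l v T))"
      by (simp add: vT(1))
  next
    fix T assume T: "T \<in> fillings u l (Suc M)"
    let ?v = "shape_below u l T M"
    note in_sk = in_skew_shape_below[OF u l ul T, of _ M]
    have "?v \<in> between u l"
      using shape_below_bounds[OF u l ul T] shape_below_partition[OF u l ul T] by (simp add: between_def)
    moreover have "restrict T (skew ?v u) \<in> fillings u ?v M"
      using T in_sk unfolding fillings_def rows_weakly_inc_def cols_weakly_inc_def by auto
    ultimately show "(?v, restrict T (skew ?v u)) \<in> Sigma (between u l) (\<lambda>v. fillings u v M)" by simp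
    show "(case (?v, restrict T (skew ?v u)) of (v, T) \<Rightarrow> glue M u l v T) = T"
    proof
      fix b
      show "(case (?v, restrict T (skew ?v u)) of (v, T) \<Rightarrow> glue M u l v T) b = T b"
        using in_sk[of b] T extensional_arb[of T "skew l u" b] by (auto simp: glue_def fillings_def less_Suc_eq)
    qed
  qed
  finally show ?thesis ..
qed

text \<open>An entry of the product of the transfer matrices \<open>w 0, ..., w (M - 1)\<close>,
  restricted to pairs ordered by containment.\<close>

primrec path_sum :: "(nat \<Rightarrow> (nat \<Rightarrow> nat) \<Rightarrow> (nat \<Rightarrow> nat) \<Rightarrow> 'a::comm_ring_1) \<Rightarrow> nat \<Rightarrow>
    (nat \<Rightarrow> nat) \<Rightarrow> (nat \<Rightarrow> nat) \<Rightarrow> 'a" where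
  "path_sum w 0 u l = of_bool (u = l)"
| "path_sum w (Suc M) u l = (\<Sum>v\<in>between u l. path_sum w M u v * w M v l)"

lemma path_sum_zero: "\<not> u \<le> l \<Longrightarrow> path_sum w M u l = 0"
  by (cases M) (auto simp: between_def intro!: sum.neutral)

lemma path_sum_cong:
  assumes "\<And>i v v'. i < M \<Longrightarrow> is_partition v \<Longrightarrow> v \<le> v' \<Longrightarrow> w i v v' = w' i v v'"
  shows "path_sum w M u l = path_sum w' M u l"
  using assms
proof (induction M arbitrary: l)
  case (Suc M)
  then show ?case by (auto simp: between_def intro!: sum.cong)
qed simp

theorem sum_fillings_path_sum:
  assumes u: "is_partition u" and l: "is_partition l" and ul: "u \<le> l"
  shows "(\<Sum>T\<in>fillings u l M. \<Prod>i<M. w i (shape_below u l T i) (shape_below u l T (Suc i))) = path_sum w M u l"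
  using l ul
proof (induction M arbitrary: l)
  case 0
  have "fillings u l 0 = (if u = l then {\<lambda>_. undefined} else {})"
  proof (cases "u = l")
    case True
    then show ?thesis by (auto simp: fillings_def skew_def extensional_def rows_weakly_inc_def cols_weakly_inc_def)
  next
    case False
    then show ?thesis using skew_empty_iff[OF 0(2)] by (auto simp: fillings_def)
  qed
  then show ?case by simp
next
  case (Suc M)
  have "(\<Sum>T\<in>fillings u l (Suc M). \<Prod>i<Suc M. w i (shape_below u l T i) (shape_below u l T (Suc i))) =
      (\<Sum>v\<in>between u l. \<Sum>T\<in>fillings u v M. \<Prod>i<Suc M. w i (shape_below u l (glue M u l v T) i)
        (shape_below u l (glue M u l v T) (Suc i)))"
    by (rule sum_fillings_peel[OF u Suc.prems])
  also have "\<dots> = (\<Sum>v\<in>between u l. \<Sum>T\<in>fillings u v M. 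
      (\<Prod>i<M. w i (shape_below u v T i) (shape_below u v T (Suc i))) * w M v l)"
  proof (intro sum.cong refl)
    fix v T assume v: "v \<in> between u l" and T: "T \<in> fillings u v M"
    then have vp: "is_partition v" "u \<le> v" by (auto simp: between_def)
    have "shape_below u l (glue M u l v T) (Suc M) = l"
      by (rule shape_below_top[OF u Suc.prems glue_filling[OF v T] order_refl])
    moreover have "shape_below u l (glue M u l v T) M = v"
      using shape_below_glue[OF v T order_refl] shape_below_top[OF u vp T order_refl] by simp
    moreover have "(\<Prod>i<M. w i (shape_below u l (glue M u l v T) i) (shape_below u l (glue M u l v T) (Suc i))) =
        (\<Prod>i<M. w i (shape_below u v T i) (shape_below u v T (Suc i)))"
      by (intro prod.cong refl) (simp add: shape_below_glue[OF v T])
    ultimately show "(\<Prod>i<Suc M. w i (shape_below u l (glue M u l v T) i) (shape_below u l (glue M u l v T) (Suc i))) =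
        (\<Prod>i<M. w i (shape_below u v T i) (shape_below u v T (Suc i))) * w M v l" by simp
  qed
  also have "\<dots> = (\<Sum>v\<in>between u l. path_sum w M u v * w M v l)"
    unfolding sum_distrib_right[symmetric]
    by (intro sum.cong refl) (simp add: Suc.IH between_def)
  finally show ?case by simp
qed

section \<open>Coefficients of skew Schur functions\<close>

definition content :: "(nat \<times> nat) set \<Rightarrow> (nat \<times> nat \<Rightarrow> nat) \<Rightarrow> nat \<Rightarrow>\<^sub>0 nat" where
  "content B T = (\<Sum>b\<in>B. Poly_Mapping.single (T b) 1)"

lemma lookup_content:
  assumes "finite B" shows "Poly_Mapping.lookup (content B T) i = card {b \<in> B. T b = i}"
proof -
  have "Poly_Mapping.lookup (content B T) i = (\<Sum>b\<in>B. if T b = i then 1 else 0)"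
    unfolding content_def lookup_sum by (intro sum.cong) (auto simp: lookup_single when_def)
  also have "\<dots> = (\<Sum>b\<in>{b \<in> B. T b = i}. 1)"
    by (rule sum.mono_neutral_cong_right) (use assms in auto)
  finally show ?thesis by simp
qed

lemma mdeg_zero [simp]: "mdeg 0 = 0"
  by (simp add: mdeg_def)

lemma mdeg_single [simp]: "mdeg (Poly_Mapping.single i n) = n"
  by (simp add: mdeg_def)

lemma mdeg_content: "finite B \<Longrightarrow> mdeg (content B T) = card B"
  unfolding content_def by (induction B rule: finite_induct) (auto simp: mdeg_add)

lemma mdeg_eq_sum:
  assumes "Poly_Mapping.keys a \<subseteq> {..<N}" shows "mdeg a = (\<Sum>i<N. Poly_Mapping.lookup a i)"
  unfolding mdeg_def by (rule sum.mono_neutral_left) (use assms in \<open>auto simp: in_keys_iff\<close>)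

lemma mcoeff_schur_degree:
  assumes "is_partition l" "mcoeff (schur l u) a \<noteq> 0"
  shows "mdeg a = card (skew l u)"
proof -
  have "{T \<in> ssyt (skew l u). content (skew l u) T = a} \<noteq> {}"
    using assms(2) unfolding schur_def mcoeff_MPS content_def by (metis card.empty of_nat_0)
  then show ?thesis using mdeg_content finite_skew[OF assms(1)] by blast
qed

abbreviation strip_weight :: "(nat \<Rightarrow> nat) \<Rightarrow> nat \<Rightarrow> (nat \<Rightarrow> nat) \<Rightarrow> (nat \<Rightarrow> nat) \<Rightarrow> int" where
  "strip_weight a i v v' \<equiv> of_bool (hstrip v v' \<and> psize v' = psize v + a i)"

text \<open>The boxes with a given entry of a semistandard tableau form a horizontal strip.
  Conversely, equal entries in a column would lie in one layer, so strips force strict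
  columns.\<close>

lemma mcoeff_schur:
  assumes u: "is_partition u" and l: "is_partition l" and ul: "u \<le> l"
    and a: "Poly_Mapping.keys a \<subseteq> {..<N}"
  shows "mcoeff (schur l u) a = path_sum (strip_weight (Poly_Mapping.lookup a)) N u l"
proof -
  let ?B = "skew l u"
  let ?ok = "\<lambda>T i. hstrip (shape_below u l T i) (shape_below u l T (Suc i)) \<and>
      psize (shape_below u l T (Suc i)) = psize (shape_below u l T i) + Poly_Mapping.lookup a i"
  have fin: "finite ?B" by (rule finite_skew[OF l])
  have "{T \<in> ssyt ?B. content ?B T = a} = {T \<in> fillings u l N. \<forall>i<N. ?ok T i}"
  proof (intro equalityI subsetI)
    fix T assume T: "T \<in> {T \<in> ssyt ?B. content ?B T = a}"
    have "T b < N" if "b \<in> ?B" for b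
    proof -
      have "b \<in> {b' \<in> ?B. T b' = T b}" using that by simp
      moreover have "finite {b' \<in> ?B. T b' = T b}" using fin by simp
      ultimately have "0 < card {b' \<in> ?B. T b' = T b}" using card_gt_0_iff by blast
      then have "T b \<in> Poly_Mapping.keys a" using T lookup_content[OF fin, of T "T b"] by (auto simp: in_keys_iff)
      then show ?thesis using a by auto
    qed
    then have F: "T \<in> fillings u l N"
      using T by (auto simp: ssyt_def fillings_def cols_strictly_inc_def cols_weakly_inc_def less_imp_le)
    have "?ok T i" for i
    proof -
      let ?v = "shape_below u l T i" and ?v' = "shape_below u l T (Suc i)"
      have p: "is_partition ?v" "is_partition ?v'" "?v \<le> ?v'"
        using shape_below_partition[OF u l ul F] shape_below_mono[OF u l ul F, of i "Suc i"] by auto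
      have st: "skew ?v' ?v = {b \<in> ?B. T b = i}" by (rule shape_below_step[OF u l ul F])
      have cs: "\<And>i i' j. (i, j) \<in> ?B \<Longrightarrow> (i', j) \<in> ?B \<Longrightarrow> i < i' \<Longrightarrow> T (i, j) < T (i', j)"
        using T by (auto simp: ssyt_def cols_strictly_inc_def)
      have "horizontal_strip ?v' ?v"
        unfolding horizontal_strip_def st
      proof (intro ballI impI)
        fix b c assume bc: "b \<in> {b \<in> ?B. T b = i}" "c \<in> {b \<in> ?B. T b = i}" "snd b = snd c"
        obtain x y x' where "b = (x, y)" "c = (x', y)" using bc(3) by (metis prod.collapse)
        then show "b = c" using bc cs[of x y x'] cs[of x' y x]
          by (cases x x' rule: linorder_cases) auto
      qed
      moreover have "card (skew ?v' ?v) = Poly_Mapping.lookup a i"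
        using T lookup_content[OF fin, of T i] by (auto simp: st)
      ultimately show ?thesis
        using horizontal_strip_iff_hstrip[OF p] card_skew[OF p(2,1,3)] by simp
    qed
    then show "T \<in> {T \<in> fillings u l N. \<forall>i<N. ?ok T i}" using F by simp
  next
    fix T assume "T \<in> {T \<in> fillings u l N. \<forall>i<N. ?ok T i}"
    then have F: "T \<in> fillings u l N" and ok: "\<And>i. i < N \<Longrightarrow> ?ok T i" by auto
    have p: "is_partition (shape_below u l T i)" for i by (rule shape_below_partition[OF u l ul F])
    have m: "shape_below u l T i \<le> shape_below u l T (Suc i)" for i by (rule shape_below_mono[OF u l ul F]) simp
    have st: "skew (shape_below u l T (Suc i)) (shape_below u l T i) = {b \<in> ?B. T b = i}" for i
      by (rule shape_below_step[OF u l ul F])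
    have TN: "T b < N" if "b \<in> ?B" for b using F that by (simp add: fillings_def)
    have "cols_strictly_inc ?B T"
      unfolding cols_strictly_inc_def
    proof (intro allI impI, elim conjE)
      fix i i' j assume b: "(i, j) \<in> ?B" "(i', j) \<in> ?B" "i < i'"
      have "T (i, j) \<le> T (i', j)" using F b by (auto simp: fillings_def cols_weakly_inc_def)
      moreover have "T (i, j) \<noteq> T (i', j)"
      proof
        assume eq: "T (i, j) = T (i', j)"
        have "horizontal_strip (shape_below u l T (Suc (T (i, j)))) (shape_below u l T (T (i, j)))"
          using ok[OF TN[OF b(1)]] horizontal_strip_iff_hstrip[OF p p m] by simp
        then show False unfolding horizontal_strip_def st using b eq by fastforce
      qed
      ultimately show "T (i, j) < T (i', j)" by simp
    qed
    moreover have "content ?B T = a"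
    proof (rule poly_mapping_eqI)
      fix i
      show "Poly_Mapping.lookup (content ?B T) i = Poly_Mapping.lookup a i"
      proof (cases "i < N")
        case True
        then show ?thesis using ok[OF True] card_skew[OF p p m, of i] unfolding lookup_content[OF fin] st by simp
      next
        case False
        then have e: "{b \<in> ?B. T b = i} = {}" using TN by auto
        have "i \<notin> Poly_Mapping.keys a" using a False by auto
        then show ?thesis unfolding lookup_content[OF fin] e by (simp add: in_keys_iff)
      qed
    qed
    ultimately show "T \<in> {T \<in> ssyt ?B. content ?B T = a}" using F by (simp add: ssyt_def fillings_def)
  qed
  then have "mcoeff (schur l u) a = int (card {T \<in> fillings u l N. \<forall>i<N. ?ok T i})"
    by (simp add: schur_def content_def)
  also have "\<dots> = (\<Sum>T\<in>fillings u l N. of_bool (\<forall>i<N. ?ok T i))"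
    using finite_fillings[OF l] by (simp add: of_bool_def sum.If_cases Int_def)
  also have "\<dots> = (\<Sum>T\<in>fillings u l N. \<Prod>i<N. of_bool (?ok T i))"
  proof (intro sum.cong refl)
    fix T
    show "of_bool (\<forall>i<N. ?ok T i) = (\<Prod>i<N. of_bool (?ok T i) :: int)"
    proof (cases "\<forall>i<N. ?ok T i")
      case False
      then have "\<exists>i\<in>{..<N}. of_bool (?ok T i) = (0 :: int)" by auto
      then have "(\<Prod>i<N. of_bool (?ok T i) :: int) = 0" by (intro prod_zero) auto
      then show ?thesis using False by simp
    qed simp
  qed
  also have "\<dots> = path_sum (strip_weight (Poly_Mapping.lookup a)) N u l"
    by (rule sum_fillings_path_sum[OF u l ul])
  finally show ?thesis .
qed

lemma finite_hs_below: "is_partition l \<Longrightarrow> finite (hstrip_below l a)"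
  by (rule finite_subset[OF _ finite_partitions_below[of l]]) (auto simp: hstrip_below_def hstrip_le)

lemma finite_hs_above: "finite (hstrip_above u a)"
  by (rule finite_subset[OF _ finite_partitions_bounded[of "psize u + a"]]) (auto simp: hstrip_above_def)

text \<open>The range becomes all strips inside \<open>l\<close>, as in the commutation rule;
  partitions that do not contain \<open>u\<close> contribute zero.\<close>

lemma path_sum_strip_Suc:
  assumes "is_partition l"
  shows "path_sum (strip_weight a) (Suc N) u l = (\<Sum>v\<in>hstrip_below l (a N). path_sum (strip_weight a) N u v)"
proof -
  have "(\<Sum>v\<in>hstrip_below l (a N). path_sum (strip_weight a) N u v) =
      (\<Sum>v\<in>{v \<in> between u l. hstrip v l \<and> psize l = psize v + a N}. path_sum (strip_weight a) N u v)"
  proof (rule sum.mono_neutral_right[OF finite_hs_below[OF assms]])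
    show "\<forall>v\<in>hstrip_below l (a N) - {v \<in> between u l. hstrip v l \<and> psize l = psize v + a N}.
        path_sum (strip_weight a) N u v = 0"
    proof
      fix v assume "v \<in> hstrip_below l (a N) - {v \<in> between u l. hstrip v l \<and> psize l = psize v + a N}"
      then have "\<not> u \<le> v" using hstrip_le[of v l] by (auto simp: hstrip_below_def between_def)
      then show "path_sum (strip_weight a) N u v = 0" by (rule path_sum_zero)
    qed
  qed (auto simp: hstrip_below_def between_def)
  also have "\<dots> = (\<Sum>v\<in>between u l. path_sum (strip_weight a) N u v * of_bool (hstrip v l \<and> psize l = psize v + a N))"
    by (rule sum.mono_neutral_cong_left) (use finite_between[OF assms] in auto)
  finally show ?thesis by simp
qed


section \<open>Multiplication of skew Schur functions\<close>

lemma mcoeff_mult: "mcoeff (f * g) a = (\<Sum>(b, c) | b + c = a. mcoeff f b * mcoeff g c)"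
  by (simp add: times_mps_def)

lemma mcoeff_1: "mcoeff 1 a = (if a = 0 then 1 else 0)"
  by (simp add: one_mps_def)

lemma mcoeff_diff: "mcoeff (f - g) a = mcoeff f a - mcoeff g a"
  by (simp add: minus_mps_def)

lemma mcoeff_of_int: "mcoeff (of_int c * f) a = c * mcoeff f a"
  by (induction c rule: int_induct[of _ 0]) (simp_all add: distrib_right left_diff_distrib mcoeff_diff)

lemma keys_add_nat: "Poly_Mapping.keys (b + c :: nat \<Rightarrow>\<^sub>0 nat) = Poly_Mapping.keys b \<union> Poly_Mapping.keys c"
  by (auto simp: in_keys_iff lookup_add)

text \<open>Separates the exponent \<open>n\<close> of variable \<open>N\<close> in a convolution,
  so that a product can be treated one variable at a time.\<close>

lemma sum_splits_last:
  fixes a a' :: "nat \<Rightarrow>\<^sub>0 nat" and h :: "_ \<Rightarrow> _ \<Rightarrow> 'a::comm_monoid_add"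
  assumes n_def: "n = Poly_Mapping.lookup a N" and a'_def: "a' = a - Poly_Mapping.single N n"
  shows "(\<Sum>(b, c) | b + c = a. h b c) =
    (\<Sum>d\<le>n. \<Sum>(b, c) | b + c = a'. h (b + Poly_Mapping.single N d) (c + Poly_Mapping.single N (n - d)))"
proof -
  let ?s = "Poly_Mapping.single N"
  have lka: "Poly_Mapping.lookup a' i = (if i = N then 0 else Poly_Mapping.lookup a i)" for i
    by (auto simp: a'_def n_def lookup_minus lookup_single when_def)
  have zero: "Poly_Mapping.lookup b N = 0" "Poly_Mapping.lookup c N = 0" if "b + c = a'" for b c
    using arg_cong[OF that, of "\<lambda>p. Poly_Mapping.lookup p N"] lka by (auto simp: lookup_add)
  have "(\<Sum>d\<le>n. \<Sum>(b, c) | b + c = a'. h (b + ?s d) (c + ?s (n - d))) =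
      (\<Sum>(d, b, c)\<in>{..n} \<times> {(b, c). b + c = a'}. h (b + ?s d) (c + ?s (n - d)))"
    by (simp only: sum.cartesian_product split_def prod.collapse)
  also have "\<dots> = (\<Sum>(b, c) | b + c = a. h b c)"
  proof (rule sum.reindex_bij_witness[of _
        "\<lambda>(b, c). (Poly_Mapping.lookup b N, b - ?s (Poly_Mapping.lookup b N), c - ?s (Poly_Mapping.lookup c N))"
        "\<lambda>(d, b, c). (b + ?s d, c + ?s (n - d))"])
    fix x assume "x \<in> {..n} \<times> {(b, c). b + c = a'}"
    then obtain d b c where x: "x = (d, b, c)" "d \<le> n" "b + c = a'" by auto
    have "?s d + ?s (n - d) = ?s n" using x(2) by (simp flip: single_add)
    then have "b + ?s d + (c + ?s (n - d)) = a' + ?s n" by (simp add: x(3)[symmetric] ac_simps)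
    also have "\<dots> = a"
      by (rule poly_mapping_eqI) (auto simp: lookup_add lka lookup_single when_def n_def)
    finally show "(case x of (d, b, c) \<Rightarrow> (b + ?s d, c + ?s (n - d))) \<in> {(b, c). b + c = a}" by (simp add: x(1))
    show "(case case x of (d, b, c) \<Rightarrow> (b + ?s d, c + ?s (n - d)) of
        (b, c) \<Rightarrow> (Poly_Mapping.lookup b N, b - ?s (Poly_Mapping.lookup b N), c - ?s (Poly_Mapping.lookup c N))) = x"
      using zero[OF x(3)] by (simp add: x(1) lookup_add)
    show "(case case x of (d, b, c) \<Rightarrow> (b + ?s d, c + ?s (n - d)) of (b, c) \<Rightarrow> h b c) =
        (case x of (d, b, c) \<Rightarrow> h (b + ?s d) (c + ?s (n - d)))" by (simp add: x(1))
  next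
    fix x assume "x \<in> {(b, c). b + c = a}"
    then obtain b c where x: "x = (b, c)" "b + c = a" by auto
    have n: "n = Poly_Mapping.lookup b N + Poly_Mapping.lookup c N"
      using x(2) by (auto simp: n_def lookup_add)
    have "b - ?s (Poly_Mapping.lookup b N) + (c - ?s (Poly_Mapping.lookup c N)) = a'"
      by (rule poly_mapping_eqI) (auto simp: lka lookup_add lookup_minus lookup_single when_def x(2)[symmetric])
    then show "(case x of (b, c) \<Rightarrow> (Poly_Mapping.lookup b N, b - ?s (Poly_Mapping.lookup b N), c - ?s (Poly_Mapping.lookup c N)))
        \<in> {..n} \<times> {(b, c). b + c = a'}" using n by (simp add: x(1))
    have "p - ?s (Poly_Mapping.lookup p N) + ?s (Poly_Mapping.lookup p N) = p" for p :: "nat \<Rightarrow>\<^sub>0 nat"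
      by (rule poly_mapping_eqI) (auto simp: lookup_add lookup_minus lookup_single when_def)
    then show "(case case x of (b, c) \<Rightarrow> (Poly_Mapping.lookup b N, b - ?s (Poly_Mapping.lookup b N), c - ?s (Poly_Mapping.lookup c N)) of
        (d, b, c) \<Rightarrow> (b + ?s d, c + ?s (n - d))) = x" using n by (simp add: x(1))
  qed
  finally show ?thesis ..
qed

text \<open>The product of \<open>f(x_i)\<close> over all variables. A variable with exponent
  \<open>0\<close> would contribute \<open>f 0\<close>, which is 1 for causal
  \<open>f\<close>.\<close>

definition weight_series :: "(int \<Rightarrow> int) \<Rightarrow> mps" where
  "weight_series f = MPS (\<lambda>a. \<Prod>i\<in>Poly_Mapping.keys a. f (int (Poly_Mapping.lookup a i)))"

definition weight_form :: "nat \<Rightarrow> (int \<Rightarrow> int) \<Rightarrow> mps" where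
  "weight_form m f = MPS (\<lambda>a. if mdeg a = m then mcoeff (weight_series f) a else 0)"

lemma mcoeff_weight_series:
  assumes "causal f" "Poly_Mapping.keys a \<subseteq> {..<N}"
  shows "mcoeff (weight_series f) a = (\<Prod>i<N. f (int (Poly_Mapping.lookup a i)))"
  unfolding weight_series_def mcoeff_MPS
  by (rule prod.mono_neutral_left) (use assms in \<open>auto simp: in_keys_iff causal_def\<close>)

text \<open>Coefficient extraction in \<open>weight_series f * schur l u\<close>, one variable at a time
  (see \<open>strip_series_eq\<close>).\<close>

primrec strip_series :: "(int \<Rightarrow> int) \<Rightarrow> (nat \<Rightarrow> nat) \<Rightarrow> nat \<Rightarrow> (nat \<Rightarrow> nat) \<Rightarrow> (nat \<Rightarrow> nat) \<Rightarrow> int" where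
  "strip_series f a 0 u l = of_bool (u = l)"
| "strip_series f a (Suc N) u l =
    (\<Sum>b\<le>a N. f (int b) * (\<Sum>v\<in>hstrip_below l (a N - b). strip_series f a N u v))"

lemma strip_series_cong:
  "(\<And>i. i < N \<Longrightarrow> a i = a' i) \<Longrightarrow> strip_series f a N u l = strip_series f a' N u l"
  by (induction N arbitrary: l) auto

text \<open>The right-hand side tests containment because \<open>schur l u\<close> need not vanish
  without it: \<open>skew l u\<close> is still a set of boxes, possibly empty.\<close>

lemma strip_series_eq:
  assumes f: "causal f" and u: "is_partition u"
  shows "is_partition l \<Longrightarrow> Poly_Mapping.keys a \<subseteq> {..<N} \<Longrightarrow>
    strip_series f (Poly_Mapping.lookup a) N u l = (if u \<le> l then mcoeff (weight_series f * schur l u) a else 0)"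
proof (induction N arbitrary: a l)
  case 0
  then have a: "a = 0" by simp
  have "{(b, c). b + c = (0 :: nat \<Rightarrow>\<^sub>0 nat)} = {(0, 0)}"
  proof -
    have "b + c = 0 \<longleftrightarrow> b = 0 \<and> c = 0" for b c :: "nat \<Rightarrow>\<^sub>0 nat"
    proof
      assume bc: "b + c = 0"
      have "Poly_Mapping.lookup b i + Poly_Mapping.lookup c i = 0" for i
        using arg_cong[OF bc, of "\<lambda>p. Poly_Mapping.lookup p i"] by (simp add: lookup_add)
      then show "b = 0 \<and> c = 0" by (auto intro!: poly_mapping_eqI)
    qed simp
    then show ?thesis by auto
  qed
  then have "mcoeff (weight_series f * schur l u) a = mcoeff (schur l u) a"
    by (simp add: mcoeff_mult a weight_series_def)
  then show ?case using mcoeff_schur[OF u 0(1) _ 0(2)] by auto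
next
  case (Suc N)
  define n where "n = Poly_Mapping.lookup a N"
  define a' where "a' = a - Poly_Mapping.single N n"
  let ?s = "Poly_Mapping.single N"
  have lka: "Poly_Mapping.lookup a' i = (if i = N then 0 else Poly_Mapping.lookup a i)" for i
    by (auto simp: a'_def n_def lookup_minus lookup_single when_def)
  have ka': "Poly_Mapping.keys a' \<subseteq> {..<N}"
  proof
    fix i assume "i \<in> Poly_Mapping.keys a'"
    then have "i \<in> Poly_Mapping.keys a" "i \<noteq> N" using lka[of i] by (auto simp: in_keys_iff split: if_splits)
    then show "i \<in> {..<N}" using Suc.prems(2) by (auto simp: less_Suc_eq)
  qed
  have cf: "strip_series f (Poly_Mapping.lookup a) N u v = (if u \<le> v then mcoeff (weight_series f * schur v u) a' else 0)"
    if "is_partition v" for v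
  proof -
    have "strip_series f (Poly_Mapping.lookup a) N u v = strip_series f (Poly_Mapping.lookup a') N u v"
      by (rule strip_series_cong) (simp add: lka)
    then show ?thesis using Suc.IH[OF that ka'] by simp
  qed
  show ?case
  proof (cases "u \<le> l")
    case False
    have "strip_series f (Poly_Mapping.lookup a) N u v = 0" if "v \<in> hstrip_below l b" for v b
      using that cf[of v] False hstrip_le[of v l] by (auto simp: hstrip_below_def)
    then show ?thesis using False by (auto intro!: sum.neutral)
  next
    case True
    have "mcoeff (weight_series f * schur l u) a =
      (\<Sum>d\<le>n. \<Sum>(b, c) | b + c = a'. mcoeff (weight_series f) (b + ?s d) * mcoeff (schur l u) (c + ?s (n - d)))"
      unfolding mcoeff_mult by (rule sum_splits_last[OF n_def a'_def])
    also have "\<dots> = (\<Sum>d\<le>n. \<Sum>(b, c) | b + c = a'. f (int d) * 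
        (\<Sum>v\<in>hstrip_below l (n - d). mcoeff (weight_series f) b * (if u \<le> v then mcoeff (schur v u) c else 0)))"
    proof (intro sum.cong refl, clarify)
      fix d b c assume bc: "a' = b + c"
      have kb: "Poly_Mapping.keys b \<subseteq> {..<N}" "Poly_Mapping.keys c \<subseteq> {..<N}"
        using ka' unfolding bc by (auto simp: keys_add_nat)
      have kb': "Poly_Mapping.keys (b + ?s d) \<subseteq> {..<Suc N}" "Poly_Mapping.keys (c + ?s (n - d)) \<subseteq> {..<Suc N}"
        using kb by (auto simp: keys_add_nat split: if_splits)
      have N0: "Poly_Mapping.lookup b N = 0" "Poly_Mapping.lookup c N = 0"
        using kb by (auto simp: in_keys_iff subset_iff)
      have 1: "mcoeff (weight_series f) (b + ?s d) = mcoeff (weight_series f) b * f (int d)"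
        unfolding mcoeff_weight_series[OF f kb'(1)] mcoeff_weight_series[OF f kb(1)]
        using N0 by (simp add: lookup_add lookup_single when_def)
      \<comment> \<open>Setting variable \<open>N\<close> aside removes the last horizontal strip,
        which has \<open>n - d\<close> boxes.\<close>
      have 2: "mcoeff (schur l u) (c + ?s (n - d)) =
          (\<Sum>v\<in>hstrip_below l (n - d). if u \<le> v then mcoeff (schur v u) c else 0)"
      proof -
        let ?c = "Poly_Mapping.lookup (c + ?s (n - d))"
        have "mcoeff (schur l u) (c + ?s (n - d)) = (\<Sum>v\<in>hstrip_below l (?c N). path_sum (strip_weight ?c) N u v)"
          unfolding mcoeff_schur[OF u Suc.prems(1) True kb'(2)] path_sum_strip_Suc[OF Suc.prems(1)] ..
        also have "?c N = n - d" using N0 by (simp add: lookup_add)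
        also have "(\<Sum>v\<in>hstrip_below l (n - d). path_sum (strip_weight ?c) N u v) =
            (\<Sum>v\<in>hstrip_below l (n - d). if u \<le> v then mcoeff (schur v u) c else 0)"
        proof (rule sum.cong[OF refl])
          fix v assume "v \<in> hstrip_below l (n - d)"
          then have v: "is_partition v" by (simp add: hstrip_below_def)
          have "path_sum (strip_weight ?c) N u v = path_sum (strip_weight (Poly_Mapping.lookup c)) N u v"
            by (rule path_sum_cong) (simp add: lookup_add lookup_single when_def)
          then show "path_sum (strip_weight ?c) N u v = (if u \<le> v then mcoeff (schur v u) c else 0)"
            using mcoeff_schur[OF u v _ kb(2)] path_sum_zero by auto
        qed
        finally show ?thesis .
      qed
      show "mcoeff (weight_series f) (b + ?s d) * mcoeff (schur l u) (c + ?s (n - d)) =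
          f (int d) * (\<Sum>v\<in>hstrip_below l (n - d). mcoeff (weight_series f) b * (if u \<le> v then mcoeff (schur v u) c else 0))"
        unfolding 1 2 sum_distrib_left[symmetric] by (simp add: mult_ac)
    qed
    also have "\<dots> = (\<Sum>d\<le>n. f (int d) * (\<Sum>v\<in>hstrip_below l (n - d). if u \<le> v then mcoeff (weight_series f * schur v u) a' else 0))"
    proof (rule sum.cong[OF refl])
      fix d
      let ?G = "\<lambda>v b c. mcoeff (weight_series f) b * (if u \<le> v then mcoeff (schur v u) c else 0)"
      have "(\<Sum>(b, c) | b + c = a'. f (int d) * (\<Sum>v\<in>hstrip_below l (n - d). ?G v b c)) =
          f (int d) * (\<Sum>(b, c) | b + c = a'. \<Sum>v\<in>hstrip_below l (n - d). ?G v b c)"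
        by (simp only: split_def sum_distrib_left)
      also have "(\<Sum>(b, c) | b + c = a'. \<Sum>v\<in>hstrip_below l (n - d). ?G v b c) =
          (\<Sum>v\<in>hstrip_below l (n - d). \<Sum>(b, c) | b + c = a'. ?G v b c)"
        unfolding split_def by (rule sum.swap)
      also have "\<dots> = (\<Sum>v\<in>hstrip_below l (n - d). if u \<le> v then mcoeff (weight_series f * schur v u) a' else 0)"
        by (rule sum.cong[OF refl]) (simp add: mcoeff_mult split_def)
      finally show "(\<Sum>(b, c) | b + c = a'. f (int d) * (\<Sum>v\<in>hstrip_below l (n - d). ?G v b c)) =
          f (int d) * (\<Sum>v\<in>hstrip_below l (n - d). if u \<le> v then mcoeff (weight_series f * schur v u) a' else 0)" .
    qed
    also have "\<dots> = (\<Sum>d\<le>n. f (int d) * (\<Sum>v\<in>hstrip_below l (n - d). strip_series f (Poly_Mapping.lookup a) N u v))"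
      by (intro sum.cong refl arg_cong2[where f = "(*)"]) (simp add: cf hstrip_below_def)
    finally show ?thesis using True by (simp add: n_def)
  qed
qed

lemma strip_series_zero: 
  assumes "causal f" "is_partition u" "is_partition l" "\<not> u \<le> l"
  shows "strip_series f a N u l = 0"
  using assms(3,4)
proof (induction N arbitrary: l)
  case (Suc N)
  have "strip_series f a N u v = 0" if "v \<in> hstrip_below l b" for v b
    using that Suc.prems hstrip_le[of v l] by (intro Suc.IH) (auto simp: hstrip_below_def)
  then show ?case by (auto intro!: sum.neutral)
qed auto

definition partitions_of_size :: "nat \<Rightarrow> (nat \<Rightarrow> nat) set" where
  "partitions_of_size s = {p. is_partition p \<and> psize p = s}"

lemma finite_partitions_of_size: "finite (partitions_of_size s)"
  by (rule finite_subset[OF _ finite_partitions_bounded[of s]]) (auto simp: partitions_of_size_def)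

text \<open>Iterating the commutation with horizontal strips: multiplication by the series of \<open>f\<close>
  is conjugation by the matrix of minors of \<open>f\<close>.\<close>

lemma path_sum_minor:
  assumes f: "causal f" and u: "is_partition u"
  shows "is_partition l \<Longrightarrow>
    (\<Sum>r\<in>partitions_of_size (psize u + (\<Sum>i<N. a i)). path_sum (strip_weight a) N u r * minor f l r) =
    (\<Sum>v | is_partition v \<and> v \<le> l. minor f v u * strip_series f a N v l)"
proof (induction N arbitrary: l)
  case 0
  have "(\<Sum>r\<in>partitions_of_size (psize u + (\<Sum>i<0. a i)). path_sum (strip_weight a) 0 u r * minor f l r) =
      (\<Sum>r\<in>{u}. path_sum (strip_weight a) 0 u r * minor f l r)"
    by (rule sum.mono_neutral_right) (use u finite_partitions_of_size in \<open>auto simp: partitions_of_size_def\<close>)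
  moreover have "(\<Sum>v | is_partition v \<and> v \<le> l. minor f v u * strip_series f a 0 v l) =
      (\<Sum>v\<in>{l}. minor f v u * strip_series f a 0 v l)"
    by (rule sum.mono_neutral_right) (use 0 finite_partitions_below in auto)
  ultimately show ?case by simp
next
  case (Suc N)
  let ?Z = "path_sum (strip_weight a) N u"
  let ?S = "partitions_of_size (psize u + (\<Sum>i<N. a i))"
  let ?S' = "partitions_of_size (psize u + (\<Sum>i<Suc N. a i))"
  have "(\<Sum>r\<in>?S'. path_sum (strip_weight a) (Suc N) u r * minor f l r) =
      (\<Sum>r\<in>?S'. \<Sum>v\<in>hstrip_below r (a N). ?Z v * minor f l r)"
    by (intro sum.cong refl) (simp only: path_sum_strip_Suc partitions_of_size_def mem_Collect_eq sum_distrib_right)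
  also have "\<dots> = (\<Sum>(r, v)\<in>Sigma ?S' (\<lambda>r. hstrip_below r (a N)). ?Z v * minor f l r)"
    by (rule sum.Sigma) (use finite_hs_below finite_partitions_of_size in \<open>auto simp: partitions_of_size_def\<close>)
  also have "\<dots> = (\<Sum>(v, r)\<in>Sigma ?S (\<lambda>v. hstrip_above v (a N)). ?Z v * minor f l r)"
    by (rule sum.reindex_bij_witness[of _ prod.swap prod.swap])
      (auto simp: partitions_of_size_def hstrip_below_def hstrip_above_def)
  also have "\<dots> = (\<Sum>v\<in>?S. \<Sum>r\<in>hstrip_above v (a N). ?Z v * minor f l r)"
    by (rule sum.Sigma[symmetric]) (use finite_hs_above finite_partitions_of_size in auto)
  also have "\<dots> = (\<Sum>v\<in>?S. \<Sum>b\<le>a N. \<Sum>r\<in>hstrip_below l (a N - b). f (int b) * (?Z v * minor f r v))"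
  proof (rule sum.cong[OF refl])
    fix v assume "v \<in> ?S"
    then have v: "is_partition v" by (simp add: partitions_of_size_def)
    show "(\<Sum>r\<in>hstrip_above v (a N). ?Z v * minor f l r) =
        (\<Sum>b\<le>a N. \<Sum>r\<in>hstrip_below l (a N - b). f (int b) * (?Z v * minor f r v))"
      unfolding sum_distrib_left[symmetric] hstrip_minor_commute[OF f Suc.prems v]
      by (simp add: sum_distrib_left mult.left_commute)
  qed
  also have "\<dots> = (\<Sum>b\<le>a N. \<Sum>r\<in>hstrip_below l (a N - b). \<Sum>v\<in>?S. f (int b) * (?Z v * minor f r v))"
    by (subst sum.swap, rule sum.cong[OF refl], rule sum.swap)
  also have "\<dots> = (\<Sum>b\<le>a N. \<Sum>r\<in>hstrip_below l (a N - b). \<Sum>v | is_partition v \<and> v \<le> l.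
      f (int b) * (minor f v u * strip_series f a N v r))"
  proof (rule sum.cong[OF refl], rule sum.cong[OF refl])
    fix b r assume "r \<in> hstrip_below l (a N - b)"
    then have r: "is_partition r" "r \<le> l" by (auto simp: hstrip_below_def hstrip_le)
    have "(\<Sum>v | is_partition v \<and> v \<le> r. minor f v u * strip_series f a N v r) =
        (\<Sum>v | is_partition v \<and> v \<le> l. minor f v u * strip_series f a N v r)"
      by (rule sum.mono_neutral_left)
        (use r strip_series_zero[OF f _ r(1)] finite_partitions_below[OF Suc.prems] in auto)
    then show "(\<Sum>v\<in>?S. f (int b) * (?Z v * minor f r v)) =
        (\<Sum>v | is_partition v \<and> v \<le> l. f (int b) * (minor f v u * strip_series f a N v r))"
      unfolding sum_distrib_left[symmetric] Suc.IH[OF r(1)] by simp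
  qed
  also have "\<dots> = (\<Sum>v | is_partition v \<and> v \<le> l. \<Sum>b\<le>a N. \<Sum>r\<in>hstrip_below l (a N - b).
      f (int b) * (minor f v u * strip_series f a N v r))"
    by (subst (2) sum.swap, subst sum.swap, rule refl)
  also have "\<dots> = (\<Sum>v | is_partition v \<and> v \<le> l. minor f v u * strip_series f a (Suc N) v l)"
    by (simp add: sum_distrib_left mult.left_commute)
  finally show ?case .
qed

text \<open>Summing \<open>path_sum_minor\<close> against \<open>minor g u e\<close> over
  \<open>u\<close> cancels the minors of \<open>f\<close>, since the two matrices are inverse to
  each other, and leaves \<open>strip_series\<close> at \<open>v = e\<close>.\<close>

theorem weight_form_schur:
  assumes f: "causal f" and g: "causal g" and fg: "genfps f * genfps g = 1"
    and l: "is_partition l" and e: "is_partition e" and el: "e \<le> l"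
  shows "weight_form m f * schur l e =
    (\<Sum>(r, u) \<in> {(r, u). is_partition r \<and> is_partition u \<and> l \<le> r \<and> u \<le> e \<and>
        card (skew r l) + card (skew e u) = m}. of_int (minor g u e * minor f l r) * schur r u)"
proof (rule mps_eqI)
  fix a
  let ?X = "{(r, u). is_partition r \<and> is_partition u \<and> l \<le> r \<and> u \<le> e \<and>
        card (skew r l) + card (skew e u) = m}"
  have rhs: "mcoeff (\<Sum>(r, u)\<in>?X. of_int (minor g u e * minor f l r) * schur r u) a =
      (\<Sum>(r, u)\<in>?X. minor g u e * minor f l r * mcoeff (schur r u) a)"
    by (simp only: mcoeff_sum split_def mcoeff_of_int)
  have sizes: "psize r + psize e = psize u + (psize l + m)" "psize l + m = card (skew r u) + psize e"
    if "(r, u) \<in> ?X" for r u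
  proof -
    have x: "is_partition r" "is_partition u" "l \<le> r" "u \<le> e" "card (skew r l) + card (skew e u) = m"
      using that by auto
    then have ur: "u \<le> r" using el by (meson order.trans)
    show 1: "psize r + psize e = psize u + (psize l + m)"
      using card_skew[OF x(1) l x(3)] card_skew[OF e x(2,4)] x(5) by linarith
    show "psize l + m = card (skew r u) + psize e"
      using card_skew[OF x(1,2) ur] 1 by linarith
  qed
  show "mcoeff (weight_form m f * schur l e) a =
      mcoeff (\<Sum>(r, u)\<in>?X. of_int (minor g u e * minor f l r) * schur r u) a"
  \<comment> \<open>In all other degrees both sides have coefficient zero.\<close>
  proof (cases "mdeg a + psize e = psize l + m")
    case False
    have "mcoeff (weight_form m f * schur l e) a = 0"
      unfolding mcoeff_mult
    proof (rule sum.neutral, clarify)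
      fix b c assume a: "a = b + c"
      show "mcoeff (weight_form m f) b * mcoeff (schur l e) c = 0"
      proof (cases "mcoeff (schur l e) c = 0")
        case nz: False
        then have "mdeg c + psize e = psize l"
          using mcoeff_schur_degree[OF l nz] card_skew[OF l e el] by simp
        then have "mdeg b \<noteq> m" using False by (auto simp: a mdeg_add)
        then show ?thesis by (simp add: weight_form_def)
      qed simp
    qed
    moreover have "(\<Sum>(r, u)\<in>?X. minor g u e * minor f l r * mcoeff (schur r u) a) = 0"
    proof (rule sum.neutral, rule ballI)
      fix x assume x: "x \<in> ?X"
      obtain r u where ru: "x = (r, u)" by (cases x)
      have "mcoeff (schur r u) a = 0"
        using mcoeff_schur_degree[of r u a] sizes(2)[of r u] x False unfolding ru by fastforce
      then show "(case x of (r, u) \<Rightarrow> minor g u e * minor f l r * mcoeff (schur r u) a) = 0" by (simp add: ru)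
    qed
    ultimately show ?thesis using rhs by simp
  next
    case True
    obtain N where N: "Poly_Mapping.keys a \<subseteq> {..<N}"
      using finite_nat_iff_bounded[of "Poly_Mapping.keys a"] by auto
    let ?a = "Poly_Mapping.lookup a"
    let ?U = "{u. is_partition u \<and> u \<le> e}"
    let ?V = "{v. is_partition v \<and> v \<le> l}"
    have finU: "finite ?U" "finite ?V" using finite_partitions_below e l by auto
    let ?S = "\<lambda>u. partitions_of_size (psize u + (\<Sum>i<N. ?a i))"
    have deg: "(\<Sum>i<N. ?a i) = mdeg a" by (rule mdeg_eq_sum[OF N, symmetric])
    have Z: "mcoeff (schur r u) a = path_sum (strip_weight ?a) N u r"
      if "is_partition r" "is_partition u" "u \<le> e" "l \<le> r" for r u
    proof -
      have "u \<le> r" using that el by (meson order.trans)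
      then show ?thesis using mcoeff_schur[OF that(2,1) _ N] by simp
    qed
    have "(\<Sum>(r, u)\<in>?X. minor g u e * minor f l r * mcoeff (schur r u) a) =
        (\<Sum>(u, r)\<in>Sigma ?U (\<lambda>u. {r \<in> ?S u. l \<le> r}). minor g u e * (path_sum (strip_weight ?a) N u r * minor f l r))"
    proof (rule sum.reindex_bij_witness[of _ prod.swap prod.swap])
      fix x assume x: "x \<in> ?X"
      then obtain r u where ru: "x = (r, u)" by (cases x) auto
      have "psize r = psize u + mdeg a" using sizes(1)[of r u] x True unfolding ru by simp
      then show "prod.swap x \<in> Sigma ?U (\<lambda>u. {r \<in> ?S u. l \<le> r})"
        using x deg by (auto simp: ru partitions_of_size_def)
      show "(case prod.swap x of (u, r) \<Rightarrow> minor g u e * (path_sum (strip_weight ?a) N u r * minor f l r)) =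
          (case x of (r, u) \<Rightarrow> minor g u e * minor f l r * mcoeff (schur r u) a)"
        using Z[of r u] x by (simp add: ru)
    next
      fix x assume "x \<in> Sigma ?U (\<lambda>u. {r \<in> ?S u. l \<le> r})"
      then obtain u r where x: "x = (u, r)" "is_partition u" "u \<le> e" "is_partition r" "l \<le> r" "psize r = psize u + mdeg a"
        using deg by (auto simp: partitions_of_size_def)
      have "card (skew r l) + card (skew e u) = m"
        using card_skew[OF x(4) l x(5)] card_skew[OF e x(2,3)] x(6) True by linarith
      then show "prod.swap x \<in> ?X" using x by simp
    qed auto
    also have "\<dots> = (\<Sum>u\<in>?U. \<Sum>r\<in>{r \<in> ?S u. l \<le> r}. minor g u e * (path_sum (strip_weight ?a) N u r * minor f l r))"
      by (rule sum.Sigma[symmetric]) (use finU finite_partitions_of_size in auto)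
    also have "\<dots> = (\<Sum>u\<in>?U. minor g u e * (\<Sum>r\<in>?S u. path_sum (strip_weight ?a) N u r * minor f l r))"
      unfolding sum_distrib_left[symmetric]
    proof (rule sum.cong[OF refl], rule arg_cong2[where f = "(*)", OF refl])
      fix u
      show "(\<Sum>r\<in>{r \<in> ?S u. l \<le> r}. path_sum (strip_weight ?a) N u r * minor f l r) =
          (\<Sum>r\<in>?S u. path_sum (strip_weight ?a) N u r * minor f l r)"
        by (rule sum.mono_neutral_left)
          (use finite_partitions_of_size minor_zero[OF f l] in \<open>auto simp: partitions_of_size_def\<close>)
    qed
    also have "\<dots> = (\<Sum>u\<in>?U. minor g u e * (\<Sum>v\<in>?V. minor f v u * strip_series f ?a N v l))"
      by (rule sum.cong[OF refl], rule arg_cong2[where f = "(*)", OF refl]) (use path_sum_minor[OF f _ l] in blast)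
    also have "\<dots> = (\<Sum>v\<in>?V. strip_series f ?a N v l * (\<Sum>u\<in>?U. minor f v u * minor g u e))"
      unfolding sum_distrib_left by (subst sum.swap) (simp only: mult_ac)
    also have "\<dots> = (\<Sum>v\<in>?V. strip_series f ?a N v l * (if v = e then 1 else 0))"
    proof (rule sum.cong[OF refl], rule arg_cong2[where f = "(*)", OF refl])
      fix v assume "v \<in> ?V"
      then have v: "is_partition v" by simp
      have "(\<Sum>u\<in>?U. minor f v u * minor g u e) =
          (\<Sum>u | is_partition u \<and> v \<le> u \<and> u \<le> e. minor f v u * minor g u e)"
        by (rule sum.mono_neutral_right) (use finU minor_zero[OF f v] in auto)
      then show "(\<Sum>u\<in>?U. minor f v u * minor g u e) = (if v = e then 1 else 0)"
        using minor_inverse[OF f g fg v e] by simp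
    qed
    also have "\<dots> = strip_series f ?a N e l"
      using finU e el by (simp add: of_bool_def if_distrib cong: if_cong)
    also have "\<dots> = mcoeff (weight_series f * schur l e) a"
      using strip_series_eq[OF f e l N] el by simp
    \<comment> \<open>In this degree a nonzero coefficient of the skew Schur function only meets the
      part of degree \<open>m\<close> of the series.\<close>
    also have "\<dots> = mcoeff (weight_form m f * schur l e) a"
      unfolding mcoeff_mult
    proof (intro sum.cong refl, clarify)
      fix b c assume a: "a = b + c"
      show "mcoeff (weight_series f) b * mcoeff (schur l e) c = mcoeff (weight_form m f) b * mcoeff (schur l e) c"
      proof (cases "mcoeff (schur l e) c = 0")
        case nz: False
        then have "mdeg c + psize e = psize l"
          using mcoeff_schur_degree[OF l nz] card_skew[OF l e el] by simp
        then have "mdeg b = m" using True by (auto simp: a mdeg_add)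
        then show ?thesis by (simp add: weight_form_def)
      qed simp
    qed
    finally show ?thesis using rhs by simp
  qed
qed


section \<open>The two product formulas\<close>

lemma mcoeff_weight_series_geom:
  "mcoeff (weight_series (geom n)) a = of_bool (\<forall>i. n dvd Poly_Mapping.lookup a i)"
proof (cases "\<forall>i. n dvd Poly_Mapping.lookup a i")
  case False
  then obtain i where i: "\<not> n dvd Poly_Mapping.lookup a i" by blast
  then have "i \<in> Poly_Mapping.keys a" by (auto simp: in_keys_iff intro: ccontr)
  then show ?thesis using i by (auto simp: weight_series_def geom_def intro!: bexI[of _ i])
qed (auto simp: weight_series_def geom_def)

lemma mdeg_scaled:
  assumes "\<And>i. Poly_Mapping.lookup a i = n * Poly_Mapping.lookup b i"
  shows "mdeg a = n * mdeg b"
proof -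
  obtain N where N: "Poly_Mapping.keys a \<union> Poly_Mapping.keys b \<subseteq> {..<N}"
    using finite_nat_iff_bounded[of "Poly_Mapping.keys a \<union> Poly_Mapping.keys b"] by auto
  then show ?thesis using mdeg_eq_sum[of a N] mdeg_eq_sum[of b N] by (simp add: assms sum_distrib_left)
qed

text \<open>Substituting \<open>x_i^n\<close> into the sum of all complete functions gives the
  product of the \<open>1/(1 - x_i^n)\<close>; the contribution of \<open>h_k\<close> is its part of
  degree \<open>n k\<close>.\<close>

lemma p_plethysm_hsym:
  assumes n: "0 < n" shows "p_plethysm n (hsym k) = weight_form (n * k) (geom n)"
proof (rule mps_eqI)
  fix a :: "nat \<Rightarrow>\<^sub>0 nat"
  let ?B = "{b. Poly_Mapping.map ((*) n) b = a}"
  have lk: "Poly_Mapping.lookup (Poly_Mapping.map ((*) n) b) i = n * Poly_Mapping.lookup b i" for b i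
    by (simp add: Poly_Mapping.map.rep_eq when_def)
  have lh: "mcoeff (p_plethysm n (hsym k)) a = (\<Sum>b\<in>?B. of_bool (mdeg b = k))"
    by (simp add: p_plethysm_def hsym_def of_bool_def)
  show "mcoeff (p_plethysm n (hsym k)) a = mcoeff (weight_form (n * k) (geom n)) a"
  proof (cases "\<forall>i. n dvd Poly_Mapping.lookup a i")
    case True
    define b where "b = Poly_Mapping.map (\<lambda>x. x div n) a"
    have lb: "Poly_Mapping.lookup a i = n * Poly_Mapping.lookup b i" for i
      using True by (simp add: b_def Poly_Mapping.map.rep_eq when_def)
    have "?B = {b}"
    proof (intro equalityI subsetI)
      fix c assume "c \<in> ?B"
      then have "n * Poly_Mapping.lookup c i = n * Poly_Mapping.lookup b i" for i using lk[of c i] lb[of i] by auto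
      then have "c = b" using n by (intro poly_mapping_eqI) simp
      then show "c \<in> {b}" by simp
    next
      fix c assume "c \<in> {b}"
      then show "c \<in> ?B" using lk lb by (auto intro!: poly_mapping_eqI)
    qed
    then show ?thesis
      using lh mdeg_scaled[of a n b, OF lb] True n
      by (simp add: weight_form_def mcoeff_weight_series_geom)
  next
    case False
    then obtain i where "\<not> n dvd Poly_Mapping.lookup a i" by blast
    then have "b \<notin> ?B" for b using lk[of b i] by auto
    then have "?B = {}" by blast
    then show ?thesis using lh False by (simp add: weight_form_def mcoeff_weight_series_geom)
  qed
qed

lemma petrie_weight_form:
  assumes k: "0 < k" shows "petrie k (int m) = weight_form m (petrie_seq k)"
proof (rule mps_eqI)
  fix a
  have "mcoeff (weight_series (petrie_seq k)) a = of_bool (\<forall>i. Poly_Mapping.lookup a i < k)"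
  proof (cases "\<forall>i. Poly_Mapping.lookup a i < k")
    case False
    then obtain i where i: "\<not> Poly_Mapping.lookup a i < k" by blast
    then have "i \<in> Poly_Mapping.keys a" using k by (auto simp: in_keys_iff)
    then show ?thesis using i by (auto simp: weight_series_def petrie_seq_def intro!: bexI[of _ i])
  qed (auto simp: weight_series_def petrie_seq_def)
  then show "mcoeff (petrie k (int m)) a = mcoeff (weight_form m (petrie_seq k)) a"
    by (simp add: mcoeff_petrie[OF k] weight_form_def)
qed

lemma finite_skew_pairs:
  assumes "is_partition l" "is_partition e"
  shows "finite {(r, u). is_partition r \<and> is_partition u \<and> l \<le> r \<and> u \<le> e \<and>
        card (skew r l) + card (skew e u) = m}"
proof (rule finite_subset)
  show "{(r, u). is_partition r \<and> is_partition u \<and> l \<le> r \<and> u \<le> e \<and> card (skew r l) + card (skew e u) = m}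
    \<subseteq> {r. is_partition r \<and> psize r \<le> psize l + m} \<times> {u. is_partition u \<and> u \<le> e}"
    using card_skew[OF _ assms(1)] by fastforce
  show "finite ({r. is_partition r \<and> psize r \<le> psize l + m} \<times> {u. is_partition u \<and> u \<le> e})"
    using finite_partitions_bounded finite_partitions_below[OF assms(2)] by (intro finite_cartesian_product)
qed

text \<open>Passes from the pairs of total size \<open>m\<close> to those that satisfy
  \<open>R\<close>: \<open>size\<close> keeps the latter among the former, and \<open>coef\<close>
  makes the other terms zero.\<close>

lemma weight_form_schur_supported:
  assumes f: "causal f" and g: "causal g" and fg: "genfps f * genfps g = 1"
    and l: "is_partition l" and e: "is_partition e" and el: "e \<le> l"
    and coef: "\<And>r u. is_partition r \<Longrightarrow> is_partition u \<Longrightarrow> card (skew r l) + card (skew e u) = m \<Longrightarrow>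
      minor g u e * minor f l r = (if R r u then c r u else 0)"
    and size: "\<And>r u. is_partition r \<Longrightarrow> is_partition u \<Longrightarrow> R r u \<Longrightarrow> card (skew r l) + card (skew e u) = m"
  shows "weight_form m f * schur l e =
    (\<Sum>(r, u) \<in> {(r, u). is_partition r \<and> is_partition u \<and> l \<le> r \<and> u \<le> e \<and> R r u}. of_int (c r u) * schur r u)"
  unfolding weight_form_schur[OF f g fg l e el]
proof (rule sum.mono_neutral_cong_right[OF finite_skew_pairs[OF l e]])
  let ?c = "\<lambda>x. case x of (r, u) \<Rightarrow> of_int (minor g u e * minor f l r) * schur r u"
  let ?X = "{(r, u). is_partition r \<and> is_partition u \<and> l \<le> r \<and> u \<le> e \<and> card (skew r l) + card (skew e u) = m}"
  let ?Y = "{(r, u). is_partition r \<and> is_partition u \<and> l \<le> r \<and> u \<le> e \<and> R r u}"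
  show "?Y \<subseteq> ?X" using size by auto
  show "\<forall>x\<in>?X - ?Y. ?c x = 0"
  proof
    fix x assume x: "x \<in> ?X - ?Y"
    obtain r u where ru: "x = (r, u)" by (cases x)
    have "minor g u e * minor f l r = 0" using x coef[of r u] by (simp add: ru)
    then show "?c x = 0" by (simp only: ru split_conv of_int_0 mult_zero_left)
  qed
  fix x assume x: "x \<in> ?Y"
  obtain r u where ru: "x = (r, u)" by (cases x)
  have "minor g u e * minor f l r = c r u" using x coef[of r u] size[of r u] by (simp add: ru)
  then show "?c x = (case x of (r, u) \<Rightarrow> of_int (c r u) * schur r u)" by (simp only: ru split_conv)
qed

theorem plethysm_schur:
  assumes n: "1 \<le> n" and l: "is_partition l" and e: "is_partition e" and el: "e \<le> l"
  shows "p_plethysm n (hsym k) * schur l e =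
    (\<Sum>(r, u) \<in> {(r, u). is_partition r \<and> is_partition u \<and> l \<le> r \<and> u \<le> e \<and>
         (\<exists>w w'. horizontal_ribbon n r l w \<and> horizontal_ribbon n (conj_part e) (conj_part u) w' \<and> w + w' = k)}.
       of_int ((-1) ^ card (skew e u) * sgn_ribbon n r l * sgn_ribbon n (conj_part e) (conj_part u)) * schur r u)"
proof -
  have n0: "0 < n" using n by simp
  have size: "card (skew r l) + card (skew e u) = n * (w + w')"
    if ru: "is_partition r" "is_partition u" and w: "horizontal_ribbon n r l w" "horizontal_ribbon n (conj_part e) (conj_part u) w'"
    for r u w w'
    using horizontal_ribbon_size[OF w(1)] card_skew[OF ru(1) l] horizontal_ribbon_size[OF w(2)]
      card_skew[of "conj_part e" "conj_part u"] card_skew_conj[OF ru(2) e] ru e by (simp add: algebra_simps)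
  show ?thesis
    unfolding p_plethysm_hsym[OF n0]
  proof (rule weight_form_schur_supported[OF causal_geom causal_geom_inv genfps_geom_mult_inv[OF n0] l e el])
    fix r u assume ru: "is_partition r" "is_partition u"
    let ?R = "\<exists>w w'. horizontal_ribbon n r l w \<and> horizontal_ribbon n (conj_part e) (conj_part u) w' \<and> w + w' = k"
    show "card (skew r l) + card (skew e u) = n * k" if ?R using that size[OF ru] by blast
    assume m: "card (skew r l) + card (skew e u) = n * k"
    \<comment> \<open>The total number of boxes fixes the sum of the weights, so the two ribbon
      conditions separate.\<close>
    have "w + w' = k" if "horizontal_ribbon n r l w" "horizontal_ribbon n (conj_part e) (conj_part u) w'" for w w'
      using size[OF ru that] m n0 by simp
    then have "?R \<longleftrightarrow> (\<exists>w. horizontal_ribbon n r l w) \<and> (\<exists>w'. horizontal_ribbon n (conj_part e) (conj_part u) w')"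
      by blast
    then show "minor (geom_inv n) u e * minor (geom n) l r =
        (if ?R then (-1) ^ card (skew e u) * sgn_ribbon n r l * sgn_ribbon n (conj_part e) (conj_part u) else 0)"
      using minor_geom_inv_conj[OF ru(2) e n0] minor_geom[OF l ru(1) n0] minor_geom[of "conj_part u" "conj_part e" n] ru e n0
      by auto
  qed
qed

theorem petrie_schur:
  assumes k: "1 \<le> k" and l: "is_partition l" and e: "is_partition e" and el: "e \<le> l"
  shows "petrie k (int m) * schur l e =
    (\<Sum>(r, u) \<in> {(r, u). is_partition r \<and> is_partition u \<and> l \<le> r \<and> u \<le> e \<and>
         card (skew r l) + card (skew e u) = m \<and> good_proper_ribbon k r l \<and>
         good_proper_ribbon k (conj_part e) (conj_part u) \<and>
         (\<forall>i. r i - l i < k) \<and> (\<forall>i. conj_part e i - conj_part u i < k)}.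
       of_int ((-1) ^ card (skew e u) * sgn_good k r l * sgn_good k (conj_part e) (conj_part u)) * schur r u)"
proof -
  have k0: "0 < k" using k by simp
  show ?thesis
    unfolding petrie_weight_form[OF k0]
  proof (rule weight_form_schur_supported[OF causal_petrie_seq[OF k0] causal_petrie_seq_inv genfps_petrie_seq_mult_inv[OF k0] l e el])
    fix r u assume ru: "is_partition r" "is_partition u" and m: "card (skew r l) + card (skew e u) = m"
    note 1 = minor_petrie_inv_conj[OF ru(2) e k0] minor_petrie[OF l ru(1) k0]
      minor_petrie[OF is_partition_conj[OF ru(2)] is_partition_conj[OF e] k0]
    note 2 = minor_petrie_row_bound[OF l ru(1) k0] minor_petrie_row_bound[OF is_partition_conj[OF ru(2)] is_partition_conj[OF e] k0]
    show "minor (petrie_seq_inv k) u e * minor (petrie_seq k) l r = (if card (skew r l) + card (skew e u) = m \<and> good_proper_ribbon k r l \<and>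
         good_proper_ribbon k (conj_part e) (conj_part u) \<and>
         (\<forall>i. r i - l i < k) \<and> (\<forall>i. conj_part e i - conj_part u i < k)
       then (-1) ^ card (skew e u) * sgn_good k r l * sgn_good k (conj_part e) (conj_part u) else 0)"
      using m 1 2 by (cases "minor (petrie_seq k) l r = 0 \<or> minor (petrie_seq k) (conj_part u) (conj_part e) = 0") (auto split: if_splits)
  qed simp
qed


section \<open>Skew modular Schur functions\<close>

text \<open>The ribbon starts in the last nonempty row of \<open>v'/u\<close> and, having the same
  southwest box, contains this whole row.\<close>

definition special_step :: "(nat \<Rightarrow> nat) \<Rightarrow> nat \<Rightarrow> (nat \<Rightarrow> nat) \<Rightarrow> (nat \<Rightarrow> nat) \<Rightarrow> bool" where
  "special_step u n v v' \<longleftrightarrow> ribbon (skew v' v) \<and> card (skew v' v) = n \<and>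
     (\<exists>b. southwestmost (skew v' v) b \<and> southwestmost (skew v' u) b)"

lemma rib_unique:
  assumes "rib p q n t r" "rib p q n' t' r" "t q = t' q"
  shows "t = t'"
proof
  fix i
  consider "i < p \<or> q < i" | "p \<le> i" "i < q" | "i = q" by linarith
  then show "t i = t' i"
  proof cases
    case 1
    then show ?thesis using ribD(2)[OF assms(1), of i] ribD(2)[OF assms(2), of i] by simp
  next
    case 2
    then show ?thesis using ribD(3)[OF assms(1), of i] ribD(3)[OF assms(2), of i] by simp
  qed (use assms(3) in simp)
qed

text \<open>Laplace expansion along the column of the last row \<open>q\<close> of \<open>r/u\<close>: deleting row \<open>p\<close> removes from
  \<open>r\<close> the ribbon that occupies the rows \<open>p, \<dots>, q\<close> and contains the whole row \<open>q\<close> of \<open>r/u\<close>.\<close>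

lemma minor_special_expansion:
  fixes h :: "int \<Rightarrow> 'a::comm_ring_1"
  assumes h: "causal h" and u: "is_partition u" and r: "is_partition r" and ur: "u \<le> r" "u \<noteq> r"
  shows "minor h u r = (\<Sum>t\<in>between u r. if special_step u (card (skew r t)) t r
    then (-1) ^ height (skew r t) * h (int (card (skew r t))) * minor h u t else 0)"
proof -
  define S where "S = {i. u i \<noteq> r i}"
  have SL: "S \<subseteq> {..<plength r}"
  proof
    fix i assume "i \<in> S"
    then have "r i \<noteq> 0" using le_funD[OF ur(1), of i] by (auto simp: S_def)
    then show "i \<in> {..<plength r}" using partition_nonzero_iff[OF r] by simp
  qed
  then have S: "finite S" "S \<noteq> {}" using ur(2) by (auto simp: S_def intro: finite_subset)
  define q where "q = Max S"
  have "q \<in> S" using Max_in[OF S] by (simp add: q_def)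
  then have q: "u q < r q" "q < plength r" using SL le_funD[OF ur(1), of q] by (auto simp: S_def)
  have above: "u i = r i" if "q < i" for i
    using Max_ge[OF S(1), of i] that by (auto simp: q_def S_def)
  have sw: "southwestmost (skew r u) (q, u q)"
    unfolding southwestmost_def
  proof (intro conjI ballI)
    show "(q, u q) \<in> skew r u" using q by (simp add: skew_def)
    fix c assume c: "c \<in> skew r u"
    then have "u (fst c) \<noteq> r (fst c)" by (auto simp: skew_def)
    then show "fst c \<le> fst (q, u q)" using above[of "fst c"] by (auto simp: not_le[symmetric])
    then have "u q \<le> u (fst c)" using is_partitionD[OF u] by simp
    then show "snd (q, u q) \<le> snd c" using c by (auto simp: skew_def)
  qed
  define n where "n p = nat (bead r p - bead u q)" for p
  have npos: "bead r p = bead u q + int (n p)" if "p \<le> q" for p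
  proof -
    have "bead r q \<le> bead r p" using that r by (simp add: bead_le_iff)
    then show ?thesis using q by (simp add: n_def bead_def)
  qed
  have ex: "\<exists>t. is_partition t \<and> rib p q (n p) t r \<and> t q = u q" if "p \<le> q" for p
  proof (rule unrib[OF r that q(1)])
    show "r (Suc q) \<le> u q" using above[of "Suc q"] is_partitionD[OF u, of q "Suc q"] by simp
    show "bead r p = int (u q) - int q + int (n p)" using npos[OF that] by (simp add: bead_def)
  qed
  define t where "t p = (SOME t. is_partition t \<and> rib p q (n p) t r \<and> t q = u q)" for p
  have t: "is_partition (t p)" "rib p q (n p) (t p) r" "t p q = u q" if "p \<le> q" for p
    using someI_ex[OF ex[OF that]] by (auto simp: t_def)
  let ?F = "\<lambda>t. (-1) ^ height (skew r t) * h (int (card (skew r t))) * minor h u t"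
  have len: "plength u \<le> plength r" by (rule plength_mono[OF u r ur(1)])
  have "minor h u r = toep (plength r) h u r" by (rule minor_toep[OF h u r len order_refl])
  \<comment> \<open>Beyond row \<open>q\<close> the two partitions agree, so the matrix can be cut
    off there and column \<open>q\<close> becomes its last.\<close>
  also have "\<dots> = toep (Suc q) h u r"
    by (rule toep_stable[OF h u r]) (use q above in auto)
  also have "\<dots> = (\<Sum>p<Suc q. h (bead r p - bead u q) * ((-1) ^ (p + q) *
      dt q (\<lambda>i j. h (bead r (skip p i) - bead u (skip q j)))))"
    unfolding toep_def by (rule dt_laplace_col) simp
  also have "\<dots> = (\<Sum>p<Suc q. ?F (t p))"
  proof (rule sum.cong[OF refl])
    fix p assume "p \<in> {..<Suc q}"
    then have pq: "p \<le> q" by simp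
    note tp = t[OF pq]
    have ti: "t p i = u i" if "q \<le> i" for i
      using tp(3) ribD(2)[OF tp(2), of i] above[of i] that by (cases "i = q") auto
    have lt: "plength (t p) \<le> plength r" by (rule plength_mono[OF tp(1) r rib_le[OF tp(2,1)]])
    have "dt q (\<lambda>i j. h (bead r (skip p i) - bead u (skip q j))) = toep q h u (t p)"
      unfolding toep_def rib_bead_skip[OF tp(2)] by (rule dt_cong) simp
    also have "\<dots> = toep (plength r) h u (t p)"
      by (rule toep_stable[OF h u tp(1), symmetric]) (use q ti in auto)
    also have "\<dots> = minor h u (t p)" by (rule minor_toep[OF h u tp(1) len lt, symmetric])
    finally have 1: "dt q (\<lambda>i j. h (bead r (skip p i) - bead u (skip q j))) = minor h u (t p)" .
    have 2: "(-1 :: 'a) ^ (p + q) = (-1) ^ height (skew r (t p))"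
      unfolding minus_one_power_diff[OF pq] rib_num_rows(2)[OF tp(2,1)] by (simp flip: mult_2)
    have 3: "bead r p - bead u q = int (card (skew r (t p)))"
      using npos[OF pq] rib_card[OF tp(2,1) r] by simp
    show "h (bead r p - bead u q) * ((-1) ^ (p + q) * dt q (\<lambda>i j. h (bead r (skip p i) - bead u (skip q j)))) = ?F (t p)"
      unfolding 1 2 3 by (simp add: mult_ac)
  qed
  also have "\<dots> = (\<Sum>t\<in>t ` {..<Suc q}. ?F t)"
  proof -
    have "inj_on t {..<Suc q}"
    proof (rule inj_onI)
      fix p p' assume a: "p \<in> {..<Suc q}" "p' \<in> {..<Suc q}" "t p = t p'"
      have pq: "p \<le> q" "p' \<le> q" using a by auto
      have "{p..q} = {p'..q}"
        unfolding rib_fst[OF t(2)[OF pq(1)] t(1)[OF pq(1)], symmetric]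
          rib_fst[OF t(2)[OF pq(2)] t(1)[OF pq(2)], symmetric] a(3) ..
      then show "p = p'" using pq by (auto simp: Icc_eq_Icc)
    qed
    then show ?thesis by (simp only: sum.reindex comp_def)
  qed
  also have "\<dots> = (\<Sum>t\<in>{t \<in> between u r. special_step u (card (skew r t)) t r}. ?F t)"
  proof (rule sum.mono_neutral_right)
    show "finite (t ` {..<Suc q})" by simp
    show "{t \<in> between u r. special_step u (card (skew r t)) t r} \<subseteq> t ` {..<Suc q}"
    proof
      fix s assume "s \<in> {t \<in> between u r. special_step u (card (skew r t)) t r}"
      then have s: "is_partition s" "s \<le> r" "ribbon (skew r s)"
        and b: "\<exists>b. southwestmost (skew r s) b \<and> southwestmost (skew r u) b"
        by (auto simp: between_def special_step_def)
      obtain p q' m where rb: "rib p q' m s r" using ribbon_imp_rib[OF s(1) r s(2,3)] by blast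
      have "(q', s q') = (q, u q)"
        using b southwestmost_unique rib_southwestmost[OF rb s(1)] sw by metis
      then have qq: "q' = q" "s q = u q" by auto
      have pq: "p \<le> q" using ribD(1)[OF rb] qq by simp
      have "s = t p" by (rule rib_unique[OF rb[unfolded qq] t(2)[OF pq]]) (simp add: qq t(3)[OF pq])
      then show "s \<in> t ` {..<Suc q}" using pq by auto
    qed
    show "\<forall>s\<in>t ` {..<Suc q} - {t \<in> between u r. special_step u (card (skew r t)) t r}. ?F s = 0"
    proof
      fix s assume s: "s \<in> t ` {..<Suc q} - {t \<in> between u r. special_step u (card (skew r t)) t r}"
      then obtain p where "p < Suc q" "s = t p" by blast
      then have p: "p \<le> q" "s = t p" by auto
      note tp = t[OF p(1)]
      have "special_step u (card (skew r (t p))) (t p) r"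
        using rib_imp_ribbon[OF tp(2,1) r] rib_southwestmost[OF tp(2,1)] sw tp(3) by (auto simp: special_step_def)
      then have "\<not> u \<le> s" using s tp(1) rib_le[OF tp(2,1)] p by (auto simp: between_def)
      then show "?F s = 0" using minor_zero[OF h u] tp(1) p by simp
    qed
  qed
  also have "\<dots> = (\<Sum>t\<in>between u r. if special_step u (card (skew r t)) t r then ?F t else 0)"
    by (rule sum.mono_neutral_cong_left) (use finite_between[OF r] in auto)
  finally show ?thesis .
qed


text \<open>The list of step sizes is read backwards: its head is the size of the last step.\<close>

primrec step_sum :: "(nat \<Rightarrow> (nat \<Rightarrow> nat) \<Rightarrow> (nat \<Rightarrow> nat) \<Rightarrow> int) \<Rightarrow> nat list \<Rightarrow>
    (nat \<Rightarrow> nat) \<Rightarrow> (nat \<Rightarrow> nat) \<Rightarrow> int" where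
  "step_sum w [] u l = of_bool (u = l)"
| "step_sum w (n # ns) u l = (\<Sum>v\<in>between u l. step_sum w ns u v * w n v l)"

text \<open>Labels start at \<open>1\<close> while \<open>shape_below\<close> counts entries from
  \<open>0\<close>; the weight of step \<open>0\<close> forbids the label \<open>0\<close>.\<close>

definition label_weight :: "(nat \<Rightarrow> (nat \<Rightarrow> nat) \<Rightarrow> (nat \<Rightarrow> nat) \<Rightarrow> int) \<Rightarrow> nat list \<Rightarrow> nat \<Rightarrow>
    (nat \<Rightarrow> nat) \<Rightarrow> (nat \<Rightarrow> nat) \<Rightarrow> int" where
  "label_weight w ty i v v' = (case i of 0 \<Rightarrow> of_bool (v = v') | Suc j \<Rightarrow> w (ty ! j) v v')"

lemma path_sum_label_weight:
  assumes u: "is_partition u"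
  shows "is_partition l \<Longrightarrow> path_sum (label_weight w (rev ns)) (Suc (length ns)) u l = step_sum w ns u l"
proof (induction ns arbitrary: l)
  case Nil
  have "(\<Sum>v\<in>between u l. of_bool (u = v) * of_bool (v = l) :: int) = of_bool (u = l)"
  proof (cases "u = l")
    case True
    then have "between u l = {u}" using u by (auto simp: between_def)
    then show ?thesis using True by simp
  qed (auto intro!: sum.neutral)
  then show ?case by (simp add: label_weight_def)
next
  case (Cons n ns)
  have "path_sum (label_weight w (rev (n # ns))) (Suc (length ns)) u v = step_sum w ns u v" if "v \<in> between u l" for v
  proof -
    have "path_sum (label_weight w (rev (n # ns))) (Suc (length ns)) u v =
        path_sum (label_weight w (rev ns)) (Suc (length ns)) u v"
      by (rule path_sum_cong) (auto simp: label_weight_def nth_append split: nat.split)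
    then show ?thesis using Cons.IH[of v] that by (simp add: between_def)
  qed
  moreover have "label_weight w (rev (n # ns)) (Suc (length ns)) v l = w n v l" for v
    by (simp add: label_weight_def nth_append)
  ultimately have "(\<Sum>v\<in>between u l. path_sum (label_weight w (rev (n # ns))) (Suc (length ns)) u v *
      label_weight w (rev (n # ns)) (Suc (length ns)) v l) = (\<Sum>v\<in>between u l. step_sum w ns u v * w n v l)"
    by (intro sum.cong) auto
  then show ?case by simp
qed

text \<open>Serves both kinds of tableaux: a kind is described by the step weights being nonzero,
  and its sign is the product of these weights.\<close>

lemma sum_labelled_fillings:
  assumes u: "is_partition u" and l: "is_partition l" and ul: "u \<le> l"
    and size: "\<And>n v v'. w n v v' \<noteq> 0 \<Longrightarrow> card (skew v' v) = n"
    and pos: "\<forall>n\<in>set ty. 0 < n"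
    and fill: "\<And>T. R T \<Longrightarrow> T \<in> fillings u l (Suc (length ty))"
    and iff: "\<And>T. T \<in> fillings u l (Suc (length ty)) \<Longrightarrow> R T \<longleftrightarrow> (\<forall>b\<in>skew l u. 1 \<le> T b) \<and>
      (\<forall>i<length ty. w (ty ! i) (shape_below u l T (Suc i)) (shape_below u l T (Suc (Suc i))) \<noteq> 0)"
    and s: "\<And>T i. R T \<Longrightarrow> i < length ty \<Longrightarrow>
      s T (Suc i) = w (ty ! i) (shape_below u l T (Suc i)) (shape_below u l T (Suc (Suc i)))"
  shows "(\<Sum>T | R T. \<Prod>i\<in>T ` skew l u. s T i) = step_sum w (rev ty) u l" "finite {T. R T}"
proof -
  let ?N = "length ty" and ?v = "shape_below u l"
  let ?W = "\<lambda>T. \<Prod>i<Suc ?N. label_weight w ty i (?v T i) (?v T (Suc i))"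
  have geom: "?W T = of_bool (?v T 0 = ?v T 1) * (\<Prod>i<?N. w (ty ! i) (?v T (Suc i)) (?v T (Suc (Suc i))))" for T
    by (subst prod.lessThan_Suc_shift) (simp add: label_weight_def)
  have one: "?v T 0 = ?v T 1 \<longleftrightarrow> (\<forall>b\<in>skew l u. 1 \<le> T b)" if T: "T \<in> fillings u l (Suc ?N)" for T
  proof -
    have m: "?v T 0 \<le> ?v T (Suc 0)" by (rule shape_below_mono[OF u l ul T]) simp
    have "?v T 0 = ?v T 1 \<longleftrightarrow> skew (?v T (Suc 0)) (?v T 0) = {}"
      unfolding One_nat_def by (rule skew_empty_iff[OF m, symmetric])
    also have "\<dots> \<longleftrightarrow> (\<forall>b\<in>skew l u. 1 \<le> T b)"
      unfolding shape_below_step[OF u l ul T] by (auto simp: Suc_le_eq)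
    finally show ?thesis .
  qed
  have fin: "finite (fillings u l (Suc ?N))" by (rule finite_fillings[OF l])
  then show "finite {T. R T}" by (rule finite_subset[rotated]) (use fill in auto)
  have "(\<Sum>T | R T. \<Prod>i\<in>T ` skew l u. s T i) = (\<Sum>T\<in>fillings u l (Suc ?N). ?W T)"
  proof (rule sum.mono_neutral_cong_left[OF fin])
    show "{T. R T} \<subseteq> fillings u l (Suc ?N)" using fill by auto
    show "\<forall>T\<in>fillings u l (Suc ?N) - {T. R T}. ?W T = 0"
    proof
      fix T assume T: "T \<in> fillings u l (Suc ?N) - {T. R T}"
      then have "\<not> (\<forall>b\<in>skew l u. 1 \<le> T b) \<or> (\<exists>i\<in>{..<?N}. w (ty ! i) (?v T (Suc i)) (?v T (Suc (Suc i))) = 0)"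
        using iff[of T] by blast
      then show "?W T = 0"
      proof
        assume "\<not> (\<forall>b\<in>skew l u. 1 \<le> T b)"
        then show ?thesis using one[of T] T unfolding geom by simp
      next
        assume "\<exists>i\<in>{..<?N}. w (ty ! i) (?v T (Suc i)) (?v T (Suc (Suc i))) = 0"
        then have "(\<Prod>i<?N. w (ty ! i) (?v T (Suc i)) (?v T (Suc (Suc i)))) = 0" by (intro prod_zero) auto
        then show ?thesis unfolding geom by simp
      qed
    qed
    fix T assume "T \<in> {T. R T}"
    then have R: "R T" and T: "T \<in> fillings u l (Suc ?N)" using fill by auto
    have c: "\<forall>b\<in>skew l u. 1 \<le> T b" "\<And>i. i < ?N \<Longrightarrow> w (ty ! i) (?v T (Suc i)) (?v T (Suc (Suc i))) \<noteq> 0"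
      using iff[OF T] R by auto
    \<comment> \<open>The parts are positive, so every label occurs, and a product over the labels
      in use runs over all of them.\<close>
    have "T ` skew l u = Suc ` {..<?N}"
    proof (intro equalityI subsetI)
      fix i assume "i \<in> T ` skew l u"
      then have "1 \<le> i" "i < Suc ?N" using c(1) T by (auto simp: fillings_def)
      then show "i \<in> Suc ` {..<?N}" by (intro image_eqI[of _ _ "i - 1"]) auto
    next
      fix i assume "i \<in> Suc ` {..<?N}"
      then obtain j where j: "i = Suc j" "j < ?N" by auto
      have "card (skew (?v T (Suc i)) (?v T i)) = ty ! j" using size[OF c(2)[OF j(2)]] j by simp
      moreover have "0 < ty ! j" using pos j(2) by simp
      ultimately have "{b \<in> skew l u. T b = i} \<noteq> {}"
        unfolding shape_below_step[OF u l ul T] by (metis card.empty less_irrefl)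
      then show "i \<in> T ` skew l u" by blast
    qed
    then have "(\<Prod>i\<in>T ` skew l u. s T i) = (\<Prod>i<?N. s T (Suc i))"
      by (simp add: prod.reindex)
    also have "\<dots> = ?W T" unfolding geom using one[OF T] c(1) s[OF R] by simp
    finally show "(\<Prod>i\<in>T ` skew l u. s T i) = ?W T" .
  qed
  also have "\<dots> = path_sum (label_weight w (rev (rev ty))) (Suc (length (rev ty))) u l"
    unfolding rev_rev_ident length_rev by (rule sum_fillings_path_sum[OF u l ul])
  also have "\<dots> = step_sum w (rev ty) u l" by (rule path_sum_label_weight[OF u l])
  finally show "(\<Sum>T | R T. \<Prod>i\<in>T ` skew l u. s T i) = step_sum w (rev ty) u l" .
qed

definition special_weight :: "(nat \<Rightarrow> nat) \<Rightarrow> nat \<Rightarrow> (nat \<Rightarrow> nat) \<Rightarrow> (nat \<Rightarrow> nat) \<Rightarrow> int" where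
  "special_weight u n v v' = (if special_step u n v v' then (-1) ^ height (skew v' v) else 0)"

definition good_weight :: "nat \<Rightarrow> nat \<Rightarrow> (nat \<Rightarrow> nat) \<Rightarrow> (nat \<Rightarrow> nat) \<Rightarrow> int" where
  "good_weight k n v v' = (if good_proper_ribbon k v' v \<and> card (skew v' v) = n \<and> (\<forall>i. v' i - v i < k)
     then sgn_good k v' v else 0)"

lemma label_boxes_skew:
  assumes "is_partition u" "is_partition l" "u \<le> l" "T \<in> fillings u l M"
  shows "label_boxes (skew l u) T i = skew (shape_below u l T (Suc i)) (shape_below u l T i)"
  unfolding label_boxes_def shape_below_step[OF assms] ..

lemma upto_boxes_skew:
  assumes "is_partition u" "is_partition l" "u \<le> l" "T \<in> fillings u l M"
  shows "upto_boxes (skew l u) T i = skew (shape_below u l T (Suc i)) u"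
  using in_skew_shape_below[OF assms] by (auto simp: upto_boxes_def)

lemma ball_atLeast1: "(\<forall>i\<in>{1..N}. A i) \<longleftrightarrow> (\<forall>i<N. A (Suc i))"
  unfolding image_Suc_lessThan[symmetric] by auto

lemma special_ribbon_tableaux_sum:
  assumes u: "is_partition u" and l: "is_partition l" and ul: "u \<le> l"
    and ty: "is_composition ty (card (skew l u))"
  shows "(\<Sum>T | special_ribbon_tableau l u ty T. sgn_srt l u T) = step_sum (special_weight u) (rev ty) u l"
    "finite {T. special_ribbon_tableau l u ty T}"
proof -
  let ?R = "special_ribbon_tableau l u ty"
  let ?s = "\<lambda>T i. (-1) ^ height (label_boxes (skew l u) T i) :: int"
  note * = sum_labelled_fillings[where w = "special_weight u" and ty = ty and R = ?R and s = ?s, OF u l ul]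
  have size: "card (skew v' v) = n" if "special_weight u n v v' \<noteq> 0" for n v v'
    using that by (auto simp: special_weight_def special_step_def split: if_splits)
  have pos: "\<forall>n\<in>set ty. 0 < n" using ty by (simp add: is_composition_def)
  have fill: "T \<in> fillings u l (Suc (length ty))" if "?R T" for T
    using that by (auto simp: special_ribbon_tableau_def Let_def fillings_def less_Suc_eq_le)
  have iff: "?R T \<longleftrightarrow> (\<forall>b\<in>skew l u. 1 \<le> T b) \<and>
      (\<forall>i<length ty. special_weight u (ty ! i) (shape_below u l T (Suc i)) (shape_below u l T (Suc (Suc i))) \<noteq> 0)"
    if T: "T \<in> fillings u l (Suc (length ty))" for T
  proof -
    have "special_weight u n v v' \<noteq> 0 \<longleftrightarrow> special_step u n v v'" for n v v' by (simp add: special_weight_def)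
    moreover have "(ribbon (label_boxes (skew l u) T (Suc i)) \<and>
        card (label_boxes (skew l u) T (Suc i)) = ty ! (Suc i - 1) \<and>
        (\<exists>b. southwestmost (label_boxes (skew l u) T (Suc i)) b \<and> southwestmost (upto_boxes (skew l u) T (Suc i)) b))
        \<longleftrightarrow> special_step u (ty ! i) (shape_below u l T (Suc i)) (shape_below u l T (Suc (Suc i)))" for i
      unfolding label_boxes_skew[OF u l ul T] upto_boxes_skew[OF u l ul T] special_step_def by simp
    ultimately show ?thesis
      unfolding special_ribbon_tableau_def Let_def ball_atLeast1 using T ty
      by (auto simp: fillings_def less_Suc_eq_le)
  qed
  have s: "?s T (Suc i) = special_weight u (ty ! i) (shape_below u l T (Suc i)) (shape_below u l T (Suc (Suc i)))"
    if "?R T" "i < length ty" for T i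
    using iff[OF fill[OF that(1)]] that label_boxes_skew[OF u l ul fill[OF that(1)]]
    by (auto simp: special_weight_def split: if_splits)
  show "(\<Sum>T | ?R T. sgn_srt l u T) = step_sum (special_weight u) (rev ty) u l" "finite {T. ?R T}"
    unfolding sgn_srt_def by (rule * ; fact size pos fill iff s)+
qed

lemma good_tableaux_sum:
  assumes v: "is_partition v" and ty: "is_composition ty (card (diagram v))"
  shows "(\<Sum>S | good_proper_ribbon_tableau k v ty S. sgn_gprt k v S) = step_sum (good_weight k) (rev ty) (\<lambda>_. 0) v"
    "finite {S. good_proper_ribbon_tableau k v ty S}"
proof -
  let ?R = "good_proper_ribbon_tableau k v ty" and ?z = "\<lambda>_ :: nat. 0 :: nat"
  let ?s = "\<lambda>S i. sgn_good k (upto_shape v S i) (upto_shape v S (i - 1))"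
  have u: "is_partition ?z" and ul: "?z \<le> v" by (auto simp: le_fun_def)
  note * = sum_labelled_fillings[where w = "good_weight k" and ty = ty and R = ?R and s = ?s, OF u v ul]
  have size: "card (skew v' v) = n" if "good_weight k n v v' \<noteq> 0" for n v v'
    using that by (auto simp: good_weight_def split: if_splits)
  have pos: "\<forall>n\<in>set ty. 0 < n" and sum: "sum_list ty = card (diagram v)" using ty by (auto simp: is_composition_def)
  have up: "upto_shape v S i = shape_below ?z v S (Suc i)" for S i
    by (simp add: upto_shape_def shape_below_def upto_boxes_def less_Suc_eq_le)
  \<comment> \<open>The upper bound for the labels comes from counting: the labels
    \<open>1, ..., length ty\<close> already account for all boxes of the diagram.\<close>
  have fill: "S \<in> fillings ?z v (Suc (length ty))" if R: "?R S" for S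
  proof -
    let ?L = "\<lambda>i. label_boxes (diagram v) S (Suc i)"
    have fin: "finite (diagram v)" by (rule finite_skew[OF v])
    have "card (\<Union>i<length ty. ?L i) = (\<Sum>i<length ty. card (?L i))"
      by (rule card_UN_disjoint) (use fin in \<open>auto simp: label_boxes_def\<close>)
    also have "\<dots> = (\<Sum>i<length ty. ty ! i)"
      using R unfolding good_proper_ribbon_tableau_def Let_def ball_atLeast1 by (intro sum.cong) auto
    also have "\<dots> = card (diagram v)" by (simp add: sum[symmetric] sum_list_sum_nth atLeast0LessThan)
    finally have eq: "(\<Union>i<length ty. ?L i) = diagram v"
      by (intro card_subset_eq[OF fin]) (auto simp: label_boxes_def)
    have "S b < Suc (length ty)" if "b \<in> diagram v" for b
    proof -
      have "b \<in> (\<Union>i<length ty. ?L i)" using that by (simp only: eq)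
      then show ?thesis by (auto simp: label_boxes_def)
    qed
    then show ?thesis using R by (auto simp: good_proper_ribbon_tableau_def Let_def fillings_def)
  qed
  have iff: "?R S \<longleftrightarrow> (\<forall>b\<in>diagram v. 1 \<le> S b) \<and>
      (\<forall>i<length ty. good_weight k (ty ! i) (shape_below ?z v S (Suc i)) (shape_below ?z v S (Suc (Suc i))) \<noteq> 0)"
    if S: "S \<in> fillings ?z v (Suc (length ty))" for S
  proof -
    have nz: "good_weight k n t t' \<noteq> 0 \<longleftrightarrow> good_proper_ribbon k t' t \<and> card (skew t' t) = n \<and> (\<forall>i. t' i - t i < k)" for n t t'
      by (simp add: good_weight_def sgn_good_def sgn_vertical_nonzero)
    have "card {j. (r, j) \<in> skew t' t} = t' r - t r" for r t t'
    proof -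
      have "{j. (r, j) \<in> skew t' t} = {t r..<t' r}" by (auto simp: skew_def)
      then show ?thesis by simp
    qed
    then have "(card (label_boxes (diagram v) S (Suc i)) = ty ! (Suc i - 1) \<and>
        good_proper_ribbon k (upto_shape v S (Suc i)) (upto_shape v S (Suc i - 1)) \<and>
        (\<forall>r. card {j. (r, j) \<in> label_boxes (diagram v) S (Suc i)} < k))
        \<longleftrightarrow> good_weight k (ty ! i) (shape_below ?z v S (Suc i)) (shape_below ?z v S (Suc (Suc i))) \<noteq> 0" for i
      unfolding label_boxes_skew[OF u v ul S] up nz by auto
    then show ?thesis
      unfolding good_proper_ribbon_tableau_def Let_def ball_atLeast1 using S ty
      by (auto simp: fillings_def)
  qed
  have s: "?s S (Suc i) = good_weight k (ty ! i) (shape_below ?z v S (Suc i)) (shape_below ?z v S (Suc (Suc i)))"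
    if "?R S" "i < length ty" for S i
    using iff[OF fill[OF that(1)]] that unfolding up by (auto simp: good_weight_def split: if_splits)
  show "(\<Sum>S | ?R S. sgn_gprt k v S) = step_sum (good_weight k) (rev ty) ?z v" "finite {S. ?R S}"
    unfolding sgn_gprt_def by (rule * ; fact size pos fill iff s)+
qed

section \<open>Compositions and products of Petrie functions\<close>

abbreviation compositions :: "nat \<Rightarrow> nat list set" where
  "compositions m \<equiv> {ns. is_composition ns m}"

lemma finite_compositions: "finite (compositions m)"
proof (rule finite_subset)
  show "compositions m \<subseteq> {ns. set ns \<subseteq> {..m} \<and> length ns \<le> m}"
  proof (clarify, intro conjI subsetI)
    fix ns assume c: "is_composition ns m"
    show "n \<in> {..m}" if "n \<in> set ns" for n using member_le_sum_list[OF that] c by (simp add: is_composition_def)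
    have "(\<forall>n\<in>set ns. 0 < n) \<Longrightarrow> length ns \<le> sum_list ns" by (induction ns) (auto simp: Suc_le_eq intro: add_less_le_mono)
    then show "length ns \<le> m" using c by (simp add: is_composition_def)
  qed
  show "finite {ns. set ns \<subseteq> {..m} \<and> length ns \<le> m}" by (rule finite_lists_length_le) simp
qed

lemma compositions_0: "compositions 0 = {[]}"
proof -
  have "ns = []" if "is_composition ns 0" for ns using that by (cases ns) (auto simp: is_composition_def)
  then show ?thesis by (auto simp: is_composition_def)
qed

lemma sum_compositions:
  assumes "0 < m"
  shows "(\<Sum>ns\<in>compositions m. F ns) = (\<Sum>n\<in>{1..m}. \<Sum>ns\<in>compositions (m - n). F (n # ns))"
proof -
  have "(\<Sum>n\<in>{1..m}. \<Sum>ns\<in>compositions (m - n). F (n # ns)) =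
      (\<Sum>(n, ns)\<in>Sigma {1..m} (\<lambda>n. compositions (m - n)). F (n # ns))"
    by (rule sum.Sigma) (auto simp: finite_compositions)
  also have "\<dots> = (\<Sum>ns\<in>compositions m. F ns)"
  proof (rule sum.reindex_bij_witness[of _ "\<lambda>ns. (hd ns, tl ns)" "\<lambda>(n, ns). n # ns"])
    fix ns assume "ns \<in> compositions m"
    then show "(hd ns, tl ns) \<in> Sigma {1..m} (\<lambda>n. compositions (m - n))"
      "(case (hd ns, tl ns) of (n, ns) \<Rightarrow> n # ns) = ns"
      using assms by (cases ns; auto simp: is_composition_def)+
  qed (auto simp: is_composition_def)
  finally show ?thesis ..
qed

text \<open>Iterates \<open>minor_special_expansion\<close> and records the sizes of the removed
  ribbons. With complete functions for \<open>h\<close> it is the expansion of the Jacobi--Trudi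
  determinant by special rim hook tableaux, known from the inverse Kostka matrix.\<close>

lemma minor_special_tableaux:
  fixes h :: "int \<Rightarrow> 'a::comm_ring_1"
  assumes h: "causal h" and u: "is_partition u"
  shows "is_partition l \<Longrightarrow> u \<le> l \<Longrightarrow> minor h u l =
    (\<Sum>ns\<in>compositions (card (skew l u)). of_int (step_sum (special_weight u) ns u l) * (\<Prod>n\<leftarrow>ns. h (int n)))"
proof (induction "card (skew l u)" arbitrary: l rule: less_induct)
  case less
  let ?z = "step_sum (special_weight u)" and ?h = "\<lambda>ns. \<Prod>n\<leftarrow>ns. h (int n)"
  define m where "m = card (skew l u)"
  show ?case
  proof (cases "u = l")
    case True
    then have "card (skew l u) = 0" using skew_empty_iff[OF less.prems(2)] by simp
    then show ?thesis using True minor_self[OF h u] by (simp add: compositions_0)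
  next
    case False
    have m0: "0 < m"
      unfolding m_def using False skew_empty_iff[OF less.prems(2)] finite_skew[OF less.prems(1)] by (simp add: card_gt_0_iff)
    have "(\<Sum>ns\<in>compositions m. of_int (?z ns u l) * ?h ns) =
        (\<Sum>n\<in>{1..m}. \<Sum>ns\<in>compositions (m - n). \<Sum>v\<in>between u l.
          of_int (special_weight u n v l) * h (int n) * (of_int (?z ns u v) * ?h ns))"
      unfolding sum_compositions[OF m0]
      by (intro sum.cong refl) (simp add: sum_distrib_right sum_distrib_left mult_ac)
    also have "\<dots> = (\<Sum>v\<in>between u l. \<Sum>n\<in>{1..m}. \<Sum>ns\<in>compositions (m - n).
          of_int (special_weight u n v l) * h (int n) * (of_int (?z ns u v) * ?h ns))"
      by (subst (2) sum.swap, subst sum.swap, rule refl)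
    also have "\<dots> = (\<Sum>v\<in>between u l. if special_step u (card (skew l v)) v l
        then (-1) ^ height (skew l v) * h (int (card (skew l v))) * minor h u v else 0)"
    proof (rule sum.cong[OF refl])
      fix v assume "v \<in> between u l"
      then have v: "is_partition v" "u \<le> v" "v \<le> l" by (auto simp: between_def)
      let ?c = "card (skew l v)"
      let ?G = "\<lambda>n. of_int (special_weight u n v l) * h (int n) * (\<Sum>ns\<in>compositions (m - n). of_int (?z ns u v) * ?h ns)"
      have cs: "m = ?c + card (skew v u)"
        using card_skew[OF less.prems(1) v(1,3)] card_skew[OF v(1) u v(2)] card_skew[OF less.prems(1) u less.prems(2)]
        by (simp add: m_def)
      have off: "?G n = 0" if "n \<noteq> ?c \<or> \<not> special_step u ?c v l" for n
        using that by (auto simp: special_weight_def special_step_def)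
      have "(\<Sum>n\<in>{1..m}. ?G n) = (if special_step u ?c v l
        then (-1) ^ height (skew l v) * h (int ?c) * minor h u v else 0)"
      proof (cases "special_step u ?c v l")
        case True
        then have "v \<noteq> l" by (auto simp: special_step_def ribbon_def box_connected_def skew_def)
        then have c0: "0 < ?c"
          using skew_empty_iff[OF v(3)] finite_skew[OF less.prems(1)] by (simp add: card_gt_0_iff)
        have "(\<Sum>n\<in>{1..m}. ?G n) = (\<Sum>n\<in>{?c}. ?G n)"
          by (rule sum.mono_neutral_right) (use c0 cs off in auto)
        also have "\<dots> = ?G ?c" by simp
        also have "m - ?c = card (skew v u)" using cs by simp
        also have "(\<Sum>ns\<in>compositions (card (skew v u)). of_int (?z ns u v) * ?h ns) = minor h u v"
          by (rule less.hyps[symmetric]) (use c0 cs v m_def in auto)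
        also have "special_weight u ?c v l = (-1) ^ height (skew l v)" using True by (simp add: special_weight_def)
        finally show ?thesis using True by simp
      next
        case False
        then show ?thesis using off by (simp only: if_False) (auto intro: sum.neutral)
      qed
      then show "(\<Sum>n\<in>{1..m}. \<Sum>ns\<in>compositions (m - n).
          of_int (special_weight u n v l) * h (int n) * (of_int (?z ns u v) * ?h ns)) =
          (if special_step u ?c v l then (-1) ^ height (skew l v) * h (int ?c) * minor h u v else 0)"
        by (simp only: sum_distrib_left)
    qed
    also have "\<dots> = minor h u l"
      by (rule minor_special_expansion[OF h u less.prems(1,2) False, symmetric])
    finally show ?thesis by (simp add: m_def)
  qed
qed

lemma causal_petrie:
  assumes "0 < k" shows "causal (petrie k)"
  unfolding causal_def
proof (intro conjI allI impI)
  show "petrie k e = 0" if "e < 0" for e using that by (simp add: petrie_def)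
  show "petrie k 0 = 1"
  proof (rule mps_eqI)
    fix a
    have "mdeg a = 0 \<longleftrightarrow> a = 0" by (auto simp: mdeg_def in_keys_iff intro!: poly_mapping_eqI)
    then show "mcoeff (petrie k 0) a = mcoeff 1 a" using assms by (auto simp: mcoeff_petrie mcoeff_1)
  qed
qed

lemma schur_empty: "schur (\<lambda>_. 0) (\<lambda>_. 0) = 1"
proof -
  have "mcoeff (schur (\<lambda>_. 0) (\<lambda>_. 0)) a = mcoeff 1 a" for a
  proof -
    have "{T \<in> ssyt (skew (\<lambda>_. 0) (\<lambda>_. 0)). (\<Sum>b\<in>skew (\<lambda>_. 0) (\<lambda>_. 0). Poly_Mapping.single (T b) 1) = a} =
        (if a = 0 then {\<lambda>_. undefined} else {})"
      by (auto simp: ssyt_def skew_def rows_weakly_inc_def cols_strictly_inc_def)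
    then show ?thesis by (simp add: schur_def mcoeff_1)
  qed
  then show ?thesis by (intro mps_eqI)
qed

text \<open>From an empty inner partition nothing can be removed, and the coefficient of this
  trivial removal is 1.\<close>

lemma petrie_schur_straight:
  assumes k: "0 < k" and l: "is_partition l"
  shows "petrie k (int m) * schur l (\<lambda>_. 0) =
    (\<Sum>r | is_partition r \<and> l \<le> r \<and> card (skew r l) = m. of_int (good_weight k m l r) * schur r (\<lambda>_. 0))"
proof -
  let ?z = "\<lambda>_ :: nat. 0 :: nat"
  have z: "u = ?z" if "u \<le> ?z" for u using that by (auto simp: le_fun_def fun_eq_iff)
  have "petrie k (int m) * schur l ?z =
     (\<Sum>(r, u)\<in>{(r, u). is_partition r \<and> is_partition u \<and> l \<le> r \<and> u \<le> ?z \<and>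
        card (skew r l) + card (skew ?z u) = m}. of_int (minor (petrie_seq_inv k) u ?z * minor (petrie_seq k) l r) * schur r u)"
    unfolding petrie_weight_form[OF k]
    by (rule weight_form_schur[OF causal_petrie_seq[OF k] causal_petrie_seq_inv genfps_petrie_seq_mult_inv[OF k] l]) (auto simp: le_fun_def)
  also have "\<dots> = (\<Sum>r | is_partition r \<and> l \<le> r \<and> card (skew r l) = m. of_int (good_weight k m l r) * schur r ?z)"
  proof (rule sum.reindex_bij_witness[of _ "\<lambda>r. (r, ?z)" fst])
    fix x assume x: "x \<in> {(r, u). is_partition r \<and> is_partition u \<and> l \<le> r \<and> u \<le> ?z \<and>
        card (skew r l) + card (skew ?z u) = m}"
    then obtain r where r: "x = (r, ?z)" "is_partition r" "l \<le> r" "card (skew r l) = m"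
      using z by (fastforce simp: skew_def)
    have "minor (petrie_seq k) l r = good_weight k m l r"
      using minor_petrie[OF l r(2) k] minor_petrie_row_bound[OF l r(2) k] r(4) sgn_vertical_nonzero
      by (auto simp: good_weight_def sgn_good_def)
    then show "of_int (good_weight k m l (fst x)) * schur (fst x) ?z =
        (case x of (r, u) \<Rightarrow> of_int (minor (petrie_seq_inv k) u ?z * minor (petrie_seq k) l r) * schur r u)"
      using minor_self[OF causal_petrie_seq_inv, of ?z k] by (simp add: r(1))
    show "(fst x, ?z) = x" "fst x \<in> {r. is_partition r \<and> l \<le> r \<and> card (skew r l) = m}" using r by auto
  qed (auto simp: skew_def)
  finally show ?thesis .
qed

text \<open>Starting from the empty shape, each factor adds one good proper ribbon with as many
  boxes as its index; the head of the list is the factor multiplied last, matching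
  \<open>step_sum\<close>.\<close>

lemma petrie_product:
  assumes k: "0 < k"
  shows "(\<Prod>n\<leftarrow>ns. petrie k (int n)) =
    (\<Sum>v\<in>partitions_of_size (sum_list ns). of_int (step_sum (good_weight k) ns (\<lambda>_. 0) v) * schur v (\<lambda>_. 0))"
proof (induction ns)
  case Nil
  have "p = (\<lambda>_. 0)" if "is_partition p" "psize p = 0" for p
    using partition_le_psize[OF that(1)] that(2) by (auto simp: fun_eq_iff)
  then have "partitions_of_size 0 = {\<lambda>_. 0}" by (auto simp: partitions_of_size_def)
  then show ?case by (simp add: schur_empty)
next
  case (Cons n ns)
  let ?z = "\<lambda>_ :: nat. 0 :: nat" and ?s = "sum_list ns"
  let ?w = "\<lambda>v. step_sum (good_weight k) ns ?z v"
  let ?A = "\<lambda>v. {r. is_partition r \<and> v \<le> r \<and> card (skew r v) = n}"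
  have finA: "finite (?A v)" if "is_partition v" for v
    by (rule finite_subset[OF _ finite_partitions_bounded[of "n + psize v"]])
      (use card_skew[OF _ that] in force)
  have "(\<Prod>n\<leftarrow>n # ns. petrie k (int n)) =
      (\<Sum>v\<in>partitions_of_size ?s. of_int (?w v) * (petrie k (int n) * schur v ?z))"
    by (simp add: Cons sum_distrib_left mult_ac)
  also have "\<dots> = (\<Sum>v\<in>partitions_of_size ?s. \<Sum>r\<in>?A v. of_int (?w v * good_weight k n v r) * schur r ?z)"
    by (rule sum.cong[OF refl])
      (simp add: petrie_schur_straight[OF k] partitions_of_size_def sum_distrib_left mult.assoc)
  also have "\<dots> = (\<Sum>(v, r)\<in>Sigma (partitions_of_size ?s) ?A. of_int (?w v * good_weight k n v r) * schur r ?z)"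
    by (rule sum.Sigma) (use finite_partitions_of_size finA in \<open>auto simp: partitions_of_size_def\<close>)
  also have "\<dots> = (\<Sum>(r, v)\<in>Sigma (partitions_of_size (n + ?s)) (\<lambda>r. {v \<in> between ?z r. psize v = ?s}).
      of_int (?w v * good_weight k n v r) * schur r ?z)"
  proof (rule sum.reindex_bij_witness[of _ prod.swap prod.swap])
    fix x assume "x \<in> Sigma (partitions_of_size ?s) ?A"
    then obtain v r where x: "x = (v, r)" "is_partition v" "psize v = ?s" "is_partition r" "v \<le> r" "card (skew r v) = n"
      by (auto simp: partitions_of_size_def)
    then show "prod.swap x \<in> Sigma (partitions_of_size (n + ?s)) (\<lambda>r. {v \<in> between ?z r. psize v = ?s})"
      using card_skew[OF x(4,2,5)] by (auto simp: partitions_of_size_def between_def le_fun_def)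
  next
    fix x assume "x \<in> Sigma (partitions_of_size (n + ?s)) (\<lambda>r. {v \<in> between ?z r. psize v = ?s})"
    then obtain v r where x: "x = (r, v)" "is_partition v" "psize v = ?s" "is_partition r" "v \<le> r" "psize r = n + ?s"
      by (auto simp: partitions_of_size_def between_def)
    then show "prod.swap x \<in> Sigma (partitions_of_size ?s) ?A"
      using card_skew[OF x(4,2,5)] by (auto simp: partitions_of_size_def)
  qed auto
  also have "\<dots> = (\<Sum>r\<in>partitions_of_size (n + ?s). \<Sum>v\<in>{v \<in> between ?z r. psize v = ?s}.
      of_int (?w v * good_weight k n v r) * schur r ?z)"
    by (rule sum.Sigma[symmetric])
      (use finite_partitions_of_size finite_between in \<open>auto simp: partitions_of_size_def\<close>)
  also have "\<dots> = (\<Sum>r\<in>partitions_of_size (n + ?s). of_int (step_sum (good_weight k) (n # ns) ?z r) * schur r ?z)"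
  proof (rule sum.cong[OF refl])
    fix r assume "r \<in> partitions_of_size (n + ?s)"
    then have r: "is_partition r" "psize r = n + ?s" by (auto simp: partitions_of_size_def)
    have "(\<Sum>v\<in>{v \<in> between ?z r. psize v = ?s}. ?w v * good_weight k n v r) =
        (\<Sum>v\<in>between ?z r. ?w v * good_weight k n v r)"
    proof (rule sum.mono_neutral_left)
      show "\<forall>v\<in>between ?z r - {v \<in> between ?z r. psize v = ?s}. ?w v * good_weight k n v r = 0"
      proof
        fix v assume "v \<in> between ?z r - {v \<in> between ?z r. psize v = ?s}"
        then have "is_partition v" "v \<le> r" "psize v \<noteq> ?s" by (auto simp: between_def)
        then show "?w v * good_weight k n v r = 0"
          using card_skew[OF r(1), of v] r(2) by (auto simp: good_weight_def)
      qed
    qed (use finite_between[OF r(1)] in auto)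
    then show "(\<Sum>v\<in>{v \<in> between ?z r. psize v = ?s}. of_int (?w v * good_weight k n v r) * schur r ?z) =
        of_int (step_sum (good_weight k) (n # ns) ?z r) * schur r ?z"
      by (simp only: sum_distrib_right[symmetric] of_int_sum[symmetric] step_sum.simps)
  qed
  finally show ?case by simp
qed

text \<open>Every label is in use, so the number of labels and the size of each layer can be read
  off the tableau. Hence the pairs in the third formula fall into disjoint classes by type.\<close>

lemma special_ribbon_tableau_type_unique:
  assumes "special_ribbon_tableau l u ty T" "special_ribbon_tableau l u ty' T"
  shows "ty = ty'"
proof -
  let ?B = "skew l u"
  have len: "T ` ?B = {1..length t}" if s: "special_ribbon_tableau l u t T" for t
  proof
    show "T ` ?B \<subseteq> {1..length t}" using s by (auto simp: special_ribbon_tableau_def Let_def)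
    show "{1..length t} \<subseteq> T ` ?B"
    proof
      fix i assume "i \<in> {1..length t}"
      then have "ribbon (label_boxes ?B T i)" using s unfolding special_ribbon_tableau_def Let_def by blast
      then have "label_boxes ?B T i \<noteq> {}" by (auto simp: ribbon_def box_connected_def)
      then show "i \<in> T ` ?B" by (auto simp: label_boxes_def)
    qed
  qed
  have "{1..length ty} = {1..length ty'}" by (rule trans[OF len[OF assms(1), symmetric] len[OF assms(2)]])
  then have "card {1..length ty} = card {1..length ty'}" by (rule arg_cong)
  then have "length ty = length ty'" by simp
  then show ?thesis
  proof (rule nth_equalityI)
    fix i assume i: "i < length ty"
    have "card (label_boxes ?B T (Suc i)) = t ! i" if "special_ribbon_tableau l u t T" "i < length t" for t
      using that unfolding special_ribbon_tableau_def Let_def ball_atLeast1 by auto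
    then show "ty ! i = ty' ! i" using assms i \<open>length ty = length ty'\<close> by metis
  qed
qed

theorem modular_schur_expansion:
  assumes k: "1 \<le> k" and l: "is_partition l" and u: "is_partition u" and ul: "u \<le> l"
  shows "modular_schur k l u =
    (\<Sum>v | is_partition v \<and> card (diagram v) = card (skew l u).
      \<Sum>(T, S) \<in> {(T, S). \<exists>ty. special_ribbon_tableau l u ty T \<and> good_proper_ribbon_tableau k v ty S}.
        of_int (sgn_srt l u T * sgn_gprt k v S) * schur v (\<lambda>_. 0))"
proof -
  have k0: "0 < k" using k by simp
  let ?m = "card (skew l u)" and ?z = "\<lambda>_ :: nat. 0 :: nat"
  let ?SRT = "\<lambda>ty. {T. special_ribbon_tableau l u ty T}"
  let ?GPT = "\<lambda>v ty. {S. good_proper_ribbon_tableau k v ty S}"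
  have sizes: "{v. is_partition v \<and> card (diagram v) = ?m} = partitions_of_size ?m"
    using card_diagram by (auto simp: partitions_of_size_def)
  have inner: "(\<Sum>(T, S) \<in> {(T, S). \<exists>ty. special_ribbon_tableau l u ty T \<and> good_proper_ribbon_tableau k v ty S}.
        of_int (sgn_srt l u T * sgn_gprt k v S) * schur v ?z) =
      (\<Sum>ty\<in>compositions ?m. of_int (step_sum (special_weight u) (rev ty) u l) *
        (of_int (step_sum (good_weight k) (rev ty) ?z v) * schur v ?z))"
    if v: "is_partition v" "card (diagram v) = ?m" for v
  proof -
    have un: "{(T, S). \<exists>ty. special_ribbon_tableau l u ty T \<and> good_proper_ribbon_tableau k v ty S} =
        (\<Union>ty\<in>compositions ?m. ?SRT ty \<times> ?GPT v ty)"
      by (auto simp: special_ribbon_tableau_def Let_def)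
    have "(\<Sum>(T, S) \<in> {(T, S). \<exists>ty. special_ribbon_tableau l u ty T \<and> good_proper_ribbon_tableau k v ty S}.
        of_int (sgn_srt l u T * sgn_gprt k v S) * schur v ?z) =
      (\<Sum>ty\<in>compositions ?m. \<Sum>(T, S)\<in>?SRT ty \<times> ?GPT v ty. of_int (sgn_srt l u T * sgn_gprt k v S) * schur v ?z)"
      unfolding un
    proof (rule sum.UNION_disjoint)
      show "\<forall>ty\<in>compositions ?m. finite (?SRT ty \<times> ?GPT v ty)"
        using special_ribbon_tableaux_sum(2)[OF u l ul] good_tableaux_sum(2)[OF v(1)] v(2)
        by (intro ballI finite_cartesian_product) auto
      show "\<forall>ty\<in>compositions ?m. \<forall>ty'\<in>compositions ?m. ty \<noteq> ty' \<longrightarrow> (?SRT ty \<times> ?GPT v ty) \<inter> (?SRT ty' \<times> ?GPT v ty') = {}"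
        by (auto dest: special_ribbon_tableau_type_unique)
    qed (rule finite_compositions)
    also have "\<dots> = (\<Sum>ty\<in>compositions ?m. of_int (step_sum (special_weight u) (rev ty) u l) *
        (of_int (step_sum (good_weight k) (rev ty) ?z v) * schur v ?z))"
    proof (rule sum.cong[OF refl])
      fix ty assume "ty \<in> compositions ?m"
      then have ty: "is_composition ty ?m" "is_composition ty (card (diagram v))" using v(2) by auto
      have "(\<Sum>(T, S)\<in>?SRT ty \<times> ?GPT v ty. of_int (sgn_srt l u T * sgn_gprt k v S) * schur v ?z) =
          (\<Sum>T\<in>?SRT ty. \<Sum>S\<in>?GPT v ty. of_int (sgn_srt l u T) * (of_int (sgn_gprt k v S) * schur v ?z))"
        by (subst sum.cartesian_product[symmetric]) (simp add: mult.assoc)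
      also have "\<dots> = of_int (\<Sum>T\<in>?SRT ty. sgn_srt l u T) * (of_int (\<Sum>S\<in>?GPT v ty. sgn_gprt k v S) * schur v ?z)"
        by (simp only: of_int_sum sum_distrib_right) (simp only: sum_distrib_left)
      finally show "(\<Sum>(T, S)\<in>?SRT ty \<times> ?GPT v ty. of_int (sgn_srt l u T * sgn_gprt k v S) * schur v ?z) =
          of_int (step_sum (special_weight u) (rev ty) u l) * (of_int (step_sum (good_weight k) (rev ty) ?z v) * schur v ?z)"
        unfolding special_ribbon_tableaux_sum(1)[OF u l ul ty(1)] good_tableaux_sum(1)[OF v(1) ty(2)] .
    qed
    finally show ?thesis .
  qed
  have "modular_schur k l u = toep (plength l) (petrie k) u l"
    unfolding modular_schur_def toep_def by (rule dt_cong) (simp add: bead_def algebra_simps)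
  also have "\<dots> = minor (petrie k) u l"
    by (rule minor_toep[OF causal_petrie[OF k0] u l plength_mono[OF u l ul] order_refl, symmetric])
  also have "\<dots> = (\<Sum>ns\<in>compositions ?m. of_int (step_sum (special_weight u) ns u l) * (\<Prod>n\<leftarrow>ns. petrie k (int n)))"
    by (rule minor_special_tableaux[OF causal_petrie[OF k0] u l ul])
  also have "\<dots> = (\<Sum>ns\<in>compositions ?m. \<Sum>v\<in>partitions_of_size ?m. of_int (step_sum (special_weight u) ns u l) *
        (of_int (step_sum (good_weight k) ns ?z v) * schur v ?z))"
    by (rule sum.cong[OF refl]) (simp add: petrie_product[OF k0] is_composition_def sum_distrib_left)
  also have "\<dots> = (\<Sum>v\<in>partitions_of_size ?m. \<Sum>ns\<in>compositions ?m. of_int (step_sum (special_weight u) ns u l) *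
        (of_int (step_sum (good_weight k) ns ?z v) * schur v ?z))"
    by (rule sum.swap)
  \<comment> \<open>Reversal permutes the compositions and restores the order in which types are
    listed.\<close>
  also have "\<dots> = (\<Sum>v\<in>partitions_of_size ?m. \<Sum>ty\<in>compositions ?m. of_int (step_sum (special_weight u) (rev ty) u l) *
        (of_int (step_sum (good_weight k) (rev ty) ?z v) * schur v ?z))"
    by (rule sum.cong[OF refl], rule sum.reindex_bij_witness[of _ rev rev]) (auto simp: is_composition_def)
  also have "\<dots> = (\<Sum>v | is_partition v \<and> card (diagram v) = ?m.
      \<Sum>(T, S) \<in> {(T, S). \<exists>ty. special_ribbon_tableau l u ty T \<and> good_proper_ribbon_tableau k v ty S}.
        of_int (sgn_srt l u T * sgn_gprt k v S) * schur v ?z)"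
    unfolding sizes[symmetric] by (rule sum.cong[OF refl], rule inner[symmetric]) auto
  finally show ?thesis .
qed

theorem theorem5:
  shows
    "(\<forall>k n lam \<eta>.
        n \<ge> 1 \<and> is_partition lam \<and> is_partition \<eta> \<and> \<eta> \<le> lam \<longrightarrow>
        p_plethysm n (hsym k) * schur lam \<eta> =
          (\<Sum>(\<rho>, \<mu>) \<in> {(\<rho>, \<mu>). is_partition \<rho> \<and> is_partition \<mu> \<and> lam \<le> \<rho> \<and> \<mu> \<le> \<eta> \<and>
               (\<exists>w w'. horizontal_ribbon n \<rho> lam w \<and>
                       horizontal_ribbon n (conj_part \<eta>) (conj_part \<mu>) w' \<and> w + w' = k)}.
             of_int ((-1) ^ card (skew \<eta> \<mu>) * sgn_ribbon n \<rho> lam *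
                     sgn_ribbon n (conj_part \<eta>) (conj_part \<mu>)) * schur \<rho> \<mu>))
     \<and>
     (\<forall>k m lam \<eta>.
        k \<ge> 1 \<and> is_partition lam \<and> is_partition \<eta> \<and> \<eta> \<le> lam \<longrightarrow>
        petrie k (int m) * schur lam \<eta> =
          (\<Sum>(\<rho>, \<mu>) \<in> {(\<rho>, \<mu>). is_partition \<rho> \<and> is_partition \<mu> \<and> lam \<le> \<rho> \<and> \<mu> \<le> \<eta> \<and>
               card (skew \<rho> lam) + card (skew \<eta> \<mu>) = m \<and>
               good_proper_ribbon k \<rho> lam \<and>
               good_proper_ribbon k (conj_part \<eta>) (conj_part \<mu>) \<and>
               (\<forall>i. \<rho> i - lam i < k) \<and> (\<forall>i. conj_part \<eta> i - conj_part \<mu> i < k)}.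
             of_int ((-1) ^ card (skew \<eta> \<mu>) * sgn_good k \<rho> lam *
                     sgn_good k (conj_part \<eta>) (conj_part \<mu>)) * schur \<rho> \<mu>))
     \<and>
     (\<forall>k lam \<mu>.
        k \<ge> 1 \<and> is_partition lam \<and> is_partition \<mu> \<and> \<mu> \<le> lam \<longrightarrow>
        modular_schur k lam \<mu> =
          (\<Sum>\<nu> | is_partition \<nu> \<and> card (diagram \<nu>) = card (skew lam \<mu>).
            \<Sum>(T, S) \<in> {(T, S). \<exists>ty. special_ribbon_tableau lam \<mu> ty T \<and>
                                     good_proper_ribbon_tableau k \<nu> ty S}.
              of_int (sgn_srt lam \<mu> T * sgn_gprt k \<nu> S) * schur \<nu> (\<lambda>_. 0)))"
  by (intro conjI allI impI; elim conjE; (rule plethysm_schur petrie_schur modular_schur_expansion; assumption))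

end
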